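(* Let $n\ge 1$ and let $f$ be a homogeneous symmetric function of degree $n$ with rational coefficients. Let $s_{\tau_n}$ and $s_{\tau'_n}$ be the ribbon Schur functions defined in the context. If $n$ is odd, then $$\langle f,s_{\tau_n}\rangle=\langle f,s_{\tau'_n}\rangle=f[E,0,-E,0,E,0,-E,0,\dots].$$ If $n$ is even, then $$\langle f,s_{\tau_n}\rangle=f[E,-1,-E,1,E,-1,-E,1,\dots],\qquad \langle f,s_{\tau'_n}\rangle=f[E,1,-E,-1,E,1,-E,-1,\dots].$$ The right-hand sides are evaluated umbrally.
   Context: $\langle\cdot,\cdot\rangle$ is the Hall inner product on symmetric functions, for which the Schur functions are orthonormal; $h_i$ is the complete homogeneous symmetric function and $p_i$ the power sum. For a composition $\alpha=(\alpha_1,\dots,\alpha_k)$ of $n$, let $s_{B_\alpha}=\sum_\beta (-1)^{k-\ell(\beta)}h_{\beta_1}h_{\beta_2}\cdots h_{\beta_{\ell(\beta)}}$, summed over all compositions $\beta$ of $n$ obtained from $\alpha$ by merging adjacent parts (including $\beta=\alpha$); this is the skew Schur function of the border strip (ribbon) with row lengths $\alpha$. Let $s_{\tau_n}=s_{B_\alpha}$ with $\alpha=(1,2,2,\dots,2,j)$, where $j=1$ if $n$ is even and $j=2$ if $n$ is odd (the descent composition of an alternating permutation of $[n]$); let $s_{\tau'_n}=s_{B_\beta}$ with $\beta=(2,2,\dots,2)$ if $n$ is even and $\beta=(2,2,\dots,2,1)$ if $n$ is odd (the descent composition of a reverse alternating permutation). Euler numbers $E_n$ are defined by $\sum_{n\ge0}E_nx^n/n!=\sec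 x+\tan x$. Substitution notation: for a symmetric function $f$, $f[a_1,a_2,\dots]$ means write $f$ as a polynomial in $p_1,p_2,\dots$ and set $p_i=a_i$. Thus $[E,0,-E,0,\dots]$ means $p_{2j+1}=(-1)^jE$, $p_{2j}=0$; $[E,-1,-E,1,\dots]$ means $p_{2j+1}=(-1)^jE$, $p_{2j}=(-1)^j$; $[E,1,-E,-1,\dots]$ means $p_{2j+1}=(-1)^jE$, $p_{2j}=(-1)^{j+1}$. Umbral evaluation: the resulting polynomial in the indeterminate $E$ is expanded in powers of $E$ and then, as the last step, each $E^k$ is replaced by $E_k$. *)

theory Defs
  imports
    "HOL-Library.Poly_Mapping"
    "HOL-Library.FuncSet"
    "HOL-Computational_Algebra.Computational_Algebra"
begin

section \<open>Formal power series over the rationals in countably many variables\<close>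

text \<open>A monomial in the variables \<open>x\<^sub>0, x\<^sub>1, \<dots>\<close> is its finitely supported exponent function.\<close>

typedef mseries = "UNIV :: ((nat \<Rightarrow>\<^sub>0 nat) \<Rightarrow> rat) set"
  morphisms mcoeff Abs_mseries ..

lemma mcoeff_Abs [simp]: "mcoeff (Abs_mseries c) = c"
  by (simp add: Abs_mseries_inverse)

lemma mseries_eqI: "(\<And>m. mcoeff f m = mcoeff g m) \<Longrightarrow> f = g"
  by (metis ext mcoeff_inject)

definition splits :: "(nat \<Rightarrow>\<^sub>0 nat) \<Rightarrow> ((nat \<Rightarrow>\<^sub>0 nat) \<times> (nat \<Rightarrow>\<^sub>0 nat)) set" where
  "splits m = {(a, b). a + b = m}"

lemma finite_splits [simp]: "finite (splits m)"
proof -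
  define A where "A = {a. \<exists>b. a + b = m}"
  have inj: "inj_on (\<lambda>a. restrict (Poly_Mapping.lookup a) (Poly_Mapping.keys m)) A"
  proof (rule inj_onI)
    fix a a' assume a: "a \<in> A" "a' \<in> A"
      and eq: "restrict (Poly_Mapping.lookup a) (Poly_Mapping.keys m) =
               restrict (Poly_Mapping.lookup a') (Poly_Mapping.keys m)"
    have 0: "Poly_Mapping.lookup c i = 0" if "c \<in> A" "i \<notin> Poly_Mapping.keys m" for c i
      using that by (auto simp: A_def in_keys_iff lookup_add)
    show "a = a'"
    proof (rule poly_mapping_eqI)
      fix i show "Poly_Mapping.lookup a i = Poly_Mapping.lookup a' i"
        using 0 a eq by (cases "i \<in> Poly_Mapping.keys m") (auto dest: fun_cong[where x = i])
    qed
  qed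
  have "(\<lambda>a. restrict (Poly_Mapping.lookup a) (Poly_Mapping.keys m)) ` A
          \<subseteq> (\<Pi>\<^sub>E i\<in>Poly_Mapping.keys m. {..Poly_Mapping.lookup m i})"
    by (auto simp: A_def lookup_add)
  hence fin: "finite A"
    by (intro finite_imageD[OF _ inj]) (rule finite_subset, assumption, simp add: finite_PiE)
  have "splits m \<subseteq> A \<times> A"
    by (auto simp: splits_def A_def) (metis add.commute)
  thus ?thesis using fin finite_subset by blast
qed

instantiation mseries :: comm_ring_1
begin

definition "0 = Abs_mseries (\<lambda>_. 0)"
definition "1 = Abs_mseries (\<lambda>m. if m = 0 then 1 else 0)"
definition "f + g = Abs_mseries (\<lambda>m. mcoeff f m + mcoeff g m)"
definition "f - g = Abs_mseries (\<lambda>m. mcoeff f m - mcoeff g m)"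
definition "- f = Abs_mseries (\<lambda>m. - mcoeff f m)"
definition "f * g = Abs_mseries (\<lambda>m. \<Sum>(a, b)\<in>splits m. mcoeff f a * mcoeff g b)"

instance
proof
  fix f g h :: mseries
  show "f * g * h = f * (g * h)"
  proof (rule mseries_eqI)
    fix m
    have "mcoeff (f * g * h) m =
      (\<Sum>(d, c)\<in>splits m. \<Sum>(a, b)\<in>splits d. mcoeff f a * mcoeff g b * mcoeff h c)"
      by (simp add: times_mseries_def sum_distrib_right case_prod_unfold)
    also have "\<dots> = (\<Sum>((d, c), (a, b))\<in>Sigma (splits m) (\<lambda>(d, c). splits d).
        mcoeff f a * mcoeff g b * mcoeff h c)"
      by (simp add: sum.Sigma case_prod_unfold)
    also have "\<dots> = (\<Sum>((a, d), (b, c))\<in>Sigma (splits m) (\<lambda>(a, d). splits d).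
        mcoeff f a * mcoeff g b * mcoeff h c)"
      by (rule sum.reindex_bij_witness[where
            j = "\<lambda>((d, c), (a, b)). ((a, b + c), (b, c))" and
            i = "\<lambda>((a, d), (b, c)). ((a + b, c), (a, b))"])
         (auto simp: splits_def add.assoc)
    also have "\<dots> =
      (\<Sum>(a, d)\<in>splits m. \<Sum>(b, c)\<in>splits d. mcoeff f a * mcoeff g b * mcoeff h c)"
      by (simp add: sum.Sigma case_prod_unfold)
    also have "\<dots> = mcoeff (f * (g * h)) m"
      by (simp add: times_mseries_def sum_distrib_left case_prod_unfold mult.assoc)
    finally show "mcoeff (f * g * h) m = mcoeff (f * (g * h)) m" .
  qed
  show "f * g = g * f"
  proof (rule mseries_eqI)
    fix m
    show "mcoeff (f * g) m = mcoeff (g * f) m"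
      unfolding times_mseries_def mcoeff_Abs
      by (rule sum.reindex_bij_witness[where i = prod.swap and j = prod.swap])
         (auto simp: splits_def add.commute mult.commute)
  qed
  show "1 * f = f"
  proof (rule mseries_eqI)
    fix m
    have "mcoeff (1 * f) m =
      (\<Sum>(a, b)\<in>splits m. (if a = 0 then 1 else 0) * mcoeff f b)"
      by (simp add: times_mseries_def one_mseries_def)
    also have "\<dots> = (\<Sum>(a, b)\<in>{(0 :: nat \<Rightarrow>\<^sub>0 nat, m)}. (if a = 0 then 1 else 0) * mcoeff f b)"
      by (rule sum.mono_neutral_right[OF finite_splits]) (auto simp: splits_def split: if_splits)
    finally show "mcoeff (1 * f) m = mcoeff f m" by simp
  qed
  show "(f + g) * h = f * h + g * h"
    by (rule mseries_eqI)
       (simp add: times_mseries_def plus_mseries_def case_prod_unfold distrib_right sum.distrib)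
  have "mcoeff (0 :: mseries) 0 \<noteq> mcoeff 1 0"
    by (simp add: zero_mseries_def one_mseries_def)
  thus "(0 :: mseries) \<noteq> 1" by metis
qed (auto intro!: mseries_eqI
      simp: plus_mseries_def minus_mseries_def uminus_mseries_def zero_mseries_def)

end

definition mconst :: "rat \<Rightarrow> mseries" where
  "mconst c = Abs_mseries (\<lambda>m. if m = 0 then c else 0)"

definition total_degree :: "(nat \<Rightarrow>\<^sub>0 nat) \<Rightarrow> nat" where
  "total_degree m = (\<Sum>i\<in>Poly_Mapping.keys m. Poly_Mapping.lookup m i)"


section \<open>Symmetric functions\<close>

definition homogeneous_symmetric :: "nat \<Rightarrow> mseries set" where
  "homogeneous_symmetric n = {f.
     (\<forall>m. mcoeff f m \<noteq> 0 \<longrightarrow> total_degree m = n) \<and>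
     (\<forall>\<pi> m. bij \<pi> \<longrightarrow> mcoeff f (Poly_Mapping.map_key \<pi> m) = mcoeff f m)}"

definition complete_sym :: "nat \<Rightarrow> mseries" where
  "complete_sym k = Abs_mseries (\<lambda>m. if total_degree m = k then 1 else 0)"

definition power_sum :: "nat \<Rightarrow> mseries" where
  "power_sum k = Abs_mseries (\<lambda>m. if \<exists>i. m = Poly_Mapping.single i k then 1 else 0)"

definition is_partition :: "nat list \<Rightarrow> bool" where
  "is_partition l \<longleftrightarrow> sorted_wrt (\<ge>) l \<and> 0 \<notin> set l"

definition cells :: "nat list \<Rightarrow> (nat \<times> nat) set" where
  "cells l = {(r, c). r < length l \<and> c < l ! r}"

text \<open>Semistandard tableaux have entries in \<open>{0, 1, \<dots>}\<close>, matching the indexing of the variables.\<close>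

definition ssyt :: "nat list \<Rightarrow> (nat \<times> nat \<Rightarrow> nat) set" where
  "ssyt l = {T \<in> extensional (cells l).
     (\<forall>r c c'. c < c' \<and> (r, c) \<in> cells l \<and> (r, c') \<in> cells l \<longrightarrow> T (r, c) \<le> T (r, c')) \<and>
     (\<forall>r r' c. r < r' \<and> (r, c) \<in> cells l \<and> (r', c) \<in> cells l \<longrightarrow> T (r, c) < T (r', c))}"

definition schur :: "nat list \<Rightarrow> mseries" where
  "schur l = Abs_mseries (\<lambda>m. of_nat (card {T \<in> ssyt l.
     \<forall>i. card {x \<in> cells l. T x = i} = Poly_Mapping.lookup m i}))"


section \<open>The Hall inner product\<close>

text \<open>The bilinear form for which the Schur functions are orthonormal: expand both arguments
  in the Schur basis and take the dot product of the coefficients.\<close>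

definition is_schur_expansion :: "mseries \<Rightarrow> (nat list \<Rightarrow> rat) \<Rightarrow> bool" where
  "is_schur_expansion f c \<longleftrightarrow>
     finite {l. c l \<noteq> 0} \<and> (\<forall>l. c l \<noteq> 0 \<longrightarrow> is_partition l) \<and>
     f = (\<Sum>l | c l \<noteq> 0. mconst (c l) * schur l)"

definition schur_coeffs :: "mseries \<Rightarrow> nat list \<Rightarrow> rat" where
  "schur_coeffs f = (THE c. is_schur_expansion f c)"

definition hall_inner :: "mseries \<Rightarrow> mseries \<Rightarrow> rat" where
  "hall_inner f g = (\<Sum>l | schur_coeffs f l \<noteq> 0. schur_coeffs f l * schur_coeffs g l)"


section \<open>Ribbon Schur functions\<close>

text \<open>Compositions are lists of positive numbers. A coarsening cuts the list into nonempty
  consecutive blocks and replaces each block by its sum.\<close>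

definition coarsenings :: "nat list \<Rightarrow> nat list set" where
  "coarsenings \<alpha> = {map sum_list bs |bs. concat bs = \<alpha> \<and> [] \<notin> set bs}"

definition ribbon_schur :: "nat list \<Rightarrow> mseries" where
  "ribbon_schur \<alpha> =
     (\<Sum>\<beta>\<in>coarsenings \<alpha>. (-1) ^ (length \<alpha> - length \<beta>) * prod_list (map complete_sym \<beta>))"

text \<open>For \<open>n = 1\<close> both compositions below are \<open>[1]\<close>.\<close>

definition alternating_comp :: "nat \<Rightarrow> nat list" where
  "alternating_comp n =
     (if even n then 1 # replicate ((n - 2) div 2) 2 @ [1]
      else 1 # replicate ((n - 1) div 2) 2)"

definition reverse_alternating_comp :: "nat \<Rightarrow> nat list" where
  "reverse_alternating_comp n =
     (if even n then replicate (n div 2) 2 else replicate ((n - 1) div 2) 2 @ [1])"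


section \<open>Substitution for the power sums and umbral evaluation\<close>

text \<open>Elements of \<open>(nat \<Rightarrow>\<^sub>0 nat) \<Rightarrow>\<^sub>0 rat\<close> are polynomials over the rationals in countably many
  variables. Below, variable number \<open>i\<close> stands for \<open>p\<^sub>i\<close>, so variable \<open>0\<close> must not occur.
  The map \<open>C\<close> embeds the coefficients into the target ring.\<close>

definition eval_mpoly ::
  "(rat \<Rightarrow> 'a) \<Rightarrow> (nat \<Rightarrow> 'a) \<Rightarrow> ((nat \<Rightarrow>\<^sub>0 nat) \<Rightarrow>\<^sub>0 rat) \<Rightarrow> 'a::comm_ring_1" where
  "eval_mpoly C a P = (\<Sum>m\<in>Poly_Mapping.keys P. C (Poly_Mapping.lookup P m) *
     (\<Prod>i\<in>Poly_Mapping.keys m. a i ^ Poly_Mapping.lookup m i))"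

definition power_sum_poly :: "mseries \<Rightarrow> ((nat \<Rightarrow>\<^sub>0 nat) \<Rightarrow>\<^sub>0 rat)" where
  "power_sum_poly f = (THE P. (\<forall>m\<in>Poly_Mapping.keys P. 0 \<notin> Poly_Mapping.keys m) \<and>
     eval_mpoly mconst power_sum P = f)"

text \<open>Polynomials in the umbral indeterminate \<open>E\<close> have type \<open>rat poly\<close>.\<close>

definition power_sum_subst :: "mseries \<Rightarrow> (nat \<Rightarrow> rat poly) \<Rightarrow> rat poly" where
  "power_sum_subst f a = eval_mpoly (\<lambda>c. [:c:]) a (power_sum_poly f)"

definition euler_number :: "nat \<Rightarrow> rat" where
  "euler_number n = fact n * fps_nth (inverse (fps_cos 1) + fps_tan 1) n"

definition umbral :: "rat poly \<Rightarrow> rat" where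
  "umbral q = (\<Sum>k\<le>Polynomial.degree q. Polynomial.coeff q k * euler_number k)"

text \<open>The sequences \<open>[E, 0, -E, 0, \<dots>]\<close>, \<open>[E, -1, -E, 1, \<dots>]\<close> and \<open>[E, 1, -E, -1, \<dots>]\<close>,
  indexed from \<open>1\<close>.\<close>

definition seq_zero :: "nat \<Rightarrow> rat poly" where
  "seq_zero i = (if odd i then (-1) ^ (i div 2) * [:0, 1:] else 0)"

definition seq_minus :: "nat \<Rightarrow> rat poly" where
  "seq_minus i = (if odd i then (-1) ^ (i div 2) * [:0, 1:] else (-1) ^ (i div 2))"

definition seq_plus :: "nat \<Rightarrow> rat poly" where
  "seq_plus i = (if odd i then (-1) ^ (i div 2) * [:0, 1:] else (-1) ^ (i div 2 + 1))"

end

theory Submission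
  imports Defs "HOL-Combinatorics.List_Permutation"
begin

text \<open>
  The Pieri rule, obtained from Fomin's local rule, gives \<open>h\<^sub>\<beta> = \<Sum>\<^sub>\<lambda> K\<^sub>\<lambda>\<^sub>\<beta> s\<^sub>\<lambda>\<close>. Hence Schur functions are
  symmetric, form a basis by triangularity of the Kostka matrix, and \<open>\<langle>f, h\<^sub>\<beta>\<rangle>\<close> is the coefficient
  of \<open>x\<^sup>\<beta>\<close> in \<open>f\<close>. So \<open>\<langle>f, s\<^bsub>B\<^sub>\<alpha>\<^esub>\<rangle>\<close> is an alternating sum of coefficients of \<open>f\<close> over the coarsenings
  of \<open>\<alpha>\<close>, and by linearity \<open>f\<close> may be taken to be a product of power sums.

  For \<open>f = \<Prod>\<^sub>j p\<^bsub>w j\<^esub>\<close> the coefficient of \<open>x\<^sup>\<beta>\<close> counts the ordered set partitions of the index set whose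
  blocks have weights \<open>\<beta>\<^sub>1, \<beta>\<^sub>2, \<dots>\<close>. With \<open>a\<close> odd and \<open>b\<close> even weights, marked by \<open>x\<close> and \<open>y\<close>, the blocks of
  even weight have exponential generating function \<open>cosh x e\<^sup>y\<close> and those of odd weight \<open>sinh x e\<^sup>y\<close>.
  Up to a global sign, the alternating sums for \<open>(2, \<dots>, 2)\<close>, \<open>(1, 2, \<dots>, 2)\<close> and \<open>(1, 2, \<dots>, 2, 1)\<close> are therefore
  the coefficients of \<open>sech x e\<^sup>-\<^sup>y\<close>, \<open>tanh x\<close> and \<open>sech x e\<^sup>y\<close>, that is, signed Euler numbers.
\<close>

section \<open>Triangular systems\<close>

text \<open>\<open>schur_coeffs\<close> and \<open>power_sum_poly\<close> are definite descriptions,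
  so neither the Hall product nor the substitution can be computed before existence and uniqueness
  of both expansions are available; hence two full triangularity arguments. A second obstacle is
  that \<open>schur\<close> is defined by tableaux, which do not show symmetry. The Pieri rule is
  therefore proved coefficientwise, without assuming symmetry, and inverting the Kostka matrix then
  writes each Schur function in products of \<open>complete_sym\<close>.

  The three generating functions come from splitting off the first block. The alternating geometric
  series over even blocks is 1 / (cosh x e^y); an initial odd block multiplies it by sinh x e^y; for
  (1, 2, ..., 2, 1) everything may also form one block, and e^y cosh x - e^y sinh x tanh x = e^y
  sech x. The even weights thus see e^-y, nothing or e^y, which explains the even entries of
  \<open>seq_plus\<close>, \<open>seq_zero\<close> and \<open>seq_minus\<close>.\<close>

lemma triangular_system_solvable:
  fixes K :: "'a \<Rightarrow> 'a \<Rightarrow> 'b::field" and r :: "'a \<Rightarrow> int"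
  assumes "finite S" "\<And>x. x \<in> S \<Longrightarrow> K x x \<noteq> 0"
    and "\<And>x y. x \<in> S \<Longrightarrow> y \<in> S \<Longrightarrow> K x y \<noteq> 0 \<Longrightarrow> x \<noteq> y \<Longrightarrow> r y < r x"
  shows "\<exists>c. \<forall>y\<in>S. (\<Sum>x\<in>S. c x * K x y) = b y"
  using assms
proof (induction S rule: finite_ranking_induct[where f = "\<lambda>x. - r x"])
  case empty
  show ?case by simp
next
  case (insert x S)
  show ?case
  proof (cases "x \<in> S")
    case True
    then show ?thesis using insert by (simp add: insert_absorb)
  next
    case False
    obtain c where c: "\<forall>y\<in>S. (\<Sum>x\<in>S. c x * K x y) = b y"
      using insert.IH insert.prems by auto
    \<comment> \<open>The ranking induction inserts an \<open>x\<close> of minimal rank, so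
      \<open>K x\<close> vanishes on \<open>S\<close>: the value chosen at \<open>x\<close> disturbs
      no equation of \<open>S\<close> and is fixed by the equation at \<open>x\<close>
      alone.\<close>
    have K0: "K x y = 0" if "y \<in> S" for y
      using insert.prems(2)[of x y] insert.hyps(2)[OF that] that False by force
    define d where "d = c(x := (b x - (\<Sum>z\<in>S. c z * K z x)) / K x x)"
    have d: "(\<Sum>z\<in>S. d z * K z y) = (\<Sum>z\<in>S. c z * K z y)" for y
      using False by (intro sum.cong) (auto simp: d_def)
    have "(\<Sum>z\<in>insert x S. d z * K z y) = b y" if "y \<in> insert x S" for y
    proof (cases "y = x")
      case True
      have "d x * K x x = b x - (\<Sum>z\<in>S. c z * K z x)"
        using insert.prems(1)[of x] by (simp add: d_def)
      then show ?thesis using False True insert.hyps by (simp add: d)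
    next
      case False
      then show ?thesis using \<open>x \<notin> S\<close> that insert.hyps c K0 by (simp add: d)
    qed
    then show ?thesis by blast
  qed
qed

text \<open>Equations at points of \<open>S\<close> do not see an inserted element of minimal rank,
  so its coefficient is killed last, by its diagonal entry. The index set is arbitrary because two
  expansions to be compared may mix degrees.\<close>

lemma triangular_system_unique:
  fixes K :: "'a \<Rightarrow> 'a \<Rightarrow> 'b::field" and r :: "'a \<Rightarrow> int"
  assumes "finite S" "\<And>x. x \<in> S \<Longrightarrow> K x x \<noteq> 0"
    and "\<And>x y. x \<in> S \<Longrightarrow> y \<in> S \<Longrightarrow> K x y \<noteq> 0 \<Longrightarrow> x \<noteq> y \<Longrightarrow> r y < r x"
    and "\<And>y. y \<in> S \<Longrightarrow> (\<Sum>x\<in>S. c x * K x y) = 0"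
  shows "\<forall>x\<in>S. c x = 0"
  using assms
proof (induction S rule: finite_ranking_induct[where f = "\<lambda>x. - r x"])
  case empty
  show ?case by simp
next
  case (insert x S)
  show ?case
  proof (cases "x \<in> S")
    case True
    then show ?thesis using insert by (simp add: insert_absorb)
  next
    case False
    have K0: "K x y = 0" if "y \<in> S" for y
      using insert.prems(2)[of x y] insert.hyps(2)[OF that] that False by force
    have c0: "\<forall>z\<in>S. c z = 0"
    proof (rule insert.IH)
      show "(\<Sum>z\<in>S. c z * K z y) = 0" if "y \<in> S" for y
        using insert.prems(3)[of y] that False insert.hyps(1) K0 by simp
    qed (use insert.prems in auto)
    have "c x * K x x = 0"
      using insert.prems(3)[of x] False insert.hyps(1) c0 by simp
    then show ?thesis using c0 insert.prems(1)[of x] by simp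
  qed
qed

section \<open>Homogeneous symmetric functions\<close>

lemma mcoeff_0 [simp]: "mcoeff 0 m = 0"
  by (simp add: zero_mseries_def)

lemma mcoeff_1: "mcoeff 1 m = (if m = 0 then 1 else 0)"
  by (simp add: one_mseries_def)

lemma mcoeff_add [simp]: "mcoeff (f + g) m = mcoeff f m + mcoeff g m"
  by (simp add: plus_mseries_def)

lemma mcoeff_uminus [simp]: "mcoeff (- f) m = - mcoeff f m"
  by (simp add: uminus_mseries_def)

lemma mcoeff_sum [simp]: "mcoeff (\<Sum>x\<in>A. f x) m = (\<Sum>x\<in>A. mcoeff (f x) m)"
  by (induction A rule: infinite_finite_induct) auto

lemma mcoeff_mult: "mcoeff (f * g) m = (\<Sum>(a, b)\<in>splits m. mcoeff f a * mcoeff g b)"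
  by (simp add: times_mseries_def)

lemma mcoeff_mconst_mult [simp]: "mcoeff (mconst c * f) m = c * mcoeff f m"
proof -
  have "mcoeff (mconst c * f) m = (\<Sum>(a, b)\<in>splits m. (if a = 0 then c else 0) * mcoeff f b)"
    by (simp add: mcoeff_mult mconst_def)
  also have "\<dots> = (\<Sum>(a, b)\<in>{(0 :: nat \<Rightarrow>\<^sub>0 nat, m)}. (if a = 0 then c else 0) * mcoeff f b)"
    by (rule sum.mono_neutral_right[OF finite_splits]) (auto simp: splits_def split: if_splits)
  finally show ?thesis by simp
qed

lemma mconst_0 [simp]: "mconst 0 = 0"
  by (rule mseries_eqI) (simp add: mconst_def)

lemma mcoeff_sign_mult [simp]: "mcoeff ((-1) ^ k * f) m = (-1) ^ k * mcoeff f m"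
  by (induction k) (simp_all add: mult.assoc)

lemma total_degree_eq_sum:
  assumes "finite A" "Poly_Mapping.keys m \<subseteq> A"
  shows "total_degree m = (\<Sum>i\<in>A. Poly_Mapping.lookup m i)"
  unfolding total_degree_def using assms
  by (intro sum.mono_neutral_left) (auto simp: in_keys_iff)

lemma total_degree_add: "total_degree (a + b) = total_degree a + total_degree b"
proof -
  let ?A = "Poly_Mapping.keys a \<union> Poly_Mapping.keys b"
  have "Poly_Mapping.keys (a + b) \<subseteq> ?A" by (rule Poly_Mapping.keys_add)
  then show ?thesis
    by (simp add: total_degree_eq_sum[of ?A] lookup_add sum.distrib)
qed

lemma total_degree_0 [simp]: "total_degree 0 = 0"
  by (simp add: total_degree_def)

lemma total_degree_single [simp]: "total_degree (Poly_Mapping.single i k) = k"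
  by (simp add: total_degree_def)

lemma total_degree_eq_0_iff [simp]: "total_degree m = 0 \<longleftrightarrow> m = 0"
  by (auto simp: total_degree_def in_keys_iff intro!: poly_mapping_eqI)

lemma homogeneous_symmetricI:
  assumes "\<And>m. mcoeff f m \<noteq> 0 \<Longrightarrow> total_degree m = n"
    and "\<And>\<pi> m. bij \<pi> \<Longrightarrow> mcoeff f (Poly_Mapping.map_key \<pi> m) = mcoeff f m"
  shows "f \<in> homogeneous_symmetric n"
  using assms by (simp add: homogeneous_symmetric_def)

lemma homogeneous_symmetric_degree:
  "f \<in> homogeneous_symmetric n \<Longrightarrow> mcoeff f m \<noteq> 0 \<Longrightarrow> total_degree m = n"
  by (simp add: homogeneous_symmetric_def)

lemma homogeneous_symmetric_map_key:
  "f \<in> homogeneous_symmetric n \<Longrightarrow> bij \<pi> \<Longrightarrow> mcoeff f (Poly_Mapping.map_key \<pi> m) = mcoeff f m"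
  by (simp add: homogeneous_symmetric_def)

lemma homogeneous_symmetric_0 [simp]: "0 \<in> homogeneous_symmetric n"
  by (simp add: homogeneous_symmetric_def)

lemma homogeneous_symmetric_add:
  "f \<in> homogeneous_symmetric n \<Longrightarrow> g \<in> homogeneous_symmetric n \<Longrightarrow>
   f + g \<in> homogeneous_symmetric n"
proof (rule homogeneous_symmetricI)
  fix m assume fg: "f \<in> homogeneous_symmetric n" "g \<in> homogeneous_symmetric n"
    and "mcoeff (f + g) m \<noteq> 0"
  then have "mcoeff f m \<noteq> 0 \<or> mcoeff g m \<noteq> 0" by auto
  then show "total_degree m = n" using fg homogeneous_symmetric_degree by blast
qed (simp add: homogeneous_symmetric_map_key)

lemma homogeneous_symmetric_sum:
  "(\<And>x. x \<in> A \<Longrightarrow> f x \<in> homogeneous_symmetric n) \<Longrightarrow> (\<Sum>x\<in>A. f x) \<in> homogeneous_symmetric n"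
  by (induction A rule: infinite_finite_induct) (auto intro: homogeneous_symmetric_add)

lemma homogeneous_symmetric_mconst_mult:
  "f \<in> homogeneous_symmetric n \<Longrightarrow> mconst c * f \<in> homogeneous_symmetric n"
  by (rule homogeneous_symmetricI)
     (simp_all add: homogeneous_symmetric_map_key homogeneous_symmetric_degree)

section \<open>Renaming variables and closure under products\<close>

lemma lookup_map_key_bij:
  "bij \<pi> \<Longrightarrow> Poly_Mapping.lookup (Poly_Mapping.map_key \<pi> m) i = Poly_Mapping.lookup m (\<pi> i)"
  by (simp add: map_key.rep_eq bij_is_inj)

lemma map_key_add_bij:
  "bij \<pi> \<Longrightarrow> Poly_Mapping.map_key \<pi> (a + b) = Poly_Mapping.map_key \<pi> a + Poly_Mapping.map_key \<pi> b"
  by (rule poly_mapping_eqI) (simp add: lookup_map_key_bij lookup_add)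

lemma map_key_inv_bij:
  assumes "bij \<pi>"
  shows "Poly_Mapping.map_key \<pi> (Poly_Mapping.map_key (inv \<pi>) a) = a"
    and "Poly_Mapping.map_key (inv \<pi>) (Poly_Mapping.map_key \<pi> b) = b"
proof -
  have inj: "inj \<pi>" and surj: "surj \<pi>" and "bij (inv \<pi>)"
    using assms by (auto simp: bij_imp_bij_inv bij_is_inj bij_is_surj)
  then show "Poly_Mapping.map_key \<pi> (Poly_Mapping.map_key (inv \<pi>) a) = a"
    and "Poly_Mapping.map_key (inv \<pi>) (Poly_Mapping.map_key \<pi> b) = b"
    using assms by (auto intro!: poly_mapping_eqI simp: lookup_map_key_bij surj_f_inv_f)
qed

lemma total_degree_map_key:
  assumes "bij \<pi>"
  shows "total_degree (Poly_Mapping.map_key \<pi> m) = total_degree m"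
proof -
  have "bij_betw \<pi> (Poly_Mapping.keys (Poly_Mapping.map_key \<pi> m)) (Poly_Mapping.keys m)"
    using inj_on_subset[OF bij_is_inj[OF assms] subset_UNIV] bij_is_surj[OF assms]
    by (simp add: bij_betw_def keys_map_key bij_is_inj[OF assms] surj_image_vimage_eq)
  then show ?thesis
    unfolding total_degree_def using assms
    by (simp add: lookup_map_key_bij sum.reindex_bij_betw[symmetric])
qed

lemma homogeneous_symmetric_mult:
  assumes "f \<in> homogeneous_symmetric n" "g \<in> homogeneous_symmetric k"
  shows "f * g \<in> homogeneous_symmetric (n + k)"
proof -
  have "total_degree m = n + k" if nz: "mcoeff (f * g) m \<noteq> 0" for m
  proof -
    have "\<exists>p\<in>splits m. (case p of (a, b) \<Rightarrow> mcoeff f a * mcoeff g b) \<noteq> 0"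
      using nz unfolding mcoeff_mult by (meson sum.neutral)
    then obtain a b where "(a, b) \<in> splits m" "mcoeff f a * mcoeff g b \<noteq> 0"
      by auto
    then show ?thesis using assms
      by (auto simp: homogeneous_symmetric_def splits_def total_degree_add)
  qed
  moreover have "mcoeff (f * g) (Poly_Mapping.map_key \<pi> m) = mcoeff (f * g) m" if "bij \<pi>" for \<pi> m
    unfolding mcoeff_mult
    by (rule sum.reindex_bij_witness[where
          i = "map_prod (Poly_Mapping.map_key \<pi>) (Poly_Mapping.map_key \<pi>)" and
          j = "map_prod (Poly_Mapping.map_key (inv \<pi>)) (Poly_Mapping.map_key (inv \<pi>))"])
       (use assms that in \<open>auto simp: splits_def map_key_inv_bij map_key_add_bij[symmetric]
           bij_imp_bij_inv homogeneous_symmetric_def\<close>)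
  ultimately show ?thesis by (rule homogeneous_symmetricI)
qed

lemma homogeneous_symmetric_1: "1 \<in> homogeneous_symmetric 0"
proof (rule homogeneous_symmetricI)
  fix \<pi> :: "nat \<Rightarrow> nat" and m :: "nat \<Rightarrow>\<^sub>0 nat"
  assume "bij \<pi>"
  then have "Poly_Mapping.map_key \<pi> m = 0 \<longleftrightarrow> m = 0"
    by (metis total_degree_map_key total_degree_eq_0_iff)
  then show "mcoeff 1 (Poly_Mapping.map_key \<pi> m) = mcoeff 1 m"
    by (simp add: mcoeff_1)
qed (simp add: mcoeff_1 split: if_splits)

lemma homogeneous_symmetric_prod_list:
  "(\<And>k. k \<in> set ks \<Longrightarrow> F k \<in> homogeneous_symmetric k) \<Longrightarrow>
   prod_list (map F ks) \<in> homogeneous_symmetric (sum_list ks)"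
  by (induction ks) (auto intro: homogeneous_symmetric_1 homogeneous_symmetric_mult)

lemma complete_sym_homogeneous_symmetric: "complete_sym k \<in> homogeneous_symmetric k"
  by (rule homogeneous_symmetricI)
     (simp_all add: complete_sym_def total_degree_map_key split: if_splits)

lemma map_key_single_bij:
  "bij \<pi> \<Longrightarrow> Poly_Mapping.map_key \<pi> (Poly_Mapping.single (\<pi> i) k) = Poly_Mapping.single i k"
  by (rule poly_mapping_eqI) (auto simp: lookup_map_key_bij lookup_single when_def bij_is_inj inj_eq)

lemma power_sum_homogeneous_symmetric: "power_sum k \<in> homogeneous_symmetric k"
proof -
  have "(\<exists>i. Poly_Mapping.map_key \<pi> m = Poly_Mapping.single i k) \<longleftrightarrow> (\<exists>i. m = Poly_Mapping.single i k)"
    if \<pi>: "bij \<pi>" for \<pi> :: "nat \<Rightarrow> nat" and m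
  proof
    assume "\<exists>i. Poly_Mapping.map_key \<pi> m = Poly_Mapping.single i k"
    then obtain i where "Poly_Mapping.map_key \<pi> m = Poly_Mapping.map_key \<pi> (Poly_Mapping.single (\<pi> i) k)"
      using map_key_single_bij[OF \<pi>] by metis
    then show "\<exists>i. m = Poly_Mapping.single i k"
      using map_key_inv_bij(2)[OF \<pi>] by metis
  next
    assume "\<exists>i. m = Poly_Mapping.single i k"
    then obtain i where "m = Poly_Mapping.single (\<pi> i) k"
      using \<pi> by (metis bij_pointE)
    then show "\<exists>i. Poly_Mapping.map_key \<pi> m = Poly_Mapping.single i k"
      using map_key_single_bij[OF \<pi>] by blast
  qed
  then show ?thesis
    by (intro homogeneous_symmetricI) (auto simp: power_sum_def split: if_splits)
qed

text \<open>Every contributing split has some \<open>Poly_Mapping.single i k\<close> on the left.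
  Positivity of \<open>k\<close> keeps these monomials distinct; for exponent 0 they would all be
  the unit monomial.\<close>

lemma mcoeff_power_sum_mult:
  assumes "k > 0"
  shows "mcoeff (power_sum k * g) m =
    (\<Sum>i | k \<le> Poly_Mapping.lookup m i. mcoeff g (m - Poly_Mapping.single i k))"
proof -
  let ?s = "\<lambda>i. Poly_Mapping.single i k"
  have "mcoeff (power_sum k * g) m =
    (\<Sum>(a, b)\<in>splits m. (if \<exists>i. a = ?s i then 1 else 0) * mcoeff g b)"
    by (simp add: mcoeff_mult power_sum_def)
  also have "\<dots> = (\<Sum>(a, b)\<in>{p \<in> splits m. \<exists>i. fst p = ?s i}. mcoeff g b)"
    by (rule sum.mono_neutral_cong_right) (auto split: if_splits)
  also have "{p \<in> splits m. \<exists>i. fst p = ?s i} =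
      (\<lambda>i. (?s i, m - ?s i)) ` {i. k \<le> Poly_Mapping.lookup m i}"
  proof -
    have "?s i + (m - ?s i) = m" if "k \<le> Poly_Mapping.lookup m i" for i
      using that by (intro poly_mapping_eqI) (auto simp: lookup_add lookup_minus lookup_single when_def)
    moreover have "k \<le> Poly_Mapping.lookup (?s i + b) i" for i b
      by (simp add: lookup_add)
    ultimately show ?thesis by (force simp: splits_def image_iff)
  qed
  also have "(\<Sum>(a, b)\<in>\<dots>. mcoeff g b) =
      (\<Sum>i | k \<le> Poly_Mapping.lookup m i. mcoeff g (m - ?s i))"
  proof (subst sum.reindex)
    have "i = j" if "?s i = ?s j" for i j
    proof -
      have "Poly_Mapping.lookup (?s i) i = Poly_Mapping.lookup (?s j) i" using that by simp
      then show ?thesis using assms by (auto simp: lookup_single when_def split: if_splits)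
    qed
    then show "inj_on (\<lambda>i. (?s i, m - ?s i)) {i. k \<le> Poly_Mapping.lookup m i}"
      by (auto intro!: inj_onI)
  qed simp
  finally show ?thesis .
qed

section \<open>Horizontal strips and the Pieri rule\<close>

definition fsize :: "(nat \<Rightarrow> nat) \<Rightarrow> nat" where
  "fsize \<nu> = (\<Sum>i | \<nu> i \<noteq> 0. \<nu> i)"

text \<open>Partitions are functions on all of nat with a zero tail, so that shapes of different
  lengths are compared row by row without case distinctions.\<close>

definition pfun :: "(nat \<Rightarrow> nat) set" where
  "pfun = {\<nu>. antimono \<nu> \<and> finite {i. \<nu> i \<noteq> 0}}"

text \<open>The interlacing inequalities say that the skew shape \<nu> / \<kappa> has at most one
  cell in each column.\<close>

definition hstrip :: "(nat \<Rightarrow> nat) \<Rightarrow> (nat \<Rightarrow> nat) \<Rightarrow> bool" where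
  "hstrip \<kappa> \<nu> \<longleftrightarrow> (\<forall>i. \<kappa> i \<le> \<nu> i \<and> \<nu> (Suc i) \<le> \<kappa> i)"

definition strip_up :: "nat \<Rightarrow> (nat \<Rightarrow> nat) \<Rightarrow> (nat \<Rightarrow> nat) set" where
  "strip_up a \<kappa> = {\<nu>. hstrip \<kappa> \<nu> \<and> fsize \<nu> = fsize \<kappa> + a}"

definition strip_down :: "nat \<Rightarrow> (nat \<Rightarrow> nat) \<Rightarrow> (nat \<Rightarrow> nat) set" where
  "strip_down a \<nu> = {\<kappa>. hstrip \<kappa> \<nu> \<and> fsize \<nu> = fsize \<kappa> + a}"

lemma support_subset_lessThan:
  fixes \<nu> :: "nat \<Rightarrow> nat"
  shows "(\<And>i. i \<ge> R \<Longrightarrow> \<nu> i = 0) \<Longrightarrow> {i. \<nu> i \<noteq> 0} \<subseteq> {..<R}"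
  by (metis (mono_tags, lifting) lessThan_iff linorder_not_le mem_Collect_eq subsetI)

lemma fsize_eq_sum:
  assumes "\<And>i. i \<ge> R \<Longrightarrow> \<nu> i = 0"
  shows "fsize \<nu> = (\<Sum>i<R. \<nu> i)"
proof -
  have "{i. \<nu> i \<noteq> 0} \<subseteq> {..<R}" using assms by (rule support_subset_lessThan)
  then show ?thesis unfolding fsize_def by (intro sum.mono_neutral_left) auto
qed

lemma finite_support_bound:
  fixes \<nu> :: "nat \<Rightarrow> nat"
  assumes "finite {i. \<nu> i \<noteq> 0}"
  obtains R where "\<And>i. i \<ge> R \<Longrightarrow> \<nu> i = 0"
proof -
  obtain R where "{i. \<nu> i \<noteq> 0} \<subseteq> {..<R}" using assms finite_nat_iff_bounded by blast
  then show ?thesis by (intro that[of R]) (auto simp: subset_iff not_less)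
qed

lemma pfun_bound:
  assumes "\<nu> \<in> pfun"
  obtains R where "\<And>i. i \<ge> R \<Longrightarrow> \<nu> i = 0"
  using assms finite_support_bound by (auto simp: pfun_def)

lemma pfunI:
  assumes "\<And>i. \<nu> (Suc i) \<le> \<nu> i" "\<And>i. i \<ge> R \<Longrightarrow> \<nu> i = 0"
  shows "\<nu> \<in> pfun"
proof -
  have "{i. \<nu> i \<noteq> 0} \<subseteq> {..<R}" using assms(2) by (rule support_subset_lessThan)
  then show ?thesis using decseq_SucI[of \<nu>] assms(1) finite_subset by (auto simp: pfun_def)
qed

lemma pfun_antimono: "\<nu> \<in> pfun \<Longrightarrow> i \<le> j \<Longrightarrow> \<nu> j \<le> \<nu> i"
  by (simp add: pfun_def antimonoD)

lemma zero_pfun: "(\<lambda>_. 0) \<in> pfun"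
  by (rule pfunI) auto

lemma hstrip_pfun_down:
  assumes "hstrip \<kappa> \<nu>" "\<nu> \<in> pfun"
  shows "\<kappa> \<in> pfun"
proof -
  obtain R where R: "\<And>i. i \<ge> R \<Longrightarrow> \<nu> i = 0" using assms(2) pfun_bound by blast
  show ?thesis
    using assms R by (intro pfunI[of _ R]) (auto simp: hstrip_def intro: order_trans, metis le_0_eq)
qed

lemma hstrip_pfun_up:
  assumes "hstrip \<kappa> \<nu>" "\<kappa> \<in> pfun"
  shows "\<nu> \<in> pfun"
proof -
  obtain R where R: "\<And>i. i \<ge> R \<Longrightarrow> \<kappa> i = 0" using assms(2) pfun_bound by blast
  have "\<nu> i = 0" if i: "i \<ge> Suc R" for i
  proof -
    obtain k where "i = Suc k" "k \<ge> R" using i by (cases i) auto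
    then show ?thesis using assms(1) R[of k] unfolding hstrip_def by (metis le_0_eq)
  qed
  then show ?thesis
    using assms by (intro pfunI[of _ "Suc R"]) (auto simp: hstrip_def intro: order_trans)
qed

lemma finite_bounded_functions:
  fixes B :: "nat \<Rightarrow> nat"
  assumes "\<And>i. i \<ge> R \<Longrightarrow> B i = 0"
  shows "finite {f. \<forall>i. f i \<le> B i}"
proof (rule finite_subset)
  show "{f. \<forall>i. f i \<le> B i} \<subseteq> {f. \<forall>i. (i \<in> {..<R} \<longrightarrow> f i \<in> {..Max (B ` {..<R})}) \<and> (i \<notin> {..<R} \<longrightarrow> f i = 0)}"
  proof (rule subsetI)
    fix f assume "f \<in> {f. \<forall>i. f i \<le> B i}"
    then have f: "f i \<le> B i" for i by simp
    have "f i \<le> Max (B ` {..<R})" if "i < R" for i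
      using order_trans[OF f[of i] Max_ge[of "B ` {..<R}" "B i"]] that by simp
    moreover have "f i = 0" if "\<not> i < R" for i
      using f[of i] assms[of i] that by simp
    ultimately show "f \<in> {f. \<forall>i. (i \<in> {..<R} \<longrightarrow> f i \<in> {..Max (B ` {..<R})}) \<and> (i \<notin> {..<R} \<longrightarrow> f i = 0)}"
      by simp
  qed
  show "finite {f. \<forall>i. (i \<in> {..<R} \<longrightarrow> f i \<in> {..Max (B ` {..<R})}) \<and> (i \<notin> {..<R} \<longrightarrow> f i = (0::nat))}"
    by (rule finite_set_of_finite_funs) auto
qed

lemma le_fsize: "\<nu> \<in> pfun \<Longrightarrow> \<nu> i \<le> fsize \<nu>"
  unfolding fsize_def pfun_def by (cases "\<nu> i = 0") (auto intro: member_le_sum)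

lemma hstrip_fsize_le:
  assumes "hstrip \<kappa> \<nu>" "\<nu> \<in> pfun"
  shows "fsize \<kappa> \<le> fsize \<nu>"
proof -
  obtain R where R: "\<And>i. i \<ge> R \<Longrightarrow> \<nu> i = 0" using assms(2) pfun_bound by blast
  moreover have le: "\<kappa> i \<le> \<nu> i" for i using assms(1) by (simp add: hstrip_def)
  moreover have "\<kappa> i = 0" if "i \<ge> R" for i using R[OF that] le[of i] by simp
  ultimately show ?thesis using fsize_eq_sum[of R \<kappa>] fsize_eq_sum[of R \<nu>] by (simp add: sum_mono)
qed

lemma finite_strip_down: "\<nu> \<in> pfun \<Longrightarrow> finite (strip_down a \<nu>)"
proof -
  assume l: "\<nu> \<in> pfun"
  then obtain R where "\<And>i. i \<ge> R \<Longrightarrow> \<nu> i = 0" using pfun_bound by blast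
  then have "finite {f. \<forall>i. f i \<le> \<nu> i}" by (rule finite_bounded_functions)
  then show ?thesis by (rule rev_finite_subset) (auto simp: strip_down_def hstrip_def)
qed

lemma finite_strip_up:
  assumes "\<kappa> \<in> pfun"
  shows "finite (strip_up a \<kappa>)"
proof -
  obtain R where R: "\<And>i. i \<ge> R \<Longrightarrow> \<kappa> i = 0" using assms pfun_bound by blast
  \<comment> \<open>Interlacing bounds every row by the row of \<kappa> above it; only row 0 needs
    the size condition.\<close>
  let ?B = "\<lambda>i. case i of 0 \<Rightarrow> fsize \<kappa> + a | Suc i \<Rightarrow> \<kappa> i"
  have "finite {f. \<forall>i. f i \<le> ?B i}"
    by (rule finite_bounded_functions[of "Suc R"]) (use R in \<open>auto split: nat.splits\<close>)
  moreover have "strip_up a \<kappa> \<subseteq> {f. \<forall>i. f i \<le> ?B i}"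
  proof safe
    fix f i assume f: "f \<in> strip_up a \<kappa>"
    then have "f \<in> pfun" using assms hstrip_pfun_up by (auto simp: strip_up_def)
    then have "f 0 \<le> fsize \<kappa> + a" using le_fsize[of f 0] f by (simp add: strip_up_def)
    then show "f i \<le> ?B i" using f by (auto simp: strip_up_def hstrip_def split: nat.split)
  qed
  ultimately show ?thesis by (rule rev_finite_subset)
qed

lemma strip_down_pfun: "\<nu> \<in> pfun \<Longrightarrow> \<kappa> \<in> strip_down a \<nu> \<Longrightarrow> \<kappa> \<in> pfun"
  using hstrip_pfun_down by (auto simp: strip_down_def)

lemma strip_up_pfun: "\<kappa> \<in> pfun \<Longrightarrow> \<nu> \<in> strip_up a \<kappa> \<Longrightarrow> \<nu> \<in> pfun"
  using hstrip_pfun_up by (auto simp: strip_up_def)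

text \<open>In each row the maximum and the minimum of the two parts add up to their sum. The
  identity \<open>refl\<close> shifts the maxima by one row, so the sizes balance except for row
  0.\<close>

lemma fsize_reflection:
  assumes "\<mu> \<in> pfun" "\<rho> \<in> pfun" "\<nu> \<in> pfun" "\<kappa> \<in> pfun"
    and refl: "\<And>i. \<kappa> i + \<nu> (Suc i) = max (\<mu> (Suc i)) (\<rho> (Suc i)) + min (\<mu> i) (\<rho> i)"
  shows "fsize \<nu> + fsize \<kappa> + max (\<mu> 0) (\<rho> 0) = fsize \<mu> + fsize \<rho> + \<nu> 0"
proof -
  have "finite ({i. \<mu> i \<noteq> 0} \<union> {i. \<rho> i \<noteq> 0} \<union> {i. \<nu> i \<noteq> 0} \<union> {i. \<kappa> i \<noteq> 0})"
    using assms(1-4) by (simp add: pfun_def)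
  then obtain R where "{i. \<mu> i \<noteq> 0} \<union> {i. \<rho> i \<noteq> 0} \<union> {i. \<nu> i \<noteq> 0} \<union> {i. \<kappa> i \<noteq> 0} \<subseteq> {..<R}"
    using finite_nat_iff_bounded by blast
  then have R: "\<mu> i = 0" "\<rho> i = 0" "\<nu> i = 0" "\<kappa> i = 0" if "i \<ge> R" for i
    using that by (auto simp: subset_iff not_less dest: leD)
  have "fsize \<nu> = (\<Sum>i<Suc R. \<nu> i)" using R by (intro fsize_eq_sum) auto
  then have "fsize \<nu> + fsize \<kappa> = \<nu> 0 + (\<Sum>i<R. \<kappa> i + \<nu> (Suc i))"
    using fsize_eq_sum[of R \<kappa>] R by (simp add: sum.lessThan_Suc_shift sum.distrib del: sum.lessThan_Suc)
  also have "\<dots> = \<nu> 0 + (\<Sum>i<R. max (\<mu> (Suc i)) (\<rho> (Suc i))) + (\<Sum>i<R. min (\<mu> i) (\<rho> i))"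
    by (simp add: refl sum.distrib)
  finally have "fsize \<nu> + fsize \<kappa> + max (\<mu> 0) (\<rho> 0) =
      \<nu> 0 + (\<Sum>i<Suc R. max (\<mu> i) (\<rho> i)) + (\<Sum>i<R. min (\<mu> i) (\<rho> i))"
    by (simp add: sum.lessThan_Suc_shift del: sum.lessThan_Suc)
  also have "\<dots> = \<nu> 0 + (\<Sum>i<R. max (\<mu> i) (\<rho> i) + min (\<mu> i) (\<rho> i))"
    using R[of R] by (simp add: sum.distrib)
  also have "\<dots> = \<nu> 0 + (\<Sum>i<R. \<mu> i + \<rho> i)"
    by (simp add: max_def min_def if_distrib cong: if_cong) (auto intro!: sum.cong)
  also have "\<dots> = fsize \<mu> + fsize \<rho> + \<nu> 0"
    using fsize_eq_sum[of R \<mu>] fsize_eq_sum[of R \<rho>] R by (simp add: sum.distrib)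
  finally show ?thesis .
qed

text \<open>Fomin's local rule: given \<open>\<mu>\<close> and \<open>\<rho>\<close>, the parts \<open>\<nu>\<^sub>i\<^sub>+\<^sub>1\<close> above and \<open>\<kappa>\<^sub>i\<close> below range
  over the same interval, so reflecting that interval exchanges the two; only \<open>\<nu>\<^sub>0\<close> is unconstrained,
  and its excess is the summation index \<open>j\<close>.\<close>

lemma strip_up_down_commute:
  fixes F :: "(nat \<Rightarrow> nat) \<Rightarrow> 'a::comm_monoid_add"
  assumes \<mu>: "\<mu> \<in> pfun"
  shows "(\<Sum>\<nu>\<in>strip_up a \<mu>. \<Sum>\<rho>\<in>strip_down b \<nu>. F \<rho>) =
    (\<Sum>j\<le>min a b. \<Sum>\<kappa>\<in>strip_down (b - j) \<mu>. \<Sum>\<rho>\<in>strip_up (a - j) \<kappa>. F \<rho>)"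
proof -
  let ?L = "Sigma (strip_up a \<mu>) (strip_down b)"
  let ?R = "Sigma {..min a b} (\<lambda>j. Sigma (strip_down (b - j) \<mu>) (strip_up (a - j)))"
  \<comment> \<open>\<open>m \<rho> i\<close> is the sum of the two end points of the common
    interval, so subtraction from it is the reflection.\<close>
  define m where "m \<rho> i = max (\<mu> (Suc i)) (\<rho> (Suc i)) + min (\<mu> i) (\<rho> i)" for \<rho> i
  define dn where "dn = (\<lambda>(\<nu>, \<rho>). (\<nu> 0 - max (\<mu> 0) (\<rho> 0), (\<lambda>i. m \<rho> i - \<nu> (Suc i)), \<rho>))"
  define up where "up = (\<lambda>(j, \<kappa>, \<rho>).
    ((\<lambda>i. case i of 0 \<Rightarrow> max (\<mu> 0) (\<rho> 0) + j | Suc i \<Rightarrow> m \<rho> i - \<kappa> i), \<rho>))"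
  have dn_in: "dn (\<nu>, \<rho>) \<in> ?R \<and> up (dn (\<nu>, \<rho>)) = (\<nu>, \<rho>)" if "(\<nu>, \<rho>) \<in> ?L" for \<nu> \<rho>
  proof -
    have h: "hstrip \<mu> \<nu>" "hstrip \<rho> \<nu>" and s: "fsize \<nu> = fsize \<mu> + a" "fsize \<nu> = fsize \<rho> + b"
      using that by (auto simp: strip_up_def strip_down_def)
    have \<nu>: "\<nu> \<in> pfun" and \<rho>: "\<rho> \<in> pfun"
      using h \<mu> hstrip_pfun_up hstrip_pfun_down by blast+
    define \<kappa> where "\<kappa> = (\<lambda>i. m \<rho> i - \<nu> (Suc i))"
    have hh: "\<mu> i \<le> \<nu> i" "\<rho> i \<le> \<nu> i" "\<nu> (Suc i) \<le> \<mu> i" "\<nu> (Suc i) \<le> \<rho> i" for i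
      using h by (auto simp: hstrip_def)
    have refl: "\<kappa> i + \<nu> (Suc i) = m \<rho> i" for i
      using hh(3,4)[of i] by (simp add: \<kappa>_def m_def)
    have "\<kappa> i \<le> \<mu> i \<and> \<kappa> i \<le> \<rho> i \<and> \<mu> (Suc i) \<le> \<kappa> i \<and> \<rho> (Suc i) \<le> \<kappa> i" for i
      using refl[of i] hh[of i] hh[of "Suc i"] unfolding m_def by linarith
    then have \<kappa>: "hstrip \<kappa> \<mu>" "hstrip \<kappa> \<rho>"
      unfolding hstrip_def by auto
    have \<kappa>p: "\<kappa> \<in> pfun" using \<kappa> \<mu> hstrip_pfun_down by blast
    have 0: "max (\<mu> 0) (\<rho> 0) \<le> \<nu> 0" using hh[of 0] by simp
    \<comment> \<open>With j the excess of \<open>\<nu> 0\<close>, this turns the two size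
      conditions on \<nu> into fsize \<mu> = fsize \<kappa> + (b - j) and fsize \<rho> = fsize
      \<kappa> + (a - j).\<close>
    have sz: "fsize \<nu> + fsize \<kappa> + max (\<mu> 0) (\<rho> 0) = fsize \<mu> + fsize \<rho> + \<nu> 0"
      using fsize_reflection[OF \<mu> \<rho> \<nu> \<kappa>p] refl by (simp add: m_def)
    have le: "fsize \<kappa> \<le> fsize \<mu>" "fsize \<kappa> \<le> fsize \<rho>"
      using hstrip_fsize_le \<kappa> \<mu> \<rho> by blast+
    have "dn (\<nu>, \<rho>) = (\<nu> 0 - max (\<mu> 0) (\<rho> 0), \<kappa>, \<rho>)" by (simp add: dn_def \<kappa>_def)
    moreover have "up (\<nu> 0 - max (\<mu> 0) (\<rho> 0), \<kappa>, \<rho>) = (\<nu>, \<rho>)"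
    proof -
      have "m \<rho> i - \<kappa> i = \<nu> (Suc i)" for i using refl[of i] by linarith
      then show ?thesis using 0 by (auto simp: up_def fun_eq_iff split: nat.split)
    qed
    ultimately show ?thesis
      using \<kappa> sz s 0 le by (auto simp: strip_up_def strip_down_def)
  qed
  have up_in: "up (j, \<kappa>, \<rho>) \<in> ?L \<and> dn (up (j, \<kappa>, \<rho>)) = (j, \<kappa>, \<rho>)" if "(j, \<kappa>, \<rho>) \<in> ?R" for j \<kappa> \<rho>
  proof -
    have h: "hstrip \<kappa> \<mu>" "hstrip \<kappa> \<rho>" and s: "fsize \<mu> = fsize \<kappa> + (b - j)" "fsize \<rho> = fsize \<kappa> + (a - j)"
      and j: "j \<le> a" "j \<le> b"
      using that by (auto simp: strip_up_def strip_down_def)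
    have \<kappa>: "\<kappa> \<in> pfun" and \<rho>: "\<rho> \<in> pfun"
      using h \<mu> hstrip_pfun_up hstrip_pfun_down by blast+
    define \<nu> where "\<nu> = (\<lambda>i. case i of 0 \<Rightarrow> max (\<mu> 0) (\<rho> 0) + j | Suc i \<Rightarrow> m \<rho> i - \<kappa> i)"
    have hh: "\<kappa> i \<le> \<mu> i" "\<kappa> i \<le> \<rho> i" "\<mu> (Suc i) \<le> \<kappa> i" "\<rho> (Suc i) \<le> \<kappa> i" for i
      using h by (auto simp: hstrip_def)
    have refl: "\<kappa> i + \<nu> (Suc i) = m \<rho> i" for i
      using hh(1,2)[of i] by (simp add: \<nu>_def m_def)
    have b1: "\<nu> (Suc i) \<le> \<mu> i \<and> \<nu> (Suc i) \<le> \<rho> i \<and> \<mu> (Suc i) \<le> \<nu> (Suc i) \<and> \<rho> (Suc i) \<le> \<nu> (Suc i)" for i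
      using refl[of i] hh[of i] unfolding m_def by linarith
    have b2: "\<mu> i \<le> \<nu> i \<and> \<rho> i \<le> \<nu> i" for i
    proof (cases i)
      case 0
      then show ?thesis by (simp add: \<nu>_def max_def)
    qed (use b1 in auto)
    have \<nu>: "hstrip \<mu> \<nu>" "hstrip \<rho> \<nu>"
      unfolding hstrip_def using b1 b2 by auto
    have \<nu>p: "\<nu> \<in> pfun" using \<nu> \<mu> hstrip_pfun_up by blast
    have l0: "\<nu> 0 = max (\<mu> 0) (\<rho> 0) + j" by (simp add: \<nu>_def)
    have sz: "fsize \<nu> + fsize \<kappa> + max (\<mu> 0) (\<rho> 0) = fsize \<mu> + fsize \<rho> + \<nu> 0"
      using fsize_reflection[OF \<mu> \<rho> \<nu>p \<kappa>] refl by (simp add: m_def)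
    have "up (j, \<kappa>, \<rho>) = (\<nu>, \<rho>)" by (simp add: up_def \<nu>_def)
    moreover have "dn (\<nu>, \<rho>) = (j, \<kappa>, \<rho>)"
    proof -
      have "m \<rho> i - \<nu> (Suc i) = \<kappa> i" for i using refl[of i] by linarith
      then show ?thesis using l0 by (auto simp: dn_def fun_eq_iff)
    qed
    ultimately show ?thesis
      using \<nu> sz s l0 j by (auto simp: strip_up_def strip_down_def)
  qed
  have "(\<Sum>\<nu>\<in>strip_up a \<mu>. \<Sum>\<rho>\<in>strip_down b \<nu>. F \<rho>) = (\<Sum>(\<nu>, \<rho>)\<in>?L. F \<rho>)"
    using \<mu> finite_strip_up finite_strip_down strip_up_pfun by (subst sum.Sigma) blast+
  also have "\<dots> = (\<Sum>(j, \<kappa>, \<rho>)\<in>?R. F \<rho>)"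
    by (rule sum.reindex_bij_witness[where i = up and j = dn])
       (use dn_in up_in in \<open>force simp: dn_def up_def split: prod.splits\<close>)+
  also have "\<dots> = (\<Sum>j\<le>min a b. \<Sum>(\<kappa>, \<rho>)\<in>Sigma (strip_down (b - j) \<mu>) (strip_up (a - j)). F \<rho>)"
    using \<mu> finite_strip_up finite_strip_down strip_down_pfun
    by (subst sum.Sigma) (blast intro: finite_SigmaI)+
  also have "\<dots> = (\<Sum>j\<le>min a b. \<Sum>\<kappa>\<in>strip_down (b - j) \<mu>. \<Sum>\<rho>\<in>strip_up (a - j) \<kappa>. F \<rho>)"
    using \<mu> finite_strip_up finite_strip_down strip_down_pfun
    by (intro sum.cong refl) (subst sum.Sigma, blast+)
  finally show ?thesis .
qed

text \<open>Counts chains of horizontal strips from the empty shape to \<nu>, step \<open>i\<close>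
  adding \<open>e i\<close> cells. The order of the steps matters here; its irrelevance is only a
  consequence of the symmetry of Schur functions.\<close>

primrec kostka :: "nat \<Rightarrow> (nat \<Rightarrow> nat) \<Rightarrow> (nat \<Rightarrow> nat) \<Rightarrow> nat" where
  "kostka 0 \<nu> e = (if \<nu> = (\<lambda>_. 0) then 1 else 0)"
| "kostka (Suc N) \<nu> e = (\<Sum>\<kappa>\<in>strip_down (e N) \<nu>. kostka N \<kappa> e)"

lemma kostka_cong: "(\<And>i. i < N \<Longrightarrow> e i = e' i) \<Longrightarrow> kostka N \<nu> e = kostka N \<nu> e'"
  by (induction N arbitrary: \<nu>) auto

text \<open>Exponent vectors of the monomials of degree \<open>a\<close> dividing x^e, i.e. the
  factors that \<open>complete_sym a\<close> can contribute to this monomial.\<close>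

definition sub_contents :: "nat \<Rightarrow> nat \<Rightarrow> (nat \<Rightarrow> nat) \<Rightarrow> (nat \<Rightarrow> nat) set" where
  "sub_contents N a e = {d. (\<forall>i<N. d i \<le> e i) \<and> (\<forall>i\<ge>N. d i = 0) \<and> (\<Sum>i<N. d i) = a}"

lemma finite_sub_contents: "finite (sub_contents N a e)"
proof (rule finite_subset)
  show "sub_contents N a e \<subseteq> {f. \<forall>i. f i \<le> (if i < N then e i else 0)}"
    by (auto simp: sub_contents_def)
qed (rule finite_bounded_functions[of N], auto)

lemma sum_sub_contents_Suc:
  fixes F :: "(nat \<Rightarrow> nat) \<Rightarrow> 'a::comm_monoid_add"
  shows "(\<Sum>d\<in>sub_contents (Suc N) a e. F d) =
    (\<Sum>j\<le>min a (e N). \<Sum>d\<in>sub_contents N (a - j) e. F (d(N := j)))"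
proof -
  have "(\<Sum>d\<in>sub_contents (Suc N) a e. F d) =
    (\<Sum>(j, d)\<in>Sigma {..min a (e N)} (\<lambda>j. sub_contents N (a - j) e). F (d(N := j)))"
    by (rule sum.reindex_bij_witness[where i = "\<lambda>(j, d). d(N := j)" and j = "\<lambda>d. (d N, d(N := 0))"])
       (auto simp: sub_contents_def fun_eq_iff not_less_eq_eq less_Suc_eq)
  then show ?thesis using finite_sub_contents by (simp add: sum.Sigma)
qed

text \<open>The local rule moves the added strip past the strip of the last letter: \<open>j\<close>
  of the \<open>a\<close> units are charged to letter \<open>N\<close>, and the other
  \<open>a - j\<close> are added to the smaller shape, where the induction applies.\<close>

lemma kostka_pieri:
  assumes "\<mu> \<in> pfun"
  shows "(\<Sum>\<nu>\<in>strip_up a \<mu>. kostka N \<nu> e) = (\<Sum>d\<in>sub_contents N a e. kostka N \<mu> (\<lambda>i. e i - d i))"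
  using assms
proof (induction N arbitrary: a \<mu>)
  case 0
  have z: "fsize (\<lambda>_. 0) = 0" by (simp add: fsize_def)
  have *: "(\<lambda>_. 0) \<in> strip_up a \<mu> \<longleftrightarrow> \<mu> = (\<lambda>_. 0) \<and> a = 0"
    by (auto simp: strip_up_def hstrip_def z fun_eq_iff fsize_def)
  have "(\<Sum>\<nu>\<in>strip_up a \<mu>. kostka 0 \<nu> e) = (\<Sum>\<nu>\<in>{\<nu>\<in>strip_up a \<mu>. \<nu> = (\<lambda>_. 0)}. 1)"
    using finite_strip_up[OF 0] by (intro sum.mono_neutral_cong_right) auto
  also have "{\<nu>\<in>strip_up a \<mu>. \<nu> = (\<lambda>_. 0)} = (if \<mu> = (\<lambda>_. 0) \<and> a = 0 then {\<lambda>_. 0} else {})"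
    using * by auto
  also have "(\<Sum>\<nu>\<in>\<dots>. 1) = (\<Sum>d\<in>sub_contents 0 a e. kostka 0 \<mu> (\<lambda>i. e i - d i))"
  proof -
    have "sub_contents 0 a e = (if a = 0 then {\<lambda>_. 0} else {})"
      by (auto simp: sub_contents_def)
    then show ?thesis by auto
  qed
  finally show ?case .
next
  case (Suc N)
  have "(\<Sum>\<nu>\<in>strip_up a \<mu>. kostka (Suc N) \<nu> e) =
    (\<Sum>j\<le>min a (e N). \<Sum>\<kappa>\<in>strip_down (e N - j) \<mu>. \<Sum>\<rho>\<in>strip_up (a - j) \<kappa>. kostka N \<rho> e)"
    by (simp add: strip_up_down_commute[OF Suc.prems])
  also have "\<dots> = (\<Sum>j\<le>min a (e N). \<Sum>\<kappa>\<in>strip_down (e N - j) \<mu>.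
      \<Sum>d\<in>sub_contents N (a - j) e. kostka N \<kappa> (\<lambda>i. e i - d i))"
    by (intro sum.cong refl Suc.IH) (rule strip_down_pfun[OF Suc.prems])
  also have "\<dots> = (\<Sum>j\<le>min a (e N). \<Sum>d\<in>sub_contents N (a - j) e.
      \<Sum>\<kappa>\<in>strip_down (e N - j) \<mu>. kostka N \<kappa> (\<lambda>i. e i - d i))"
    by (intro sum.cong refl sum.swap)
  also have "\<dots> = (\<Sum>j\<le>min a (e N). \<Sum>d\<in>sub_contents N (a - j) e.
      kostka (Suc N) \<mu> (\<lambda>i. e i - (d(N := j)) i))"
  proof (intro sum.cong refl)
    fix j d
    have "kostka N \<kappa> (\<lambda>i. e i - d i) = kostka N \<kappa> (\<lambda>i. e i - (d(N := j)) i)" for \<kappa>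
      by (rule kostka_cong) auto
    then show "(\<Sum>\<kappa>\<in>strip_down (e N - j) \<mu>. kostka N \<kappa> (\<lambda>i. e i - d i)) =
        kostka (Suc N) \<mu> (\<lambda>i. e i - (d(N := j)) i)"
      by simp
  qed
  also have "\<dots> = (\<Sum>d\<in>sub_contents (Suc N) a e. kostka (Suc N) \<mu> (\<lambda>i. e i - d i))"
    by (simp add: sum_sub_contents_Suc)
  finally show ?case .
qed

section \<open>Tableaux as chains of horizontal strips\<close>

definition fcells :: "(nat \<Rightarrow> nat) \<Rightarrow> (nat \<times> nat) set" where
  "fcells \<nu> = {(r, c). c < \<nu> r}"

definition tableaux :: "(nat \<Rightarrow> nat) \<Rightarrow> (nat \<Rightarrow> nat) \<Rightarrow> (nat \<times> nat \<Rightarrow> nat) set" where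
  "tableaux \<nu> e = {T \<in> extensional (fcells \<nu>).
     (\<forall>r c c'. c < c' \<and> c' < \<nu> r \<longrightarrow> T (r, c) \<le> T (r, c')) \<and>
     (\<forall>r r' c. r < r' \<and> c < \<nu> r \<and> c < \<nu> r' \<longrightarrow> T (r, c) < T (r', c)) \<and>
     (\<forall>i. card {x \<in> fcells \<nu>. T x = i} = e i)}"

lemma fcells_Sigma: "fcells \<nu> = Sigma {r. \<nu> r \<noteq> 0} (\<lambda>r. {..<\<nu> r})"
  by (auto simp: fcells_def)

lemma finite_fcells: "\<nu> \<in> pfun \<Longrightarrow> finite (fcells \<nu>)"
  unfolding fcells_Sigma by (intro finite_SigmaI) (auto simp: pfun_def)

lemma card_fcells: "\<nu> \<in> pfun \<Longrightarrow> card (fcells \<nu>) = fsize \<nu>"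
  unfolding fcells_Sigma fsize_def by (subst card_SigmaI) (auto simp: pfun_def)

lemma fcells_mono: "hstrip \<kappa> \<nu> \<Longrightarrow> fcells \<kappa> \<subseteq> fcells \<nu>"
  by (fastforce simp: fcells_def hstrip_def intro: less_le_trans)

lemma tableaux_entry:
  assumes "\<nu> \<in> pfun" "T \<in> tableaux \<nu> e" "x \<in> fcells \<nu>"
  shows "e (T x) \<noteq> 0"
proof -
  have "x \<in> {y \<in> fcells \<nu>. T y = T x}" using assms(3) by simp
  moreover have "finite {y \<in> fcells \<nu>. T y = T x}" using finite_fcells[OF assms(1)] by simp
  ultimately have "card {y \<in> fcells \<nu>. T y = T x} \<noteq> 0"
    by (metis card_eq_0_iff empty_iff)
  then show ?thesis using assms(2) by (simp add: tableaux_def)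
qed

lemma finite_tableaux:
  assumes "\<nu> \<in> pfun" "\<And>i. i \<ge> N \<Longrightarrow> e i = 0"
  shows "finite (tableaux \<nu> e)"
proof (rule finite_subset)
  show "tableaux \<nu> e \<subseteq> fcells \<nu> \<rightarrow>\<^sub>E {..<N}"
  proof
    fix T assume T: "T \<in> tableaux \<nu> e"
    have "T x < N" if "x \<in> fcells \<nu>" for x
      using tableaux_entry[OF assms(1) T that] assms(2) by (meson not_le)
    then show "T \<in> fcells \<nu> \<rightarrow>\<^sub>E {..<N}" using T by (auto simp: tableaux_def PiE_iff)
  qed
qed (use finite_fcells[OF assms(1)] in \<open>auto intro: finite_PiE\<close>)

text \<open>Deleting the entries \<open>N\<close> of a tableau with entries at most \<open>N\<close> removes a horizontal strip.\<close>

lemma card_tableaux_Suc: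
  assumes \<nu>: "\<nu> \<in> pfun" and e: "\<And>i. i \<ge> Suc N \<Longrightarrow> e i = 0"
  shows "card (tableaux \<nu> e) = (\<Sum>\<kappa>\<in>strip_down (e N) \<nu>. card (tableaux \<kappa> (e(N := 0))))"
proof -
  let ?e = "e(N := 0)"
  let ?R = "Sigma (strip_down (e N) \<nu>) (\<lambda>\<kappa>. tableaux \<kappa> ?e)"
  \<comment> \<open>The first column of row \<open>r\<close> that lies outside the shape or holds an
    entry at least \<open>N\<close>; since rows increase weakly, this is the number of entries below
    \<open>N\<close>.\<close>
  define sh where "sh T r = (LEAST c. \<not> (c < \<nu> r \<and> T (r, c) < N))" for T :: "nat \<times> nat \<Rightarrow> nat" and r
  define dn where "dn T = (sh T, restrict T (fcells (sh T)))" for T :: "nat \<times> nat \<Rightarrow> nat"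
  define up where "up = (\<lambda>(\<kappa>, T). \<lambda>x. if x \<in> fcells \<kappa> then T x else if x \<in> fcells \<nu> then N else undefined)"
  have anti: "\<nu> j \<le> \<nu> i" if "i \<le> j" for i j using \<nu> that by (rule pfun_antimono)
  have dn_in: "dn T \<in> ?R \<and> up (dn T) = T" if T: "T \<in> tableaux \<nu> e" for T
  proof -
    have rows: "T (r, c) \<le> T (r, c')" if "c \<le> c'" "c' < \<nu> r" for r c c'
      using T that by (cases "c = c'") (auto simp: tableaux_def)
    have cols: "T (r, c) < T (r', c)" if "r < r'" "c < \<nu> r" "c < \<nu> r'" for r r' c
      using T that by (auto simp: tableaux_def)
    have cnt: "card {x \<in> fcells \<nu>. T x = i} = e i" for i
      using T by (auto simp: tableaux_def)
    have ext: "T \<in> extensional (fcells \<nu>)" using T by (auto simp: tableaux_def)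
    have ent: "T x \<le> N" if "x \<in> fcells \<nu>" for x
      using tableaux_entry[OF \<nu> T that] e by (meson not_less_eq_eq)
    define \<kappa> where "\<kappa> = sh T"
    have \<kappa>: "c < \<kappa> r \<longleftrightarrow> c < \<nu> r \<and> T (r, c) < N" for r c
    proof
      assume "c < \<kappa> r"
      then show "c < \<nu> r \<and> T (r, c) < N"
        unfolding \<kappa>_def sh_def using not_less_Least by blast
    next
      assume c: "c < \<nu> r \<and> T (r, c) < N"
      have "\<not> (\<kappa> r < \<nu> r \<and> T (r, \<kappa> r) < N)"
        unfolding \<kappa>_def sh_def by (rule LeastI[of _ "\<nu> r"]) simp
      then show "c < \<kappa> r" using c rows[of "\<kappa> r" c r] by (meson le_less_trans not_less)
    qed
    have hs: "hstrip \<kappa> \<nu>"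
      unfolding hstrip_def
    proof (intro allI conjI)
      fix r
      show "\<kappa> r \<le> \<nu> r" using \<kappa>[of "\<nu> r" r] by simp
      \<comment> \<open>If the row below reached column \<open>\<kappa> r\<close>, its entry there,
        at most \<open>N\<close>, would force an entry below \<open>N\<close> just above it, where
        \<open>\<kappa>\<close> has already ended.\<close>
      show "\<nu> (Suc r) \<le> \<kappa> r"
      proof (rule ccontr)
        assume "\<not> \<nu> (Suc r) \<le> \<kappa> r"
        then have "\<kappa> r < \<nu> (Suc r)" by simp
        moreover have "\<kappa> r < \<nu> r" using calculation anti[of r "Suc r"] by simp
        moreover have "T (Suc r, \<kappa> r) \<le> N" using ent[of "(Suc r, \<kappa> r)"] calculation by (simp add: fcells_def)
        ultimately have "T (r, \<kappa> r) < N" using cols[of r "Suc r" "\<kappa> r"] by simp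
        then show False using \<kappa>[of "\<kappa> r" r] \<open>\<kappa> r < \<nu> r\<close> by simp
      qed
    qed
    have \<kappa>p: "\<kappa> \<in> pfun" using hs \<nu> hstrip_pfun_down by blast
    have sub: "fcells \<kappa> \<subseteq> fcells \<nu>" using fcells_mono hs by blast
    have mem: "x \<in> fcells \<kappa> \<longleftrightarrow> x \<in> fcells \<nu> \<and> T x < N" for x
      using \<kappa> by (cases x) (auto simp: fcells_def)
    have "{x \<in> fcells \<nu>. T x = N} = fcells \<nu> - fcells \<kappa>"
      using mem ent by (auto simp: nat_less_le)
    then have "fsize \<nu> = fsize \<kappa> + e N"
      using cnt[of N] card_Diff_subset[OF finite_fcells[OF \<kappa>p] sub] card_mono[OF finite_fcells[OF \<nu>] sub]
      by (simp add: card_fcells \<kappa>p \<nu>)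
    then have sd: "\<kappa> \<in> strip_down (e N) \<nu>" using hs by (simp add: strip_down_def)
    have "card {x \<in> fcells \<kappa>. restrict T (fcells \<kappa>) x = i} = ?e i" for i
    proof -
      have *: "{x \<in> fcells \<kappa>. restrict T (fcells \<kappa>) x = i} = {x \<in> fcells \<kappa>. T x = i}" by auto
      show ?thesis
      proof (cases "i < N")
        case True
        then have "{x \<in> fcells \<kappa>. T x = i} = {x \<in> fcells \<nu>. T x = i}" using mem by auto
        then show ?thesis using True cnt[of i] * by simp
      next
        case False
        then have "{x \<in> fcells \<kappa>. T x = i} = {}" using mem by auto
        moreover have "?e i = 0" using False e[of i] by (cases "i = N") auto
        ultimately show ?thesis using * by (metis card.empty)
      qed
    qed
    moreover have "T (r, c) \<le> T (r, c')" if "c < c'" "c' < \<kappa> r" for r c c'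
      using rows \<kappa> that by simp
    moreover have "T (r, c) < T (r', c)" if "r < r'" "c < \<kappa> r" "c < \<kappa> r'" for r r' c
      using cols \<kappa> that by simp
    ultimately have "restrict T (fcells \<kappa>) \<in> tableaux \<kappa> ?e"
      by (simp add: tableaux_def fcells_def)
    moreover have "up (dn T) = T"
      unfolding dn_def up_def using mem ent ext
      by (auto simp: fun_eq_iff \<kappa>_def[symmetric] extensional_def nat_less_le)
    ultimately show ?thesis using sd by (simp add: dn_def \<kappa>_def[symmetric])
  qed
  have up_in: "up p \<in> tableaux \<nu> e \<and> dn (up p) = p" if "p \<in> ?R" for p
  proof -
    obtain \<kappa> T where p: "p = (\<kappa>, T)" and sd: "\<kappa> \<in> strip_down (e N) \<nu>" and T: "T \<in> tableaux \<kappa> ?e"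
      using \<open>p \<in> ?R\<close> by auto
    have hs: "hstrip \<kappa> \<nu>" and sz: "fsize \<nu> = fsize \<kappa> + e N" using sd by (auto simp: strip_down_def)
    have \<kappa>p: "\<kappa> \<in> pfun" using hs \<nu> hstrip_pfun_down by blast
    have sub: "fcells \<kappa> \<subseteq> fcells \<nu>" using fcells_mono hs by blast
    have rows: "T (r, c) \<le> T (r, c')" if "c < c'" "c' < \<kappa> r" for r c c'
      using T that by (auto simp: tableaux_def)
    have cols: "T (r, c) < T (r', c)" if "r < r'" "c < \<kappa> r" "c < \<kappa> r'" for r r' c
      using T that by (auto simp: tableaux_def)
    have cnt: "card {x \<in> fcells \<kappa>. T x = i} = ?e i" for i
      using T by (auto simp: tableaux_def)
    have ext: "T \<in> extensional (fcells \<kappa>)" using T by (auto simp: tableaux_def)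
    have ent: "T x < N" if "x \<in> fcells \<kappa>" for x
    proof (rule ccontr)
      assume "\<not> T x < N"
      then have "?e (T x) = 0" using e[of "T x"] by (cases "T x = N") auto
      then show False using tableaux_entry[OF \<kappa>p T that] by simp
    qed
    define S where "S = up p"
    have S: "S x = (if x \<in> fcells \<kappa> then T x else if x \<in> fcells \<nu> then N else undefined)" for x
      by (simp add: S_def up_def p)
    have SN: "x \<in> fcells \<kappa> \<longleftrightarrow> x \<in> fcells \<nu> \<and> S x < N" for x
      using ent sub S[of x] by auto
    have "S \<in> extensional (fcells \<nu>)" using sub by (auto simp: extensional_def S)
    moreover have "S (r, c) \<le> S (r, c')" if "c < c'" "c' < \<nu> r" for r c c'
    proof (cases "c' < \<kappa> r")
      case True
      then show ?thesis using rows[OF that(1) True] that by (auto simp: S fcells_def)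
    next
      case False
      then show ?thesis using ent[of "(r, c)"] that by (auto simp: S fcells_def)
    qed
    \<comment> \<open>A cell with another cell below it in its column lies in \<kappa> by
      interlacing, so it never carries the new letter \<open>N\<close>.\<close>
    moreover have "S (r, c) < S (r', c)" if "r < r'" "c < \<nu> r" "c < \<nu> r'" for r r' c
    proof -
      have "\<nu> r' \<le> \<nu> (Suc r)" using anti that(1) by simp
      also have "\<dots> \<le> \<kappa> r" using hs by (simp add: hstrip_def)
      finally have "c < \<kappa> r" using that by simp
      then show ?thesis using cols[OF that(1)] ent[of "(r, c)"] that by (auto simp: S fcells_def)
    qed
    moreover have "card {x \<in> fcells \<nu>. S x = i} = e i" for i
    proof (cases "i = N")
      case True
      have "{x \<in> fcells \<nu>. S x = N} = fcells \<nu> - fcells \<kappa>"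
        using ent by (fastforce simp: S)
      then show ?thesis
        using True sz card_Diff_subset[OF finite_fcells[OF \<kappa>p] sub]
        by (simp add: card_fcells \<kappa>p \<nu>)
    next
      case False
      then have "{x \<in> fcells \<nu>. S x = i} = {x \<in> fcells \<kappa>. T x = i}"
        using sub by (auto simp: S split: if_splits)
      then show ?thesis using cnt[of i] False by simp
    qed
    ultimately have 1: "S \<in> tableaux \<nu> e" by (simp add: tableaux_def)
    have "sh S r = \<kappa> r" for r
      unfolding sh_def
    proof (rule Least_equality)
      show "\<not> (\<kappa> r < \<nu> r \<and> S (r, \<kappa> r) < N)" using SN[of "(r, \<kappa> r)"] by (auto simp: fcells_def)
      fix c assume "\<not> (c < \<nu> r \<and> S (r, c) < N)"
      then show "\<kappa> r \<le> c" using SN[of "(r, c)"] by (auto simp: fcells_def)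
    qed
    then have "sh S = \<kappa>" by blast
    moreover have "restrict S (fcells \<kappa>) = T"
      using ext by (auto simp: fun_eq_iff S restrict_def extensional_def)
    ultimately have "dn S = p" by (simp add: dn_def p)
    then show ?thesis using 1 by (simp add: S_def)
  qed
  have "bij_betw dn (tableaux \<nu> e) ?R"
    by (rule bij_betw_byWitness[where f' = up]) (use dn_in up_in in blast)+
  then have "card (tableaux \<nu> e) = card ?R" by (rule bij_betw_same_card)
  also have "\<dots> = (\<Sum>\<kappa>\<in>strip_down (e N) \<nu>. card (tableaux \<kappa> ?e))"
  proof (rule card_SigmaI)
    show "finite (strip_down (e N) \<nu>)" using finite_strip_down \<nu> by blast
    show "\<forall>\<kappa>\<in>strip_down (e N) \<nu>. finite (tableaux \<kappa> ?e)"
    proof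
      fix \<kappa> assume "\<kappa> \<in> strip_down (e N) \<nu>"
      then have "\<kappa> \<in> pfun" using strip_down_pfun \<nu> by blast
      then show "finite (tableaux \<kappa> ?e)" by (rule finite_tableaux[of _ "Suc N"]) (simp add: e)
    qed
  qed
  finally show ?thesis .
qed

lemma card_tableaux:
  assumes "\<nu> \<in> pfun" "\<And>i. i \<ge> N \<Longrightarrow> e i = 0"
  shows "card (tableaux \<nu> e) = kostka N \<nu> e"
  using assms
proof (induction N arbitrary: \<nu> e)
  case 0
  show ?case
  proof (cases "\<nu> = (\<lambda>_. 0)")
    case True
    then have "tableaux \<nu> e = {\<lambda>_. undefined}"
      using 0 by (auto simp: tableaux_def fcells_def extensional_def)
    then show ?thesis using True by simp
  next
    case False
    then obtain r where "\<nu> r \<noteq> 0" by auto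
    then have "(r, 0) \<in> fcells \<nu>" by (simp add: fcells_def)
    then have "tableaux \<nu> e = {}" using tableaux_entry[OF 0(1)] 0(2) by blast
    then show ?thesis using False by simp
  qed
next
  case (Suc N)
  have "card (tableaux \<nu> e) = (\<Sum>\<kappa>\<in>strip_down (e N) \<nu>. card (tableaux \<kappa> (e(N := 0))))"
    using Suc.prems by (intro card_tableaux_Suc) auto
  also have "\<dots> = (\<Sum>\<kappa>\<in>strip_down (e N) \<nu>. kostka N \<kappa> e)"
  proof (rule sum.cong[OF refl])
    fix \<kappa> assume "\<kappa> \<in> strip_down (e N) \<nu>"
    then have "\<kappa> \<in> pfun" using strip_down_pfun Suc.prems by blast
    then have "card (tableaux \<kappa> (e(N := 0))) = kostka N \<kappa> (e(N := 0))"
    proof (rule Suc.IH)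
      show "(e(N := 0)) i = 0" if "N \<le> i" for i
        using Suc.prems(2)[of i] that by (cases "i = N") auto
    qed
    also have "\<dots> = kostka N \<kappa> e" by (rule kostka_cong) simp
    finally show "card (tableaux \<kappa> (e(N := 0))) = kostka N \<kappa> e" .
  qed
  finally show ?case by simp
qed

section \<open>Schur functions of shapes and the Pieri rule\<close>

definition fschur :: "(nat \<Rightarrow> nat) \<Rightarrow> mseries" where
  "fschur \<nu> = Abs_mseries (\<lambda>m. of_nat (card (tableaux \<nu> (Poly_Mapping.lookup m))))"

lemma schur_eq_fschur: "schur l = fschur (nth_default 0 l)"
proof -
  let ?\<nu> = "nth_default 0 l"
  have lt: "c < ?\<nu> r \<longleftrightarrow> r < length l \<and> c < l ! r" for r c
    by (simp add: nth_default_def)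
  have c: "cells l = fcells ?\<nu>" by (auto simp: cells_def fcells_def lt)
  have "{T \<in> ssyt l. \<forall>i. card {x \<in> cells l. T x = i} = Poly_Mapping.lookup m i} =
      tableaux ?\<nu> (Poly_Mapping.lookup m)" for m
    unfolding ssyt_def tableaux_def c fcells_def by (auto intro: less_trans)
  then show ?thesis by (simp add: schur_def fschur_def)
qed

lemma mcoeff_fschur:
  assumes "\<nu> \<in> pfun" "Poly_Mapping.keys m \<subseteq> {..<N}"
  shows "mcoeff (fschur \<nu>) m = of_nat (kostka N \<nu> (Poly_Mapping.lookup m))"
proof -
  have "Poly_Mapping.lookup m i = 0" if "i \<ge> N" for i
    using assms(2) that by (metis in_keys_iff lessThan_iff not_le subsetD)
  then show ?thesis using card_tableaux[OF assms(1)] by (simp add: fschur_def)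
qed

text \<open>The factor taken from \<open>complete_sym a\<close> is an exponent vector of degree
  \<open>a\<close> below that of \<open>m\<close>, and each such vector has coefficient 1;
  coefficientwise the rule is therefore \<open>kostka_pieri\<close>, with \<open>N\<close> bounding
  the variables of \<open>m\<close>.\<close>

lemma complete_sym_mult_fschur:
  assumes "\<nu> \<in> pfun"
  shows "complete_sym a * fschur \<nu> = (\<Sum>\<rho>\<in>strip_up a \<nu>. fschur \<rho>)"
proof (rule mseries_eqI)
  fix m :: "nat \<Rightarrow>\<^sub>0 nat"
  let ?l = Poly_Mapping.lookup
  obtain N where N: "Poly_Mapping.keys m \<subseteq> {..<N}"
    using finite_nat_iff_bounded finite_keys by blast
  have lz: "?l m i = 0" if "i \<ge> N" for i
    using N that by (metis in_keys_iff lessThan_iff not_le subsetD)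
  have dec: "?l x i + ?l y i = ?l m i" if "x + y = m" for x y i
    using that by (auto simp: lookup_add)
  have keys: "Poly_Mapping.keys x \<subseteq> {..<N}" "Poly_Mapping.keys y \<subseteq> {..<N}" if "x + y = m" for x y
  proof -
    have "?l x i = 0 \<and> ?l y i = 0" if "i \<ge> N" for i
      using dec[OF \<open>x + y = m\<close>, of i] lz[OF that] by simp
    then show "Poly_Mapping.keys x \<subseteq> {..<N}" "Poly_Mapping.keys y \<subseteq> {..<N}"
      by (metis in_keys_iff lessThan_iff not_le subsetI)+
  qed
  have "mcoeff (complete_sym a * fschur \<nu>) m =
    (\<Sum>(x, y)\<in>splits m. (if total_degree x = a then 1 else 0) * mcoeff (fschur \<nu>) y)"
    by (simp add: mcoeff_mult complete_sym_def)
  also have "\<dots> = (\<Sum>(x, y)\<in>{(x, y) \<in> splits m. total_degree x = a}. mcoeff (fschur \<nu>) y)"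
    by (rule sum.mono_neutral_cong_right) (auto split: if_splits)
  also have "\<dots> = (\<Sum>d\<in>sub_contents N a (?l m). of_nat (kostka N \<nu> (\<lambda>i. ?l m i - d i)))"
  proof (rule sum.reindex_bij_witness[where j = "\<lambda>(x, y). ?l x" and
        i = "\<lambda>d. (Abs_poly_mapping d, m - Abs_poly_mapping d)"])
    fix p assume "p \<in> {(x, y) \<in> splits m. total_degree x = a}"
    then obtain x y where p: "p = (x, y)" "x + y = m" "total_degree x = a" by (auto simp: splits_def)
    show "(Abs_poly_mapping (case p of (x, y) \<Rightarrow> ?l x), m - Abs_poly_mapping (case p of (x, y) \<Rightarrow> ?l x)) = p"
      using p by (auto simp: lookup_inverse)
    show "(case p of (x, y) \<Rightarrow> ?l x) \<in> sub_contents N a (?l m)"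
      using p keys(1)[of x y] dec[of x y] total_degree_eq_sum[of "{..<N}" x]
      by (auto simp: sub_contents_def in_keys_iff subset_iff dest: leD) (metis le_add1)
    have "(\<lambda>i. ?l m i - ?l x i) = ?l y" using p dec[of x y] by (auto simp: fun_eq_iff) (metis add_diff_cancel_left')
    then show "of_nat (kostka N \<nu> (\<lambda>i. ?l m i - (case p of (x, y) \<Rightarrow> ?l x) i)) =
        (case p of (x, y) \<Rightarrow> mcoeff (fschur \<nu>) y)"
      using p mcoeff_fschur[OF assms keys(2)[of x y]] by simp
  next
    fix d assume d: "d \<in> sub_contents N a (?l m)"
    have sub: "{i. d i \<noteq> 0} \<subseteq> {..<N}" using d by (intro support_subset_lessThan) (auto simp: sub_contents_def)
    then have "finite {i. d i \<noteq> 0}" using finite_subset by blast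
    then have l: "?l (Abs_poly_mapping d) = d" by simp
    then show "(case (Abs_poly_mapping d, m - Abs_poly_mapping d) of (x, y) \<Rightarrow> ?l x) = d" by simp
    have "d i \<le> ?l m i" for i using d by (cases "i < N") (auto simp: sub_contents_def)
    then have "Abs_poly_mapping d + (m - Abs_poly_mapping d) = m"
      by (intro poly_mapping_eqI) (simp add: lookup_add lookup_minus l)
    moreover have "total_degree (Abs_poly_mapping d) = a"
    proof -
      have "Poly_Mapping.keys (Abs_poly_mapping d) \<subseteq> {..<N}"
        using sub l by (auto simp: in_keys_iff)
      then show ?thesis using total_degree_eq_sum[of "{..<N}" "Abs_poly_mapping d"] d l
        by (simp add: sub_contents_def)
    qed
    ultimately show "(Abs_poly_mapping d, m - Abs_poly_mapping d) \<in> {(x, y) \<in> splits m. total_degree x = a}"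
      by (simp add: splits_def)
  qed
  also have "\<dots> = of_nat (\<Sum>\<rho>\<in>strip_up a \<nu>. kostka N \<rho> (?l m))"
    by (simp add: kostka_pieri[OF assms])
  also have "\<dots> = mcoeff (\<Sum>\<rho>\<in>strip_up a \<nu>. fschur \<rho>) m"
    using strip_up_pfun[OF assms] N by (simp add: mcoeff_fschur)
  finally show "mcoeff (complete_sym a * fschur \<nu>) m = mcoeff (\<Sum>\<rho>\<in>strip_up a \<nu>. fschur \<rho>) m" .
qed

section \<open>The Hall inner product with a ribbon\<close>

definition parts :: "nat \<Rightarrow> nat list set" where
  "parts n = {l. is_partition l \<and> sum_list l = n}"

lemma length_le_sum_list:
  fixes l :: "nat list"
  shows "0 \<notin> set l \<Longrightarrow> length l \<le> sum_list l"
  by (induction l) auto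

lemma finite_parts: "finite (parts n)"
proof (rule finite_subset)
  show "parts n \<subseteq> {l. set l \<subseteq> {..n} \<and> length l \<le> n}"
    using length_le_sum_list member_le_sum_list by (fastforce simp: parts_def is_partition_def)
qed (rule finite_lists_length_le, simp)

lemma nth_default_pfun:
  assumes "is_partition l"
  shows "nth_default 0 l \<in> pfun"
proof (rule pfunI[of _ "length l"])
  show "nth_default 0 l (Suc i) \<le> nth_default 0 l i" for i
    using assms by (auto simp: is_partition_def nth_default_def sorted_wrt_iff_nth_less)
qed (simp add: nth_default_beyond)

lemma fsize_nth_default: "fsize (nth_default 0 l) = sum_list l"
  by (subst fsize_eq_sum[of "length l"])
     (auto simp: nth_default_beyond sum_list_sum_nth nth_default_def atLeast0LessThan)

lemma nth_default_inject:
  assumes "0 \<notin> set l" "0 \<notin> set l'" "nth_default 0 l = nth_default (0::nat) l'"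
  shows "l = l'"
proof -
  have nz: "i < length l \<longleftrightarrow> nth_default 0 l i \<noteq> 0" if "0 \<notin> set l" for l :: "nat list" and i
    using that by (auto simp: nth_default_def) (metis nth_mem gr0I)
  have "i < length l \<longleftrightarrow> i < length l'" for i
    using nz assms by metis
  then have "length l = length l'" by (meson linorder_neqE_nat less_irrefl)
  moreover have "l ! i = l' ! i" if "i < length l" for i
    using fun_cong[OF assms(3), of i] that calculation by (simp add: nth_default_nth)
  ultimately show ?thesis by (rule nth_equalityI)
qed

lemma bij_betw_parts: "bij_betw (nth_default 0) (parts n) {\<nu> \<in> pfun. fsize \<nu> = n}"
proof (rule bij_betw_imageI)
  show "inj_on (nth_default 0) (parts n)"
    by (rule inj_onI) (auto simp: parts_def is_partition_def intro: nth_default_inject)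
  show "nth_default 0 ` parts n = {\<nu> \<in> pfun. fsize \<nu> = n}"
  proof safe
    fix \<nu> assume \<nu>: "\<nu> \<in> pfun" and n: "n = fsize \<nu>"
    define R where "R = (LEAST R. \<nu> R = 0)"
    have "\<exists>R. \<nu> R = 0" using \<nu> pfun_bound by blast
    then have "\<nu> R = 0" unfolding R_def by (rule LeastI_ex)
    then have ge: "\<nu> i = 0" if "i \<ge> R" for i
      using pfun_antimono[OF \<nu> that] by simp
    have lt: "\<nu> i \<noteq> 0" if "i < R" for i
      using that not_less_Least unfolding R_def by blast
    define l where "l = map \<nu> [0..<R]"
    have "nth_default 0 l = \<nu>" using ge by (auto simp: l_def nth_default_def fun_eq_iff not_less)
    moreover have "0 \<notin> set l" using lt by (fastforce simp: l_def)
    then have "is_partition l"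
      using pfun_antimono[OF \<nu>] by (auto simp: is_partition_def l_def sorted_wrt_iff_nth_less)
    ultimately show "\<nu> \<in> nth_default 0 ` parts (fsize \<nu>)"
      using fsize_nth_default[of l] by (auto simp: parts_def intro!: image_eqI[of _ _ l])
  qed (auto simp: parts_def nth_default_pfun fsize_nth_default)
qed

lemma finite_pfun_fsize: "finite {\<nu> \<in> pfun. fsize \<nu> = n}"
  using bij_betw_finite[OF bij_betw_parts] finite_parts by blast

text \<open>Iterated Pieri rule. Factor \<open>N\<close> adds the last strip, so collecting terms by
  the outer shape turns upward strips into the downward strips of the recursion of
  \<open>kostka\<close>.\<close>

lemma prod_complete_sym:
  "(\<Prod>i<N. complete_sym (e i)) =
     (\<Sum>\<nu> | \<nu> \<in> pfun \<and> fsize \<nu> = (\<Sum>i<N. e i). mconst (of_nat (kostka N \<nu> e)) * fschur \<nu>)"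
proof (induction N)
  case 0
  have "{\<nu> \<in> pfun. fsize \<nu> = 0} = {\<lambda>_. 0}"
  proof -
    have "\<nu> i = 0" if "\<nu> \<in> pfun" "fsize \<nu> = 0" for \<nu> i using le_fsize[of \<nu> i] that by simp
    then show ?thesis using zero_pfun by (auto simp: fsize_def fun_eq_iff)
  qed
  moreover have "fschur (\<lambda>_. 0) = 1"
  proof (rule mseries_eqI)
    fix m :: "nat \<Rightarrow>\<^sub>0 nat"
    have "tableaux (\<lambda>_. 0) (Poly_Mapping.lookup m) = (if m = 0 then {\<lambda>_. undefined} else {})"
      by (auto simp: tableaux_def fcells_def extensional_def poly_mapping_eq_iff fun_eq_iff)
    then show "mcoeff (fschur (\<lambda>_. 0)) m = mcoeff 1 m" by (simp add: fschur_def mcoeff_1)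
  qed
  moreover have "mconst 1 = 1" by (rule mseries_eqI) (simp add: mconst_def mcoeff_1)
  ultimately show ?case by simp
next
  case (Suc N)
  let ?n = "\<Sum>i<N. e i"
  let ?P = "\<lambda>n. {\<nu> \<in> pfun. fsize \<nu> = n}"
  let ?K = "\<lambda>\<nu>. mconst (of_nat (kostka N \<nu> e))"
  have "(\<Prod>i<Suc N. complete_sym (e i)) = (\<Sum>\<nu>\<in>?P ?n. ?K \<nu> * (complete_sym (e N) * fschur \<nu>))"
    unfolding prod.lessThan_Suc Suc.IH sum_distrib_right by (simp add: mult_ac)
  also have "\<dots> = (\<Sum>\<nu>\<in>?P ?n. \<Sum>\<rho>\<in>strip_up (e N) \<nu>. ?K \<nu> * fschur \<rho>)"
    by (intro sum.cong refl) (simp add: complete_sym_mult_fschur sum_distrib_left)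
  also have "\<dots> = (\<Sum>(\<nu>, \<rho>)\<in>Sigma (?P ?n) (strip_up (e N)). ?K \<nu> * fschur \<rho>)"
    using finite_strip_up finite_pfun_fsize by (intro sum.Sigma) auto
  also have "\<dots> = (\<Sum>(\<rho>, \<nu>)\<in>Sigma (?P (?n + e N)) (strip_down (e N)). ?K \<nu> * fschur \<rho>)"
    by (rule sum.reindex_bij_witness[where i = prod.swap and j = prod.swap])
       (auto simp: strip_up_def strip_down_def intro: hstrip_pfun_up hstrip_pfun_down)
  also have "\<dots> = (\<Sum>\<rho>\<in>?P (?n + e N). \<Sum>\<nu>\<in>strip_down (e N) \<rho>. ?K \<nu> * fschur \<rho>)"
    using finite_strip_down finite_pfun_fsize by (intro sum.Sigma[symmetric]) auto
  also have "\<dots> = (\<Sum>\<rho>\<in>?P (?n + e N). mconst (of_nat (kostka (Suc N) \<rho> e)) * fschur \<rho>)"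
    by (intro sum.cong refl mseries_eqI) (simp add: sum_distrib_right)
  finally show ?case by simp
qed

lemma keys_Poly_Mapping_nth: "Poly_Mapping.keys (Poly_Mapping.nth l) \<subseteq> {..<length l}"
  by (rule subsetI) (simp add: in_keys_iff nth_default_def del: keys_nth split: if_splits)

lemma mcoeff_schur_nth:
  "is_partition l \<Longrightarrow> mcoeff (schur l) (Poly_Mapping.nth \<beta>) =
     of_nat (kostka (length \<beta>) (nth_default 0 l) (nth_default 0 \<beta>))"
  using mcoeff_fschur[OF nth_default_pfun keys_Poly_Mapping_nth] by (simp add: schur_eq_fschur)

text \<open>The same Kostka number expands products of \<open>complete_sym\<close> in Schur
  functions and Schur functions in monomials. This transposition is the source of the duality
  between complete functions and monomials.\<close>

lemma complete_sym_prod_list_expansion: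
  "prod_list (map complete_sym \<beta>) =
     (\<Sum>l\<in>parts (sum_list \<beta>). mconst (mcoeff (schur l) (Poly_Mapping.nth \<beta>)) * schur l)"
proof -
  let ?N = "length \<beta>" and ?e = "nth_default 0 \<beta>"
  have "prod_list (map complete_sym \<beta>) = (\<Prod>i<?N. complete_sym (?e i))"
    by (simp add: prod.list_conv_set_nth atLeast0LessThan nth_default_nth)
  also have "\<dots> = (\<Sum>\<nu> | \<nu> \<in> pfun \<and> fsize \<nu> = sum_list \<beta>. mconst (of_nat (kostka ?N \<nu> ?e)) * fschur \<nu>)"
    unfolding prod_complete_sym
    by (simp add: sum_list_sum_nth atLeast0LessThan nth_default_nth)
  also have "\<dots> = (\<Sum>l\<in>parts (sum_list \<beta>).
      mconst (of_nat (kostka ?N (nth_default 0 l) ?e)) * fschur (nth_default 0 l))"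
    by (rule sum.reindex_bij_betw[symmetric, OF bij_betw_parts])
  also have "\<dots> = (\<Sum>l\<in>parts (sum_list \<beta>). mconst (mcoeff (schur l) (Poly_Mapping.nth \<beta>)) * schur l)"
    by (intro sum.cong refl) (simp add: parts_def mcoeff_schur_nth, simp add: schur_eq_fschur)
  finally show ?thesis .
qed

text \<open>Each strip lengthens the shape by at most one row, so the letters below \<open>k\<close>
  stay in the first \<open>k\<close> rows; counting them gives the inequality. The zero rows are
  carried along to settle the last case, where both sums are the full size.\<close>

lemma kostka_dominance:
  assumes "\<nu> \<in> pfun" "kostka N \<nu> e \<noteq> 0"
  shows "(\<forall>i\<ge>N. \<nu> i = 0) \<and> fsize \<nu> = (\<Sum>i<N. e i) \<and> (\<forall>k\<le>N. (\<Sum>i<k. e i) \<le> (\<Sum>i<k. \<nu> i))"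
  using assms
proof (induction N arbitrary: \<nu>)
  case 0
  then show ?case by (auto simp: fsize_def split: if_splits)
next
  case (Suc N)
  obtain \<kappa> where \<kappa>: "\<kappa> \<in> strip_down (e N) \<nu>" "kostka N \<kappa> e \<noteq> 0"
    using Suc.prems(2) unfolding kostka.simps(2) by (rule sum.not_neutral_contains_not_neutral)
  have "\<kappa> \<in> pfun" using strip_down_pfun Suc.prems(1) \<kappa>(1) by blast
  note IH = Suc.IH[OF this \<kappa>(2)]
  have le: "\<kappa> i \<le> \<nu> i" "\<nu> (Suc i) \<le> \<kappa> i" for i
    using \<kappa>(1) by (auto simp: strip_down_def hstrip_def)
  have z: "\<nu> i = 0" if "i \<ge> Suc N" for i
  proof -
    obtain j where "i = Suc j" "j \<ge> N" using \<open>i \<ge> Suc N\<close> by (cases i) auto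
    then show ?thesis using IH le(2)[of j] by simp
  qed
  have sz: "fsize \<nu> = (\<Sum>i<Suc N. e i)" using \<kappa>(1) IH by (simp add: strip_down_def)
  have "(\<Sum>i<k. e i) \<le> (\<Sum>i<k. \<nu> i)" if "k \<le> Suc N" for k
  proof (cases "k = Suc N")
    case True
    then show ?thesis using sz fsize_eq_sum[of "Suc N" \<nu>] z by simp
  next
    case False
    then have "(\<Sum>i<k. e i) \<le> (\<Sum>i<k. \<kappa> i)" using IH that by simp
    also have "\<dots> \<le> (\<Sum>i<k. \<nu> i)" using le by (intro sum_mono) auto
    finally show ?thesis .
  qed
  then show ?case using z sz by blast
qed

text \<open>Adding row \<open>N\<close> as a whole at step \<open>N\<close> is an admissible chain:
  it belongs to the tableau with entry r throughout row r.\<close>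

lemma kostka_diagonal:
  assumes "\<mu> \<in> pfun"
  shows "kostka N (\<lambda>i. if i < N then \<mu> i else 0) \<mu> > 0"
proof (induction N)
  case (Suc N)
  let ?t = "\<lambda>N i. if i < N then \<mu> i else 0"
  have p: "?t N \<in> pfun" for N
    using pfun_antimono[OF assms] by (intro pfunI[of _ N]) auto
  have "hstrip (?t N) (?t (Suc N))"
    using pfun_antimono[OF assms] by (auto simp: hstrip_def)
  moreover have "fsize (?t k) = (\<Sum>i<k. \<mu> i)" for k
    by (subst fsize_eq_sum[of k]) auto
  ultimately have "?t N \<in> strip_down (\<mu> N) (?t (Suc N))"
    by (simp add: strip_down_def)
  then have "kostka N (?t N) \<mu> \<le> kostka (Suc N) (?t (Suc N)) \<mu>"
    using finite_strip_down[OF p] by (auto intro: member_le_sum)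
  then show ?case using Suc.IH by linarith
qed simp

text \<open>Strictly monotone for the dominance order on partitions of size at most \<open>M\<close>.\<close>

definition dominance_rank :: "nat \<Rightarrow> nat list \<Rightarrow> int" where
  "dominance_rank M l = int (\<Sum>k\<le>M. \<Sum>i<k. nth_default 0 l i)"

lemma schur_triangular:
  assumes l: "is_partition l" and \<mu>: "is_partition \<mu>" and M: "sum_list \<mu> \<le> M"
    and nz: "mcoeff (schur l) (Poly_Mapping.nth \<mu>) \<noteq> 0" and ne: "l \<noteq> \<mu>"
  shows "dominance_rank M \<mu> < dominance_rank M l"
proof -
  let ?\<nu> = "nth_default 0 l" and ?e = "nth_default 0 \<mu>" and ?N = "length \<mu>"
  have "kostka ?N ?\<nu> ?e \<noteq> 0" using nz mcoeff_schur_nth[OF l] by simp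
  then have D: "\<And>i. i \<ge> ?N \<Longrightarrow> ?\<nu> i = 0" "fsize ?\<nu> = (\<Sum>i<?N. ?e i)"
    "\<And>k. k \<le> ?N \<Longrightarrow> (\<Sum>i<k. ?e i) \<le> (\<Sum>i<k. ?\<nu> i)"
    using kostka_dominance[OF nth_default_pfun[OF l]] by blast+
  have e0: "?e i = 0" if "i \<ge> ?N" for i using that by (simp add: nth_default_beyond)
  have dom: "(\<Sum>i<k. ?e i) \<le> (\<Sum>i<k. ?\<nu> i)" for k
  proof (cases "k \<le> ?N")
    case False
    then have "fsize ?\<nu> = (\<Sum>i<k. ?\<nu> i)" "fsize ?e = (\<Sum>i<k. ?e i)" "fsize ?e = (\<Sum>i<?N. ?e i)"
      using D(1) e0 by (auto intro!: fsize_eq_sum)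
    then show ?thesis using D(2) by simp
  qed (rule D(3))
  have NM: "?N \<le> M" using length_le_sum_list[of \<mu>] \<mu> M by (simp add: is_partition_def)
  \<comment> \<open>Both functions vanish from \<open>M\<close> on, as \<open>\<mu>\<close> has at
    most \<open>M\<close> parts and \<open>l\<close> no more rows than \<open>\<mu>\<close>.
    Agreement of all partial sums up to \<open>M\<close> would make them equal.\<close>
  have "\<exists>k\<le>M. (\<Sum>i<k. ?e i) \<noteq> (\<Sum>i<k. ?\<nu> i)"
  proof (rule ccontr)
    assume "\<not> ?thesis"
    then have eq: "(\<Sum>i<k. ?e i) = (\<Sum>i<k. ?\<nu> i)" if "k \<le> M" for k using that by blast
    have "?e i = ?\<nu> i" for i
    proof (cases "i < M")
      case True
      then show ?thesis using eq[of i] eq[of "Suc i"] by simp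
    next
      case False
      then show ?thesis using D(1)[of i] e0[of i] NM by simp
    qed
    then have "?\<nu> = ?e" by auto
    then show False using ne l \<mu> nth_default_inject by (auto simp: is_partition_def)
  qed
  then obtain k where "k \<le> M" "(\<Sum>i<k. ?e i) < (\<Sum>i<k. ?\<nu> i)"
    using dom by (metis le_neq_implies_less)
  then show ?thesis
    unfolding dominance_rank_def of_nat_less_iff using dom by (intro sum_strict_mono_ex1) auto
qed

lemma schur_diagonal:
  assumes "is_partition \<mu>"
  shows "mcoeff (schur \<mu>) (Poly_Mapping.nth \<mu>) \<noteq> 0"
proof -
  have "(\<lambda>i. if i < length \<mu> then nth_default 0 \<mu> i else 0) = nth_default 0 \<mu>"
    by (auto simp: nth_default_beyond fun_eq_iff)
  then show ?thesis
    using kostka_diagonal[OF nth_default_pfun[OF assms], of "length \<mu>"] mcoeff_schur_nth[OF assms, of \<mu>]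
    by simp
qed

text \<open>Products of \<open>complete_sym\<close> expand in Schur functions by a triangular matrix
  with nonzero diagonal; inverting it writes \<open>schur l\<close> as a combination of products
  whose symmetry is evident.\<close>

lemma schur_homogeneous_symmetric:
  assumes "l \<in> parts n"
  shows "schur l \<in> homogeneous_symmetric n"
proof -
  \<comment> \<open>The transposed Kostka matrix, as the unknowns are indexed by the products of
    complete functions; hence the negated rank.\<close>
  define K where "K \<mu> \<nu> = mcoeff (schur \<nu>) (Poly_Mapping.nth \<mu>)" for \<mu> \<nu>
  have "\<exists>c. \<forall>y\<in>parts n. (\<Sum>x\<in>parts n. c x * K x y) = (if y = l then 1 else 0)"
  proof (rule triangular_system_solvable[where r = "\<lambda>x. - dominance_rank n x"])
    show "- dominance_rank n y < - dominance_rank n x"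
      if "x \<in> parts n" "y \<in> parts n" "K x y \<noteq> 0" "x \<noteq> y" for x y
      using that schur_triangular[of y x n] by (simp add: parts_def K_def)
  qed (rule finite_parts, simp add: K_def schur_diagonal parts_def)
  then obtain c where c: "\<And>y. y \<in> parts n \<Longrightarrow> (\<Sum>x\<in>parts n. c x * K x y) = (if y = l then 1 else 0)"
    by blast
  have "(\<Sum>\<mu>\<in>parts n. mconst (c \<mu>) * prod_list (map complete_sym \<mu>)) =
      (\<Sum>\<mu>\<in>parts n. \<Sum>\<nu>\<in>parts n. mconst (c \<mu> * K \<mu> \<nu>) * schur \<nu>)"
    by (intro sum.cong refl mseries_eqI)
       (simp add: complete_sym_prod_list_expansion parts_def K_def sum_distrib_left mult.assoc)
  also have "\<dots> = (\<Sum>\<nu>\<in>parts n. mconst (\<Sum>\<mu>\<in>parts n. c \<mu> * K \<mu> \<nu>) * schur \<nu>)"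
    by (subst sum.swap) (intro sum.cong refl mseries_eqI, simp add: sum_distrib_right)
  also have "\<dots> = (\<Sum>\<nu>\<in>parts n. if \<nu> = l then schur \<nu> else 0)"
    by (intro sum.cong refl mseries_eqI) (simp add: c)
  also have "\<dots> = schur l" using assms finite_parts by simp
  finally have "schur l = (\<Sum>\<mu>\<in>parts n. mconst (c \<mu>) * prod_list (map complete_sym \<mu>))" by simp
  moreover have "prod_list (map complete_sym \<mu>) \<in> homogeneous_symmetric n" if "\<mu> \<in> parts n" for \<mu>
    using that homogeneous_symmetric_prod_list[of \<mu> complete_sym] complete_sym_homogeneous_symmetric
    by (simp add: parts_def)
  ultimately show ?thesis
    by (auto intro!: homogeneous_symmetric_sum homogeneous_symmetric_mconst_mult)
qed

section \<open>Symmetric functions are determined by their coefficients at partitions\<close>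

lemma homogeneous_symmetric_mset:
  assumes f: "f \<in> homogeneous_symmetric n" and "mset xs = mset ys"
  shows "mcoeff f (Poly_Mapping.nth xs) = mcoeff f (Poly_Mapping.nth ys)"
proof -
  obtain p where p: "p permutes {..<length ys}" "permute_list p ys = xs"
    using mset_eq_permutation[OF assms(2)] by blast
  have len: "length xs = length ys" using assms(2) by (rule mset_eq_length)
  have "nth_default 0 xs i = nth_default 0 ys (p i)" for i
  proof (cases "i < length ys")
    case True
    then have "p i < length ys" using p(1) permutes_in_image by fastforce
    then show ?thesis using True p len by (auto simp: nth_default_nth permute_list_nth)
  next
    case False
    then show ?thesis using p(1) len permutes_not_in by (fastforce simp: nth_default_beyond)
  qed
  then have "Poly_Mapping.nth xs = Poly_Mapping.map_key p (Poly_Mapping.nth ys)"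
    by (intro poly_mapping_eqI) (simp add: lookup_map_key_bij permutes_bij[OF p(1)])
  then show ?thesis using homogeneous_symmetric_map_key[OF f permutes_bij[OF p(1)]] by simp
qed

lemma total_degree_nth: "total_degree (Poly_Mapping.nth l) = sum_list l"
  using total_degree_eq_sum[OF _ keys_Poly_Mapping_nth[of l]]
  by (simp add: sum_list_sum_nth atLeast0LessThan nth_default_nth)

lemma poly_mapping_nth_obtain:
  fixes m :: "nat \<Rightarrow>\<^sub>0 nat"
  obtains xs where "m = Poly_Mapping.nth xs"
proof -
  obtain N where N: "Poly_Mapping.keys m \<subseteq> {..<N}"
    using finite_nat_iff_bounded finite_keys by blast
  have "m = Poly_Mapping.nth (map (Poly_Mapping.lookup m) [0..<N])"
  proof (rule poly_mapping_eqI)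
    fix i show "Poly_Mapping.lookup m i = Poly_Mapping.lookup (Poly_Mapping.nth (map (Poly_Mapping.lookup m) [0..<N])) i"
      using N by (cases "i < N") (auto simp: nth_default_def in_keys_iff subset_iff)
  qed
  then show ?thesis using that by blast
qed

lemma sorted_wrt_rev_sort: "sorted_wrt (\<ge>) (rev (sort (xs :: nat list)))"
  by (simp add: sorted_wrt_rev)

lemma homogeneous_symmetric_eqI:
  assumes f: "f \<in> homogeneous_symmetric n" and g: "g \<in> homogeneous_symmetric n"
    and eq: "\<And>l. l \<in> parts n \<Longrightarrow> mcoeff f (Poly_Mapping.nth l) = mcoeff g (Poly_Mapping.nth l)"
  shows "f = g"
proof (rule mseries_eqI)
  fix m :: "nat \<Rightarrow>\<^sub>0 nat"
  show "mcoeff f m = mcoeff g m"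
  proof (cases "total_degree m = n")
    case False
    then show ?thesis using f g homogeneous_symmetric_degree by metis
  next
    case True
    obtain xs where xs: "m = Poly_Mapping.nth xs" by (rule poly_mapping_nth_obtain)
    define l where "l = rev (sort (filter (\<lambda>x. x \<noteq> 0) xs))"
    \<comment> \<open>Sorting drops the zero exponents; putting them back at the end restores the
      multiset without changing the monomial.\<close>
    let ?z = "replicate (length (filter (\<lambda>x. x = 0) xs)) 0"
    have "mset ?z = filter_mset (\<lambda>x. x = 0) (mset xs)"
      by (induction xs) auto
    moreover have "mset xs = filter_mset (\<lambda>x. x \<noteq> 0) (mset xs) + filter_mset (\<lambda>x. \<not> x \<noteq> 0) (mset xs)"
      by (rule multiset_partition)
    ultimately have ms: "mset xs = mset (l @ ?z)"
      by (simp add: l_def)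
    have nth: "Poly_Mapping.nth (l @ ?z) = Poly_Mapping.nth l" by simp
    have "is_partition l" by (simp add: l_def is_partition_def sorted_wrt_rev_sort)
    moreover have "sum_list l = n"
      using True total_degree_nth[of xs] xs ms by (metis nth total_degree_nth sum_mset_sum_list)
    ultimately have "l \<in> parts n" by (simp add: parts_def)
    then show ?thesis
      using eq homogeneous_symmetric_mset[OF f ms] homogeneous_symmetric_mset[OF g ms] nth xs by simp
  qed
qed

section \<open>Existence and uniqueness of Schur expansions\<close>

lemma schur_expansion_exists:
  assumes f: "f \<in> homogeneous_symmetric n"
  obtains c where "f = (\<Sum>l\<in>parts n. mconst (c l) * schur l)"
proof -
  define K where "K \<nu> \<mu> = mcoeff (schur \<nu>) (Poly_Mapping.nth \<mu>)" for \<nu> \<mu>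
  have "\<exists>c. \<forall>y\<in>parts n. (\<Sum>x\<in>parts n. c x * K x y) = mcoeff f (Poly_Mapping.nth y)"
  proof (rule triangular_system_solvable[where r = "dominance_rank n"])
    show "dominance_rank n y < dominance_rank n x"
      if "x \<in> parts n" "y \<in> parts n" "K x y \<noteq> 0" "x \<noteq> y" for x y
      using that schur_triangular[of x y n] by (simp add: parts_def K_def)
  qed (rule finite_parts, simp add: K_def schur_diagonal parts_def)
  then obtain c where c: "\<And>y. y \<in> parts n \<Longrightarrow> (\<Sum>x\<in>parts n. c x * K x y) = mcoeff f (Poly_Mapping.nth y)"
    by blast
  have "f = (\<Sum>l\<in>parts n. mconst (c l) * schur l)"
    by (rule homogeneous_symmetric_eqI[OF f])
       (auto intro!: homogeneous_symmetric_sum homogeneous_symmetric_mconst_mult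
          schur_homogeneous_symmetric simp: c[symmetric] K_def)
  then show ?thesis by (rule that)
qed

text \<open>Linear independence of Schur functions by triangularity, in the form that gives
  \<open>schur_coeffs\<close> its meaning.\<close>

lemma is_schur_expansion_unique:
  assumes "is_schur_expansion f c" "is_schur_expansion f d"
  shows "c = d"
proof -
  define S where "S = {l. c l \<noteq> 0} \<union> {l. d l \<noteq> 0}"
  have fin: "finite S" and part: "\<And>l. l \<in> S \<Longrightarrow> is_partition l"
    using assms by (auto simp: S_def is_schur_expansion_def)
  have sum_S: "f = (\<Sum>l\<in>S. mconst (b l) * schur l)"
    if "is_schur_expansion f b" "{l. b l \<noteq> 0} \<subseteq> S" for b
  proof -
    have "f = (\<Sum>l | b l \<noteq> 0. mconst (b l) * schur l)"
      using that(1) by (simp add: is_schur_expansion_def)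
    also have "\<dots> = (\<Sum>l\<in>S. mconst (b l) * schur l)"
      using that(2) fin by (intro sum.mono_neutral_left) auto
    finally show ?thesis .
  qed
  have "f = (\<Sum>l\<in>S. mconst (c l) * schur l)" "f = (\<Sum>l\<in>S. mconst (d l) * schur l)"
    using sum_S[OF assms(1)] sum_S[OF assms(2)] by (auto simp: S_def)
  then have eq: "(\<Sum>l\<in>S. c l * mcoeff (schur l) m) = (\<Sum>l\<in>S. d l * mcoeff (schur l) m)" for m
    by (metis (no_types, lifting) mcoeff_mconst_mult mcoeff_sum sum.cong)
  \<comment> \<open>The expansions may involve partitions of several sizes; one bound makes their
    ranks comparable.\<close>
  define M where "M = Max (insert 0 (sum_list ` S))"
  have M: "sum_list l \<le> M" if "l \<in> S" for l using that fin by (simp add: M_def)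
  have "\<forall>l\<in>S. c l - d l = 0"
  proof (rule triangular_system_unique[where r = "dominance_rank M"
        and K = "\<lambda>\<nu> \<mu>. mcoeff (schur \<nu>) (Poly_Mapping.nth \<mu>)"])
    show "dominance_rank M y < dominance_rank M x"
      if "x \<in> S" "y \<in> S" "mcoeff (schur x) (Poly_Mapping.nth y) \<noteq> 0" "x \<noteq> y" for x y
      using that part M by (intro schur_triangular) auto
  qed (auto simp: fin part schur_diagonal left_diff_distrib sum_subtractf eq)
  moreover have "c l = d l" if "l \<notin> S" for l using that by (simp add: S_def)
  ultimately have "c l = d l" for l by (metis eq_iff_diff_eq_0)
  then show ?thesis by (rule ext)
qed

lemma schur_coeffs_sum:
  fixes c :: "nat list \<Rightarrow> rat"
  shows "schur_coeffs (\<Sum>l\<in>parts n. mconst (c l) * schur l) = (\<lambda>l. if l \<in> parts n then c l else 0)"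
proof -
  let ?c = "\<lambda>l. if l \<in> parts n then c l else 0"
  let ?f = "\<Sum>l\<in>parts n. mconst (c l) * schur l"
  have sub: "{l. ?c l \<noteq> 0} \<subseteq> parts n" by auto
  have "?f = (\<Sum>l | ?c l \<noteq> 0. mconst (?c l) * schur l)"
    by (rule sum.mono_neutral_cong_right) (use finite_parts in \<open>auto split: if_splits\<close>)
  then have "is_schur_expansion ?f ?c"
    using sub finite_subset[OF sub finite_parts] by (auto simp: is_schur_expansion_def parts_def)
  then show ?thesis
    unfolding schur_coeffs_def using is_schur_expansion_unique by blast
qed

lemma hall_inner_sum:
  "hall_inner (\<Sum>l\<in>parts n. mconst (c l) * schur l) (\<Sum>l\<in>parts n. mconst (d l) * schur l) =
     (\<Sum>l\<in>parts n. c l * d l)"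
  unfolding hall_inner_def schur_coeffs_sum
  by (rule sum.mono_neutral_cong_left) (use finite_parts in auto)

section \<open>Pairing with a ribbon\<close>

lemma coarsenings_sum_length:
  assumes "\<beta> \<in> coarsenings \<alpha>"
  shows "sum_list \<beta> = sum_list \<alpha>" "length \<beta> \<le> length \<alpha>"
proof -
  obtain bs where bs: "\<beta> = map sum_list bs" "concat bs = \<alpha>" "[] \<notin> set bs"
    using assms by (auto simp: coarsenings_def)
  have "sum_list (map sum_list bs) = sum_list (concat bs)" for bs :: "nat list list"
    by (induction bs) auto
  then show "sum_list \<beta> = sum_list \<alpha>" using bs by simp
  have "length bs \<le> length (concat bs)"
    using bs(3)
  proof (induction bs)
    case (Cons b bs)
    then have "length b \<ge> 1" by (cases b) auto
    then show ?case using Cons by simp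
  qed simp
  then show "length \<beta> \<le> length \<alpha>" using bs by simp
qed

lemma finite_coarsenings: "finite (coarsenings \<alpha>)"
proof (rule finite_subset)
  show "coarsenings \<alpha> \<subseteq> {l. set l \<subseteq> {..sum_list \<alpha>} \<and> length l \<le> length \<alpha>}"
    using coarsenings_sum_length member_le_sum_list by (fastforce simp: subset_iff)
qed (rule finite_lists_length_le, simp)

text \<open>The complete homogeneous functions are dual to the monomials:
  \<open>\<langle>f, h\<^sub>\<beta>\<rangle>\<close> is the coefficient of \<open>x\<^sup>\<beta>\<close> in \<open>f\<close>.\<close>

lemma hall_inner_ribbon_schur:
  assumes f: "f \<in> homogeneous_symmetric (sum_list \<alpha>)"
  shows "hall_inner f (ribbon_schur \<alpha>) =
    (\<Sum>\<beta>\<in>coarsenings \<alpha>. (-1) ^ (length \<alpha> - length \<beta>) * mcoeff f (Poly_Mapping.nth \<beta>))"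
proof -
  let ?n = "sum_list \<alpha>"
  obtain c where c: "f = (\<Sum>l\<in>parts ?n. mconst (c l) * schur l)"
    using schur_expansion_exists[OF f] .
  define d where "d l = (\<Sum>\<beta>\<in>coarsenings \<alpha>. (-1) ^ (length \<alpha> - length \<beta>) *
    mcoeff (schur l) (Poly_Mapping.nth \<beta>))" for l
  have "ribbon_schur \<alpha> = (\<Sum>\<beta>\<in>coarsenings \<alpha>. \<Sum>l\<in>parts ?n.
      mconst ((-1) ^ (length \<alpha> - length \<beta>) * mcoeff (schur l) (Poly_Mapping.nth \<beta>)) * schur l)"
    unfolding ribbon_schur_def
    by (intro sum.cong refl mseries_eqI)
       (simp add: complete_sym_prod_list_expansion coarsenings_sum_length sum_distrib_left mult.assoc)
  also have "\<dots> = (\<Sum>l\<in>parts ?n. mconst (d l) * schur l)"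
    by (subst sum.swap) (intro sum.cong refl mseries_eqI, simp add: d_def sum_distrib_right)
  finally have "hall_inner f (ribbon_schur \<alpha>) = (\<Sum>l\<in>parts ?n. c l * d l)"
    using c hall_inner_sum by simp
  also have "\<dots> = (\<Sum>\<beta>\<in>coarsenings \<alpha>. \<Sum>l\<in>parts ?n. (-1) ^ (length \<alpha> - length \<beta>) *
      (c l * mcoeff (schur l) (Poly_Mapping.nth \<beta>)))"
    by (subst sum.swap) (simp add: d_def sum_distrib_left mult_ac)
  \<comment> \<open>For each \<beta> the inner sum over \<open>l\<close> reassembles the coefficient
    of \<open>f\<close> from its Schur expansion.\<close>
  also have "\<dots> = (\<Sum>\<beta>\<in>coarsenings \<alpha>. (-1) ^ (length \<alpha> - length \<beta>) * mcoeff f (Poly_Mapping.nth \<beta>))"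
    by (simp add: c sum_distrib_left)
  finally show ?thesis .
qed

section \<open>The power sum basis\<close>

abbreviation power_sum_list :: "nat list \<Rightarrow> mseries" where
  "power_sum_list l \<equiv> prod_list (map power_sum l)"

definition exponents :: "(nat \<Rightarrow>\<^sub>0 nat) \<Rightarrow> nat multiset" where
  "exponents m = image_mset (Poly_Mapping.lookup m) (mset_set (Poly_Mapping.keys m))"

lemma exponents_add_single:
  assumes "k > 0" "i \<notin> Poly_Mapping.keys m"
  shows "exponents (m + Poly_Mapping.single i k) = add_mset k (exponents m)"
proof -
  let ?m = "m + Poly_Mapping.single i k"
  have l: "Poly_Mapping.lookup ?m j = (if j = i then k else Poly_Mapping.lookup m j)" for j
    using assms by (auto simp: lookup_add lookup_single when_def in_keys_iff)
  have keys: "Poly_Mapping.keys ?m = insert i (Poly_Mapping.keys m)"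
    using assms by (auto simp: in_keys_iff l split: if_splits)
  have "image_mset (Poly_Mapping.lookup ?m) (mset_set (Poly_Mapping.keys m)) = exponents m"
    unfolding exponents_def using assms(2) by (intro image_mset_cong) (auto simp: l)
  then show ?thesis using assms(2) by (simp add: exponents_def keys l)
qed

lemma mcoeff_power_sum_list_nonneg:
  "0 \<notin> set l \<Longrightarrow> mcoeff (power_sum_list l) m \<ge> 0"
  by (induction l arbitrary: m) (auto simp: mcoeff_1 mcoeff_power_sum_mult intro!: sum_nonneg)

lemma minus_single_add:
  fixes m :: "nat \<Rightarrow>\<^sub>0 nat"
  assumes "k \<le> Poly_Mapping.lookup m i"
  shows "m - Poly_Mapping.single i k + Poly_Mapping.single i k = m"
  using assms by (intro poly_mapping_eqI) (auto simp: lookup_add lookup_minus lookup_single when_def)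

text \<open>Each factor raises the exponent of one variable, so there are at most as many variables
  as factors; in case of equality no two factors share a variable and the exponents are the
  parts.\<close>

lemma mcoeff_power_sum_list_nonzero:
  assumes "0 \<notin> set l" "mcoeff (power_sum_list l) m \<noteq> 0"
  shows "card (Poly_Mapping.keys m) \<le> length l \<and>
    (card (Poly_Mapping.keys m) = length l \<longrightarrow> exponents m = mset l)"
  using assms
proof (induction l arbitrary: m)
  case Nil
  then show ?case by (auto simp: mcoeff_1 exponents_def split: if_splits)
next
  case (Cons k l)
  have k: "k > 0" using Cons.prems by simp
  have "(\<Sum>i | k \<le> Poly_Mapping.lookup m i. mcoeff (power_sum_list l) (m - Poly_Mapping.single i k)) \<noteq> 0"
    using Cons.prems k by (simp add: mcoeff_power_sum_mult)
  then obtain i where i: "k \<le> Poly_Mapping.lookup m i"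
    and nz: "mcoeff (power_sum_list l) (m - Poly_Mapping.single i k) \<noteq> 0"
    by (auto elim: sum.not_neutral_contains_not_neutral)
  define m' where "m' = m - Poly_Mapping.single i k"
  have m: "m = m' + Poly_Mapping.single i k" using minus_single_add[OF i] by (simp add: m'_def)
  have IH: "card (Poly_Mapping.keys m') \<le> length l"
    "card (Poly_Mapping.keys m') = length l \<longrightarrow> exponents m' = mset l"
    using Cons nz by (auto simp: m'_def)
  have keys: "Poly_Mapping.keys m = insert i (Poly_Mapping.keys m')"
    using k by (auto simp: m in_keys_iff lookup_add lookup_single when_def split: if_splits)
  show ?case
  proof (cases "i \<in> Poly_Mapping.keys m'")
    case True
    then show ?thesis using keys IH by (simp add: insert_absorb)
  next
    case False
    then show ?thesis using keys IH exponents_add_single[OF k False] by (simp flip: m)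
  qed
qed

text \<open>Matching the factors to distinct variables produces the monomial, and nothing cancels it
  because all coefficients are nonnegative.\<close>

lemma mcoeff_power_sum_list_pos:
  assumes "0 \<notin> set l" "exponents m = mset l"
  shows "mcoeff (power_sum_list l) m > 0"
  using assms
proof (induction l arbitrary: m)
  case Nil
  then have "m = 0" by (auto simp: exponents_def mset_set_empty_iff)
  then show ?case by (simp add: mcoeff_1)
next
  case (Cons k l)
  have k: "k > 0" using Cons.prems by simp
  have "k \<in># exponents m" using Cons.prems by simp
  then obtain i where i: "Poly_Mapping.lookup m i = k" by (auto simp: exponents_def)
  define m' where "m' = m - Poly_Mapping.single i k"
  have m: "m = m' + Poly_Mapping.single i k" using minus_single_add[of k m i] i by (simp add: m'_def)
  have "i \<notin> Poly_Mapping.keys m'" using i by (simp add: m'_def in_keys_iff lookup_minus)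
  then have "exponents m' = mset l"
    using exponents_add_single[OF k, of i m'] Cons.prems(2) by (simp flip: m)
  then have "mcoeff (power_sum_list l) m' > 0" using Cons by simp
  moreover have "mcoeff (power_sum_list l) m' \<le>
      (\<Sum>i | k \<le> Poly_Mapping.lookup m i. mcoeff (power_sum_list l) (m - Poly_Mapping.single i k))"
    unfolding m'_def
  proof (rule member_le_sum)
    have "{i. k \<le> Poly_Mapping.lookup m i} \<subseteq> Poly_Mapping.keys m"
      using k by (auto simp: in_keys_iff)
    then show "finite {i. k \<le> Poly_Mapping.lookup m i}" using finite_keys finite_subset by blast
  qed (use i Cons.prems mcoeff_power_sum_list_nonneg in auto)
  ultimately show ?case using k by (simp add: mcoeff_power_sum_mult)
qed

lemma keys_nth_positive: "0 \<notin> set l \<Longrightarrow> Poly_Mapping.keys (Poly_Mapping.nth l) = {..<length l}"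
  by (rule set_eqI) (auto simp: in_keys_iff nth_default_def simp del: keys_nth, metis nth_mem)

lemma exponents_nth:
  assumes "0 \<notin> set l"
  shows "exponents (Poly_Mapping.nth l) = mset l"
proof -
  have "exponents (Poly_Mapping.nth l) = image_mset (nth_default 0 l) (mset_set {..<length l})"
    by (simp add: exponents_def keys_nth_positive[OF assms] del: keys_nth)
  also have "\<dots> = image_mset ((!) l) (mset_set {..<length l})"
    by (intro image_mset_cong) (simp add: nth_default_nth)
  also have "\<dots> = mset (map ((!) l) [0..<length l])"
    by (simp add: mset_set_upto_eq_mset_upto)
  finally show ?thesis by (simp add: map_nth)
qed

lemma partition_eqI:
  assumes "is_partition l" "is_partition l'" "mset l = mset l'"
  shows "l = l'"
proof -
  have "sorted (rev l)" "sorted (rev l')"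
    using assms by (simp_all add: is_partition_def sorted_wrt_rev)
  then have "rev l = rev l'" using assms(3) by (metis mset_rev properties_for_sort)
  then show ?thesis by simp
qed

text \<open>The number of parts can serve as the rank: factors that share a variable lower the
  number of variables, while equal numbers force equal multisets of parts, hence equal
  partitions.\<close>

lemma power_sum_list_triangular:
  assumes "is_partition l" "is_partition \<mu>" "mcoeff (power_sum_list l) (Poly_Mapping.nth \<mu>) \<noteq> 0" "l \<noteq> \<mu>"
  shows "int (length \<mu>) < int (length l)"
proof -
  have p: "0 \<notin> set l" "0 \<notin> set \<mu>" using assms by (auto simp: is_partition_def)
  have "length \<mu> \<le> length l \<and> (length \<mu> = length l \<longrightarrow> mset \<mu> = mset l)"
    using mcoeff_power_sum_list_nonzero[OF p(1) assms(3)] keys_nth_positive[OF p(2)] exponents_nth[OF p(2)]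
    by simp
  then show ?thesis using partition_eqI[OF assms(1,2)] assms(4) by (metis le_neq_implies_less of_nat_less_iff)
qed

lemma power_sum_list_diagonal:
  "is_partition l \<Longrightarrow> mcoeff (power_sum_list l) (Poly_Mapping.nth l) \<noteq> 0"
  using mcoeff_power_sum_list_pos[of l] exponents_nth by (force simp: is_partition_def)

lemma power_sum_expansion_exists:
  assumes f: "f \<in> homogeneous_symmetric n"
  obtains c where "f = (\<Sum>l\<in>parts n. mconst (c l) * power_sum_list l)"
proof -
  define K where "K \<nu> \<mu> = mcoeff (power_sum_list \<nu>) (Poly_Mapping.nth \<mu>)" for \<nu> \<mu>
  have "\<exists>c. \<forall>y\<in>parts n. (\<Sum>x\<in>parts n. c x * K x y) = mcoeff f (Poly_Mapping.nth y)"
  proof (rule triangular_system_solvable[where r = "\<lambda>l. int (length l)"])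
    show "int (length y) < int (length x)"
      if "x \<in> parts n" "y \<in> parts n" "K x y \<noteq> 0" "x \<noteq> y" for x y
      using that power_sum_list_triangular[of x y] by (simp add: parts_def K_def)
  qed (rule finite_parts, simp add: K_def power_sum_list_diagonal parts_def)
  then obtain c where c: "\<And>y. y \<in> parts n \<Longrightarrow> (\<Sum>x\<in>parts n. c x * K x y) = mcoeff f (Poly_Mapping.nth y)"
    by blast
  have hs: "power_sum_list l \<in> homogeneous_symmetric n" if "l \<in> parts n" for l
    using that homogeneous_symmetric_prod_list[of l power_sum] power_sum_homogeneous_symmetric
    by (simp add: parts_def)
  have "f = (\<Sum>l\<in>parts n. mconst (c l) * power_sum_list l)"
    by (rule homogeneous_symmetric_eqI[OF f])
       (auto intro!: homogeneous_symmetric_sum homogeneous_symmetric_mconst_mult hs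
          simp: c[symmetric] K_def)
  then show ?thesis by (rule that)
qed

text \<open>The product of the p_i over the parts i of \<open>l\<close>, as a monomial in the p_i:
  exponents are multiplicities of parts. The same type elsewhere holds monomials in the original
  variables.\<close>

definition list_monomial :: "nat list \<Rightarrow> (nat \<Rightarrow>\<^sub>0 nat)" where
  "list_monomial l = Abs_poly_mapping (count (mset l))"

lemma lookup_list_monomial [simp]: "Poly_Mapping.lookup (list_monomial l) = count (mset l)"
  unfolding list_monomial_def by (simp add: Abs_poly_mapping_inverse)

lemma keys_list_monomial [simp]: "Poly_Mapping.keys (list_monomial l) = set l"
  by (auto simp: in_keys_iff count_eq_zero_iff)

lemma inj_on_list_monomial: "inj_on list_monomial {l. is_partition l}"
proof (rule inj_onI)
  fix l l' assume l: "l \<in> {l. is_partition l}" "l' \<in> {l. is_partition l}" "list_monomial l = list_monomial l'"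
  have "count (mset l) = count (mset l')" by (metis l(3) lookup_list_monomial)
  then show "l = l'" using l partition_eqI by (simp add: count_inject)
qed

lemma list_monomial_surj:
  assumes "0 \<notin> Poly_Mapping.keys m"
  shows "\<exists>l. is_partition l \<and> list_monomial l = m"
proof -
  define M where "M = Abs_multiset (Poly_Mapping.lookup m)"
  have M: "count M = Poly_Mapping.lookup m"
    unfolding M_def using finite_keys[of m] by (intro count_Abs_multiset) (simp add: keys.rep_eq)
  let ?l = "rev (sorted_list_of_multiset M)"
  have "mset ?l = M" by simp
  moreover have "0 \<notin># M" using assms M by (simp add: in_keys_iff flip: count_eq_zero_iff)
  then have "is_partition ?l" by (simp add: is_partition_def sorted_wrt_rev)
  ultimately show ?thesis using M
    by (intro exI[of _ ?l]) (auto intro!: poly_mapping_eqI)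
qed

text \<open>\<open>S\<close> may exceed the support, so that two polynomials can be evaluated over
  one index set; \<open>C 0 = 0\<close> removes the surplus terms.\<close>

lemma eval_mpoly_list_monomials:
  assumes S: "finite S" "S \<subseteq> {l. is_partition l}" "Poly_Mapping.keys P \<subseteq> list_monomial ` S"
    and C: "C 0 = 0"
  shows "eval_mpoly C a P =
    (\<Sum>l\<in>S. C (Poly_Mapping.lookup P (list_monomial l)) * prod_list (map a l))"
proof -
  let ?t = "\<lambda>m. C (Poly_Mapping.lookup P m) * (\<Prod>i\<in>Poly_Mapping.keys m. a i ^ Poly_Mapping.lookup m i)"
  have "eval_mpoly C a P = (\<Sum>m\<in>list_monomial ` S. ?t m)"
    unfolding eval_mpoly_def using S C by (intro sum.mono_neutral_left) (auto simp: in_keys_iff)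
  also have "\<dots> = (\<Sum>l\<in>S. ?t (list_monomial l))"
    using inj_on_subset[OF inj_on_list_monomial S(2)] by (simp add: sum.reindex)
  also have "(\<Prod>i\<in>set l. a i ^ count (mset l) i) = prod_list (map a l)" for l
    using image_prod_mset_multiplicity[of a "mset l"] by (simp flip: prod_mset_prod_list)
  then have "(\<Sum>l\<in>S. ?t (list_monomial l)) =
      (\<Sum>l\<in>S. C (Poly_Mapping.lookup P (list_monomial l)) * prod_list (map a l))"
    by simp
  finally show ?thesis .
qed

text \<open>Algebraic independence of the power sums, from the triangularity of their products.
  Variable 0 has to be excluded since \<open>power_sum 0\<close> is 1.\<close>

lemma power_sum_poly_unique:
  assumes P: "\<forall>m\<in>Poly_Mapping.keys P. 0 \<notin> Poly_Mapping.keys m"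
    and Q: "\<forall>m\<in>Poly_Mapping.keys Q. 0 \<notin> Poly_Mapping.keys m"
    and eq: "eval_mpoly mconst power_sum P = eval_mpoly mconst power_sum Q"
  shows "P = Q"
proof -
  have "Poly_Mapping.keys P \<union> Poly_Mapping.keys Q \<subseteq> list_monomial ` {l. is_partition l}"
    using P Q list_monomial_surj by (force simp: image_iff)
  then obtain S where S: "finite S" "S \<subseteq> {l. is_partition l}"
    "Poly_Mapping.keys P \<union> Poly_Mapping.keys Q = list_monomial ` S"
    using finite_subset_image[of "Poly_Mapping.keys P \<union> Poly_Mapping.keys Q"] by (metis finite_UnI finite_keys)
  let ?p = "\<lambda>l. Poly_Mapping.lookup P (list_monomial l)" and ?q = "\<lambda>l. Poly_Mapping.lookup Q (list_monomial l)"
  have "(\<Sum>l\<in>S. mconst (?p l) * power_sum_list l) = (\<Sum>l\<in>S. mconst (?q l) * power_sum_list l)"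
  proof -
    have "Poly_Mapping.keys P \<subseteq> list_monomial ` S" "Poly_Mapping.keys Q \<subseteq> list_monomial ` S"
      using S(3) by blast+
    then show ?thesis
      using eq eval_mpoly_list_monomials[OF S(1,2), of P mconst power_sum]
        eval_mpoly_list_monomials[OF S(1,2), of Q mconst power_sum] by simp
  qed
  then have eq': "(\<Sum>l\<in>S. ?p l * mcoeff (power_sum_list l) m) = (\<Sum>l\<in>S. ?q l * mcoeff (power_sum_list l) m)" for m
    by (metis (no_types, lifting) mcoeff_mconst_mult mcoeff_sum sum.cong)
  have "\<forall>l\<in>S. ?p l - ?q l = 0"
  proof (rule triangular_system_unique[where r = "\<lambda>l. int (length l)"
        and K = "\<lambda>\<nu> \<mu>. mcoeff (power_sum_list \<nu>) (Poly_Mapping.nth \<mu>)"])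
    show "int (length y) < int (length x)"
      if "x \<in> S" "y \<in> S" "mcoeff (power_sum_list x) (Poly_Mapping.nth y) \<noteq> 0" "x \<noteq> y" for x y
      using that S(2) by (intro power_sum_list_triangular) auto
    show "mcoeff (power_sum_list x) (Poly_Mapping.nth x) \<noteq> 0" if "x \<in> S" for x
      using that S(2) by (intro power_sum_list_diagonal) auto
  qed (simp_all add: S(1) left_diff_distrib sum_subtractf eq')
  then have on_S: "Poly_Mapping.lookup P m = Poly_Mapping.lookup Q m" if "m \<in> list_monomial ` S" for m
    using that by auto
  show ?thesis
  proof (rule poly_mapping_eqI)
    fix m show "Poly_Mapping.lookup P m = Poly_Mapping.lookup Q m"
      using on_S[of m] S(3) by (cases "m \<in> list_monomial ` S") (auto simp: in_keys_iff)
  qed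
qed

lemma power_sum_subst_expansion:
  fixes c :: "nat list \<Rightarrow> rat"
  shows "power_sum_subst (\<Sum>l\<in>parts n. mconst (c l) * power_sum_list l) a =
    (\<Sum>l\<in>parts n. smult (c l) (prod_list (map a l)))"
proof -
  \<comment> \<open>The polynomial that the definite description in \<open>power_sum_poly\<close>
    has to return.\<close>
  define P where "P = (\<Sum>l\<in>parts n. Poly_Mapping.single (list_monomial l) (c l))"
  have sub: "parts n \<subseteq> {l. is_partition l}" by (auto simp: parts_def)
  have lP: "Poly_Mapping.lookup P (list_monomial l) = c l" if "l \<in> parts n" for l
  proof -
    have "list_monomial l' = list_monomial l \<longleftrightarrow> l' = l" if "l' \<in> parts n" for l'
      using that \<open>l \<in> parts n\<close> inj_on_subset[OF inj_on_list_monomial sub] by (auto dest: inj_onD)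
    then have "Poly_Mapping.lookup P (list_monomial l) = (\<Sum>l'\<in>parts n. if l' = l then c l' else 0)"
      unfolding P_def lookup_sum by (intro sum.cong refl) (auto simp: lookup_single when_def)
    then show ?thesis using that finite_parts by simp
  qed
  have keys: "Poly_Mapping.keys P \<subseteq> list_monomial ` parts n"
  proof
    fix m assume "m \<in> Poly_Mapping.keys P"
    then have "(\<Sum>l\<in>parts n. Poly_Mapping.lookup (Poly_Mapping.single (list_monomial l) (c l)) m) \<noteq> 0"
      by (simp add: P_def in_keys_iff lookup_sum)
    then obtain l where "l \<in> parts n" "Poly_Mapping.lookup (Poly_Mapping.single (list_monomial l) (c l)) m \<noteq> 0"
      by (rule sum.not_neutral_contains_not_neutral)
    then show "m \<in> list_monomial ` parts n" by (auto simp: lookup_single when_def split: if_splits)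
  qed
  have ev: "eval_mpoly C a' P = (\<Sum>l\<in>parts n. C (c l) * prod_list (map a' l))"
    if "C 0 = 0" for C :: "rat \<Rightarrow> 'b::comm_ring_1" and a'
    using eval_mpoly_list_monomials[OF finite_parts sub keys, of C a'] that lP by simp
  have "power_sum_poly (\<Sum>l\<in>parts n. mconst (c l) * power_sum_list l) = P"
    unfolding power_sum_poly_def
  proof (rule the_equality)
    show 1: "(\<forall>m\<in>Poly_Mapping.keys P. 0 \<notin> Poly_Mapping.keys m) \<and>
      eval_mpoly mconst power_sum P = (\<Sum>l\<in>parts n. mconst (c l) * power_sum_list l)"
      using keys by (auto simp: ev parts_def is_partition_def)
    show "Q = P" if "(\<forall>m\<in>Poly_Mapping.keys Q. 0 \<notin> Poly_Mapping.keys m) \<and>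
      eval_mpoly mconst power_sum Q = (\<Sum>l\<in>parts n. mconst (c l) * power_sum_list l)" for Q
      using that 1 power_sum_poly_unique by metis
  qed
  then show ?thesis by (simp add: power_sum_subst_def ev)
qed

section \<open>Power sum coefficients over coarsenings\<close>

text \<open>The alternating sum of a ribbon with an arbitrary functional in place of the
  coefficients of \<open>f\<close>; this allows linear expansion in \<open>\<phi>\<close> and
  recursion on \<open>\<alpha>\<close>.\<close>

definition coarse_sum :: "nat list \<Rightarrow> (nat list \<Rightarrow> rat) \<Rightarrow> rat" where
  "coarse_sum \<alpha> \<phi> = (\<Sum>\<beta>\<in>coarsenings \<alpha>. (-1) ^ (length \<alpha> - length \<beta>) * \<phi> \<beta>)"

lemma coarsenings_Nil [simp]: "coarsenings [] = {[]}"
proof -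
  have "bs = []" if "concat bs = []" "[] \<notin> set bs" for bs :: "nat list list"
    using that by (cases bs) auto
  then show ?thesis by (force simp: coarsenings_def)
qed

lemma coarsenings_unfold:
  assumes "\<alpha> \<noteq> []"
  shows "coarsenings \<alpha> =
    (\<Union>k<length \<alpha>. (#) (sum_list (take (Suc k) \<alpha>)) ` coarsenings (drop (Suc k) \<alpha>))"
proof (intro equalityI subsetI)
  fix \<beta> assume "\<beta> \<in> coarsenings \<alpha>"
  then obtain bs where bs: "\<beta> = map sum_list bs" "concat bs = \<alpha>" "[] \<notin> set bs"
    by (auto simp: coarsenings_def)
  then obtain b bs' where b: "bs = b # bs'" using assms by (cases bs) auto
  define k where "k = length b - 1"
  have k: "length b = Suc k" using bs(3) b by (cases b) (auto simp: k_def)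
  have "k < length \<alpha>" using bs(2) b k by auto
  moreover have "take (Suc k) \<alpha> = b" "drop (Suc k) \<alpha> = concat bs'" using bs(2) b k by auto
  moreover have "map sum_list bs' \<in> coarsenings (concat bs')" using bs(3) b by (auto simp: coarsenings_def)
  ultimately show "\<beta> \<in> (\<Union>k<length \<alpha>. (#) (sum_list (take (Suc k) \<alpha>)) ` coarsenings (drop (Suc k) \<alpha>))"
    using bs(1) b by (intro UN_I[of k]) auto
next
  fix \<beta> assume "\<beta> \<in> (\<Union>k<length \<alpha>. (#) (sum_list (take (Suc k) \<alpha>)) ` coarsenings (drop (Suc k) \<alpha>))"
  then obtain k bs where k: "k < length \<alpha>" and bs: "concat bs = drop (Suc k) \<alpha>" "[] \<notin> set bs"
    and \<beta>: "\<beta> = sum_list (take (Suc k) \<alpha>) # map sum_list bs"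
    by (auto simp: coarsenings_def)
  have "concat (take (Suc k) \<alpha> # bs) = \<alpha>" using bs by simp
  moreover have "[] \<notin> set (take (Suc k) \<alpha> # bs)" using k bs assms by auto
  ultimately show "\<beta> \<in> coarsenings \<alpha>"
    unfolding coarsenings_def using \<beta> by (auto intro!: exI[of _ "take (Suc k) \<alpha> # bs"])
qed

lemma sum_list_take_less:
  fixes \<alpha> :: "nat list"
  assumes "0 \<notin> set \<alpha>" "i < j" "j \<le> length \<alpha>"
  shows "sum_list (take i \<alpha>) < sum_list (take j \<alpha>)"
proof -
  have "take j \<alpha> = take i \<alpha> @ take (j - i) (drop i \<alpha>)"
    using assms(2) by (metis le_add_diff_inverse less_imp_le take_add)
  moreover have "length (take (j - i) (drop i \<alpha>)) \<le> sum_list (take (j - i) (drop i \<alpha>))"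
    using assms(1) by (intro length_le_sum_list) (meson in_set_dropD in_set_takeD)
  ultimately show ?thesis using assms by simp
qed

lemma coarse_sum_Nil [simp]: "coarse_sum [] \<phi> = \<phi> []"
  by (simp add: coarse_sum_def)

text \<open>A first block of \<open>Suc k\<close> parts costs the sign (-1)^k. Positive parts make
  the partial sums distinct, so the first entry of a coarsening determines \<open>k\<close> and
  nothing is counted twice.\<close>

lemma coarse_sum_unfold:
  assumes "\<alpha> \<noteq> []" "0 \<notin> set \<alpha>"
  shows "coarse_sum \<alpha> \<phi> = (\<Sum>k<length \<alpha>. (-1) ^ k *
    coarse_sum (drop (Suc k) \<alpha>) (\<lambda>\<beta>. \<phi> (sum_list (take (Suc k) \<alpha>) # \<beta>)))"
proof -
  let ?s = "\<lambda>k. sum_list (take (Suc k) \<alpha>)"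
  let ?C = "\<lambda>k. (#) (?s k) ` coarsenings (drop (Suc k) \<alpha>)"
  have "?s i \<noteq> ?s j" if "i < length \<alpha>" "j < length \<alpha>" "i \<noteq> j" for i j
    using that sum_list_take_less[OF assms(2), of "Suc i" "Suc j"] sum_list_take_less[OF assms(2), of "Suc j" "Suc i"]
    by (cases "i < j") auto
  then have "coarse_sum \<alpha> \<phi> =
      (\<Sum>k<length \<alpha>. \<Sum>\<beta>\<in>?C k. (-1) ^ (length \<alpha> - length \<beta>) * \<phi> \<beta>)"
    unfolding coarse_sum_def coarsenings_unfold[OF assms(1)]
    by (intro sum.UNION_disjoint) (auto simp: finite_coarsenings)
  also have "\<dots> = (\<Sum>k<length \<alpha>. (-1) ^ k * coarse_sum (drop (Suc k) \<alpha>) (\<lambda>\<beta>. \<phi> (?s k # \<beta>)))"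
  proof (rule sum.cong[OF refl])
    fix k assume k: "k \<in> {..<length \<alpha>}"
    have "(\<Sum>\<beta>\<in>?C k. (-1) ^ (length \<alpha> - length \<beta>) * \<phi> \<beta>) =
      (\<Sum>\<beta>\<in>coarsenings (drop (Suc k) \<alpha>). (-1) ^ (length \<alpha> - Suc (length \<beta>)) * \<phi> (?s k # \<beta>))"
      by (subst sum.reindex) auto
    also have "\<dots> = (\<Sum>\<beta>\<in>coarsenings (drop (Suc k) \<alpha>).
        (-1) ^ k * ((-1) ^ (length (drop (Suc k) \<alpha>) - length \<beta>) * \<phi> (?s k # \<beta>)))"
    proof (rule sum.cong[OF refl])
      fix \<beta> assume "\<beta> \<in> coarsenings (drop (Suc k) \<alpha>)"
      then have "length \<beta> \<le> length \<alpha> - Suc k" using coarsenings_sum_length(2) by fastforce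
      then have "length \<alpha> - Suc (length \<beta>) = k + (length (drop (Suc k) \<alpha>) - length \<beta>)"
        using k by auto
      then show "(-1) ^ (length \<alpha> - Suc (length \<beta>)) * \<phi> (?s k # \<beta>) =
          (-1) ^ k * ((-1) ^ (length (drop (Suc k) \<alpha>) - length \<beta>) * \<phi> (?s k # \<beta>))"
        by (simp only: power_add mult.assoc)
    qed
    finally show "(\<Sum>\<beta>\<in>?C k. (-1) ^ (length \<alpha> - length \<beta>) * \<phi> \<beta>) =
        (-1) ^ k * coarse_sum (drop (Suc k) \<alpha>) (\<lambda>\<beta>. \<phi> (?s k # \<beta>))"
      by (simp add: coarse_sum_def sum_distrib_left)
  qed
  finally show ?thesis .
qed

section \<open>Linearity and reversal of coarsening sums\<close>

lemma coarse_sum_sum: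
  "coarse_sum \<alpha> (\<lambda>\<beta>. \<Sum>x\<in>A. F x \<beta>) = (\<Sum>x\<in>A. coarse_sum \<alpha> (F x))"
  unfolding coarse_sum_def by (subst sum.swap) (simp add: sum_distrib_left)

lemma coarse_sum_scale: "coarse_sum \<alpha> (\<lambda>\<beta>. c * \<phi> \<beta>) = c * coarse_sum \<alpha> \<phi>"
  unfolding coarse_sum_def by (simp add: sum_distrib_left mult.left_commute)

lemma rev_coarsenings: "\<beta> \<in> coarsenings \<alpha> \<Longrightarrow> rev \<beta> \<in> coarsenings (rev \<alpha>)"
proof -
  assume "\<beta> \<in> coarsenings \<alpha>"
  then obtain bs where bs: "\<beta> = map sum_list bs" "concat bs = \<alpha>" "[] \<notin> set bs"
    by (auto simp: coarsenings_def)
  have "map sum_list (rev (map rev bs)) = rev \<beta>" using bs(1) by (simp add: rev_map)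
  moreover have "concat (rev (map rev bs)) = rev \<alpha>" using bs(2) by (metis rev_concat rev_map)
  moreover have "[] \<notin> set (rev (map rev bs))" using bs(3) by auto
  ultimately show ?thesis unfolding coarsenings_def by (metis (mono_tags, lifting) mem_Collect_eq)
qed

text \<open>Reversing the blocks and their order preserves the sign. With symmetric coefficients
  this exchanges (1, 2, ..., 2) and (2, ..., 2, 1).\<close>

lemma coarse_sum_rev:
  assumes "\<And>\<beta>. \<phi> (rev \<beta>) = \<phi> \<beta>"
  shows "coarse_sum (rev \<alpha>) \<phi> = coarse_sum \<alpha> \<phi>"
  unfolding coarse_sum_def
  by (rule sum.reindex_bij_witness[where i = rev and j = rev])
     (use assms rev_coarsenings[of _ \<alpha>] rev_coarsenings[of _ "rev \<alpha>"] in auto)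

text \<open>Indexing the factors by a set with weights makes removal of the factors used by one
  block simply \<open>I - S\<close>. For positive weights the value counts the maps from
  \<open>I\<close> to the positions of \<beta> whose fibres have weights \<beta>.\<close>

definition pcoeff :: "('i \<Rightarrow> nat) \<Rightarrow> 'i set \<Rightarrow> nat list \<Rightarrow> rat" where
  "pcoeff w I \<beta> = mcoeff (\<Prod>j\<in>I. power_sum (w j)) (Poly_Mapping.nth \<beta>)"

section \<open>Products of power sums as counts of ordered set partitions\<close>

lemma mcoeff_power_sum_mult_nth:
  assumes "k > 0"
  shows "mcoeff (power_sum k * g) (Poly_Mapping.nth \<beta>) =
    (\<Sum>i<length \<beta>. if k \<le> \<beta> ! i then mcoeff g (Poly_Mapping.nth (\<beta>[i := \<beta> ! i - k])) else 0)"
proof -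
  have set: "{i. k \<le> nth_default 0 \<beta> i} = {i \<in> {..<length \<beta>}. k \<le> \<beta> ! i}"
    using assms by (auto simp: nth_default_def split: if_splits)
  have "Poly_Mapping.nth \<beta> - Poly_Mapping.single i k = Poly_Mapping.nth (\<beta>[i := \<beta> ! i - k])"
    if "i < length \<beta>" for i
    using that by (intro poly_mapping_eqI)
      (auto simp: lookup_minus lookup_single when_def nth_default_def nth_list_update)
  then show ?thesis
    using assms by (simp add: mcoeff_power_sum_mult set sum.If_cases Int_def conj_commute)
qed

lemma pcoeff_insert:
  assumes "finite I" "x \<notin> I" "w x > 0"
  shows "pcoeff w (insert x I) \<beta> =
    (\<Sum>i<length \<beta>. if w x \<le> \<beta> ! i then pcoeff w I (\<beta>[i := \<beta> ! i - w x]) else 0)"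
  unfolding pcoeff_def using assms by (simp add: mcoeff_power_sum_mult_nth)

lemma sum_Pow_insert:
  assumes "finite I" "x \<notin> I"
  shows "(\<Sum>S\<in>Pow (insert x I). F S) = (\<Sum>S\<in>Pow I. F S) + (\<Sum>S\<in>Pow I. F (insert x S))"
proof -
  have "inj_on (insert x) (Pow I)" using assms(2) by (intro inj_onI) (metis Diff_insert_absorb PowD subsetD)
  then show ?thesis
    unfolding Pow_insert using assms by (subst sum.union_disjoint) (auto simp: sum.reindex)
qed

text \<open>\<open>S\<close> is the set of factors that raise the first variable. A further factor
  either joins \<open>S\<close> or acts on a later position; these are the two halves of the subset
  sum over the enlarged index set.\<close>

lemma pcoeff_Cons:
  assumes "finite I" "\<And>j. j \<in> I \<Longrightarrow> w j > 0"
  shows "pcoeff w I (b # \<beta>) = (\<Sum>S\<in>Pow I. if sum w S = b then pcoeff w (I - S) \<beta> else 0)"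
  using assms
proof (induction I arbitrary: b \<beta> rule: finite_induct)
  case empty
  have "Poly_Mapping.nth (b # \<beta>) = 0 \<longleftrightarrow> b = 0 \<and> Poly_Mapping.nth \<beta> = 0"
    by (auto simp flip: total_degree_eq_0_iff simp: total_degree_nth)
  moreover have "(\<Sum>S\<in>Pow {}. if sum w S = b then pcoeff w ({} - S) \<beta> else 0) =
      (if b = 0 then pcoeff w {} \<beta> else 0)"
    by (auto simp: Pow_empty)
  ultimately show ?case by (auto simp: pcoeff_def mcoeff_1)
next
  case (insert x I)
  have pos: "w x > 0" using insert.prems by simp
  have IH: "pcoeff w I (b # \<beta>) = (\<Sum>S\<in>Pow I. if sum w S = b then pcoeff w (I - S) \<beta> else 0)" for b \<beta>
    using insert.IH insert.prems by simp
  have "pcoeff w (insert x I) (b # \<beta>) = (if w x \<le> b then pcoeff w I ((b - w x) # \<beta>) else 0) +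
      (\<Sum>i<length \<beta>. if w x \<le> \<beta> ! i then pcoeff w I (b # \<beta>[i := \<beta> ! i - w x]) else 0)"
    using insert.hyps pos by (simp add: pcoeff_insert sum.lessThan_Suc_shift cong: if_cong del: sum.lessThan_Suc)
  moreover have "(if w x \<le> b then pcoeff w I ((b - w x) # \<beta>) else 0) =
      (\<Sum>S\<in>Pow I. if sum w (insert x S) = b then pcoeff w (insert x I - insert x S) \<beta> else 0)"
  proof -
    have "sum w (insert x S) = w x + sum w S" "insert x I - insert x S = I - S" if "S \<in> Pow I" for S
      using that insert.hyps finite_subset[of S I] by (auto simp: sum.insert_if)
    then show ?thesis unfolding IH by (auto intro!: sum.cong sum.neutral[symmetric])
  qed
  moreover have "(\<Sum>i<length \<beta>. if w x \<le> \<beta> ! i then pcoeff w I (b # \<beta>[i := \<beta> ! i - w x]) else 0) =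
      (\<Sum>S\<in>Pow I. if sum w S = b then pcoeff w (insert x I - S) \<beta> else 0)"
  proof -
    have "(\<Sum>i<length \<beta>. if w x \<le> \<beta> ! i then pcoeff w I (b # \<beta>[i := \<beta> ! i - w x]) else 0) =
      (\<Sum>i<length \<beta>. \<Sum>S\<in>Pow I. if sum w S = b then
         (if w x \<le> \<beta> ! i then pcoeff w (I - S) (\<beta>[i := \<beta> ! i - w x]) else 0) else 0)"
      unfolding IH by (intro sum.cong refl) (auto intro!: sum.cong sum.neutral)
    also have "\<dots> = (\<Sum>S\<in>Pow I. if sum w S = b then pcoeff w (insert x (I - S)) \<beta> else 0)"
      using insert.hyps pos
      by (subst sum.swap) (auto simp: pcoeff_insert intro!: sum.cong)
    also have "\<dots> = (\<Sum>S\<in>Pow I. if sum w S = b then pcoeff w (insert x I - S) \<beta> else 0)"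
    proof (intro sum.cong refl)
      fix S assume "S \<in> Pow I"
      then have "insert x (I - S) = insert x I - S" using insert.hyps by auto
      then show "(if sum w S = b then pcoeff w (insert x (I - S)) \<beta> else 0) =
        (if sum w S = b then pcoeff w (insert x I - S) \<beta> else 0)" by simp
    qed
    finally show ?thesis .
  qed
  ultimately show ?case using insert.hyps by (simp add: sum_Pow_insert)
qed

lemma pcoeff_rev: "finite I \<Longrightarrow> pcoeff w I (rev \<beta>) = pcoeff w I \<beta>"
proof -
  assume "finite I"
  then have "(\<Prod>j\<in>I. power_sum (w j)) \<in> homogeneous_symmetric (\<Sum>j\<in>I. w j)"
    by (induction I rule: finite_induct)
       (auto intro: homogeneous_symmetric_1 homogeneous_symmetric_mult power_sum_homogeneous_symmetric)
  then show ?thesis unfolding pcoeff_def by (rule homogeneous_symmetric_mset) simp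
qed

text \<open>Choosing the length of the first block and the factors it receives leaves the same
  problem for the rest of the composition and \<open>I - S\<close>. All evaluations rest on this
  recursion.\<close>

lemma coarse_sum_pcoeff_unfold:
  assumes "finite I" "\<And>j. j \<in> I \<Longrightarrow> w j > 0" "\<alpha> \<noteq> []" "0 \<notin> set \<alpha>"
  shows "coarse_sum \<alpha> (pcoeff w I) = (\<Sum>k<length \<alpha>. \<Sum>S | S \<subseteq> I \<and> sum w S = sum_list (take (Suc k) \<alpha>).
    (-1) ^ k * coarse_sum (drop (Suc k) \<alpha>) (pcoeff w (I - S)))"
proof -
  have "coarse_sum \<alpha>' (\<lambda>\<beta>. pcoeff w I (b # \<beta>)) =
      (\<Sum>S | S \<subseteq> I \<and> sum w S = b. coarse_sum \<alpha>' (pcoeff w (I - S)))" for \<alpha>' b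
  proof -
    have "pcoeff w I (b # \<beta>) = (\<Sum>S | S \<subseteq> I \<and> sum w S = b. pcoeff w (I - S) \<beta>)" for \<beta>
    proof -
      have "pcoeff w I (b # \<beta>) = (\<Sum>S\<in>Pow I. if sum w S = b then pcoeff w (I - S) \<beta> else 0)"
        using assms(1,2) by (rule pcoeff_Cons)
      also have "\<dots> = (\<Sum>S | S \<subseteq> I \<and> sum w S = b. pcoeff w (I - S) \<beta>)"
        using assms(1) by (intro sum.mono_neutral_cong_right) auto
      finally show ?thesis .
    qed
    then show ?thesis by (simp add: coarse_sum_sum)
  qed
  then show ?thesis
    unfolding coarse_sum_unfold[OF assms(3,4)] by (simp add: sum_distrib_left)
qed

text \<open>Injectivity of \<open>b\<close> makes the inner index sets disjoint, so a sum over block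
  lengths becomes one over subsets of admissible weight; admissibility will turn out to be a parity
  condition.\<close>

lemma sum_group_weights:
  fixes b :: "nat \<Rightarrow> nat"
  assumes "finite I" "inj_on b {..<m}"
  shows "(\<Sum>k<m. \<Sum>S | S \<subseteq> I \<and> sum w S = b k. g S) = (\<Sum>S | S \<subseteq> I \<and> sum w S \<in> b ` {..<m}. g S)"
proof -
  have "(\<Sum>S\<in>(\<Union>k<m. {S. S \<subseteq> I \<and> sum w S = b k}). g S) = (\<Sum>k<m. \<Sum>S | S \<subseteq> I \<and> sum w S = b k. g S)"
    using assms by (intro sum.UNION_disjoint) (auto dest: inj_onD)
  moreover have "(\<Union>k<m. {S. S \<subseteq> I \<and> sum w S = b k}) = {S. S \<subseteq> I \<and> sum w S \<in> b ` {..<m}}" by auto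
  ultimately show ?thesis by simp
qed

section \<open>Binomial convolution over subsets, by parity of the weights\<close>

lemma sum_Pow_card:
  fixes F :: "nat \<Rightarrow> rat"
  assumes "finite A"
  shows "(\<Sum>S\<in>Pow A. F (card S)) = (\<Sum>j\<le>card A. of_nat (card A choose j) * F j)"
proof -
  have "(\<Sum>S\<in>Pow A. F (card S)) = (\<Sum>j\<le>card A. \<Sum>S | S \<in> Pow A \<and> card S = j. F (card S))"
    using assms by (intro sum.group[symmetric]) (auto intro: card_mono)
  also have "\<dots> = (\<Sum>j\<le>card A. of_nat (card A choose j) * F j)"
    using n_subsets[OF assms] by (intro sum.cong refl) simp
  finally show ?thesis .
qed

definition nodd :: "('i \<Rightarrow> nat) \<Rightarrow> 'i set \<Rightarrow> nat" where
  "nodd w I = card {j \<in> I. odd (w j)}"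

definition neven :: "('i \<Rightarrow> nat) \<Rightarrow> 'i set \<Rightarrow> nat" where
  "neven w I = card {j \<in> I. even (w j)}"

text \<open>A subset is a free choice among the odd weights and among the even ones: this is
  multiplication of exponential generating functions in x and y.\<close>

lemma sum_Pow_nodd_neven:
  fixes F H :: "nat \<Rightarrow> rat"
  assumes "finite I"
  shows "(\<Sum>S\<in>Pow I. F (nodd w S) * H (neven w S)) =
    (\<Sum>j\<le>nodd w I. of_nat (nodd w I choose j) * F j) * (\<Sum>j\<le>neven w I. of_nat (neven w I choose j) * H j)"
proof -
  let ?O = "{j \<in> I. odd (w j)}" and ?E = "{j \<in> I. even (w j)}"
  have "(\<Sum>S\<in>Pow I. F (nodd w S) * H (neven w S)) = (\<Sum>(A, B)\<in>Pow ?O \<times> Pow ?E. F (card A) * H (card B))"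
    by (rule sum.reindex_bij_witness[where i = "\<lambda>(A, B). A \<union> B" and
          j = "\<lambda>S. ({j \<in> S. odd (w j)}, {j \<in> S. even (w j)})"])
       (auto simp: nodd_def neven_def)
  also have "\<dots> = (\<Sum>A\<in>Pow ?O. F (card A)) * (\<Sum>B\<in>Pow ?E. H (card B))"
    by (simp add: sum_product sum.cartesian_product)
  also have "\<dots> = (\<Sum>j\<le>nodd w I. of_nat (nodd w I choose j) * F j) * (\<Sum>j\<le>neven w I. of_nat (neven w I choose j) * H j)"
    using assms by (simp add: sum_Pow_card nodd_def neven_def)
  finally show ?thesis .
qed

lemma even_sum_nodd: "finite I \<Longrightarrow> even (sum w I) \<longleftrightarrow> even (nodd w I)"
  by (simp add: even_sum_iff nodd_def)

lemma nodd_Diff: "finite I \<Longrightarrow> S \<subseteq> I \<Longrightarrow> nodd w (I - S) = nodd w I - nodd w S"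
  unfolding nodd_def
  by (subst card_Diff_subset[symmetric]) (auto intro: arg_cong[where f = card] finite_subset)

lemma neven_Diff: "finite I \<Longrightarrow> S \<subseteq> I \<Longrightarrow> neven w (I - S) = neven w I - neven w S"
  unfolding neven_def
  by (subst card_Diff_subset[symmetric]) (auto intro: arg_cong[where f = card] finite_subset)

section \<open>Euler numbers\<close>

text \<open>Since sech x = sec (ix) and tanh x = -i tan (ix), this is the sign by which coefficient
  k changes when passing to hyperbolic functions.\<close>

abbreviation half_sign :: "nat \<Rightarrow> rat" where
  "half_sign k \<equiv> (-1) ^ (k div 2)"

lemma fact_mult_euler_nth:
  fixes u :: "nat \<Rightarrow> rat"
  assumes "\<And>j. fps_nth F j = u j / fact j"
  shows "fact a * fps_nth (F * (inverse (fps_cos 1) + fps_tan 1)) a =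
    (\<Sum>j\<le>a. of_nat (a choose j) * (u j * euler_number (a - j)))"
proof -
  let ?G = "inverse (fps_cos 1) + fps_tan 1 :: rat fps"
  have G: "fps_nth ?G k = euler_number k / fact k" for k by (simp add: euler_number_def del: fps_add_nth)
  have "fact a * fps_nth (F * ?G) a = (\<Sum>j\<le>a. fact a * (fps_nth F j * fps_nth ?G (a - j)))"
    by (simp add: fps_mult_nth atLeast0AtMost sum_distrib_left del: fps_add_nth)
  also have "\<dots> = (\<Sum>j\<le>a. of_nat (a choose j) * (u j * euler_number (a - j)))"
    by (intro sum.cong refl) (simp add: assms G binomial_fact del: fps_add_nth)
  finally show ?thesis .
qed

text \<open>Coefficient form of cos (sec + tan) = 1 + sin. For even \<open>a\<close> the sine is
  absent and the recursion of the secant numbers remains.\<close>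

lemma euler_cos_sum:
  "(\<Sum>j\<le>a. of_nat (a choose j) * ((if even j then half_sign j else 0) * euler_number (a - j))) =
     (if a = 0 then 1 else 0) + (if odd a then half_sign a else 0)"
proof -
  let ?c = "fps_cos 1 :: rat fps" and ?s = "fps_sin 1 :: rat fps"
  have c0: "fps_nth ?c 0 \<noteq> 0" by (simp add: fps_cos_def)
  have "?c * (inverse ?c + fps_tan 1) = ?c * inverse ?c + ?s * (?c * inverse ?c)"
    by (simp add: fps_tan_def fps_divide_unit[OF c0] algebra_simps)
  also have "\<dots> = 1 + ?s" using inverse_mult_eq_1'[OF c0] by simp
  finally have eq: "?c * (inverse ?c + fps_tan 1) = 1 + ?s" .
  have "fact a * fps_nth (1 + ?s) a =
      (\<Sum>j\<le>a. of_nat (a choose j) * ((if even j then half_sign j else 0) * euler_number (a - j)))"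
    unfolding eq[symmetric] by (rule fact_mult_euler_nth) (simp add: fps_cos_def)
  moreover have "fact a * fps_nth (1 + ?s) a = (if a = 0 then 1 else 0) + (if odd a then half_sign a else 0)"
    by (auto simp: fps_sin_def elim!: oddE)
  ultimately show ?thesis by simp
qed

text \<open>Coefficient form of sin (sec + tan) = sec + tan - cos. Odd \<open>a\<close> isolates sin
  sec = tan and even \<open>a\<close> isolates sin tan = sec - cos; both are used.\<close>

lemma euler_sin_sum:
  "(\<Sum>j\<le>a. of_nat (a choose j) * ((if odd j then half_sign j else 0) * euler_number (a - j))) =
     euler_number a - (if even a then half_sign a else 0)"
proof -
  let ?c = "fps_cos 1 :: rat fps" and ?s = "fps_sin 1 :: rat fps"
  let ?G = "inverse ?c + fps_tan 1"
  have c0: "fps_nth ?c 0 \<noteq> 0" by (simp add: fps_cos_def)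
  have inv: "?c * inverse ?c = 1" using inverse_mult_eq_1'[OF c0] .
  have s2: "?s * ?s = 1 - ?c * ?c"
    using fps_sin_cos_sum_of_squares[of "1 :: rat"] by (simp add: power2_eq_square algebra_simps)
  have "?s * ?G = ?s * inverse ?c + (?s * ?s) * inverse ?c"
    by (simp add: fps_tan_def fps_divide_unit[OF c0] algebra_simps)
  also have "\<dots> = ?s * inverse ?c + inverse ?c - ?c * (?c * inverse ?c)"
    unfolding s2 by (simp add: algebra_simps)
  also have "\<dots> = ?G - ?c"
    by (simp add: inv fps_tan_def fps_divide_unit[OF c0])
  finally have eq: "?s * ?G = ?G - ?c" .
  have "fact a * fps_nth (?G - ?c) a =
      (\<Sum>j\<le>a. of_nat (a choose j) * ((if odd j then half_sign j else 0) * euler_number (a - j)))"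
    unfolding eq[symmetric] by (rule fact_mult_euler_nth) (auto simp: fps_sin_def elim!: oddE)
  moreover have "fact a * fps_nth (?G - ?c) a = euler_number a - (if even a then half_sign a else 0)"
    unfolding fps_sub_nth right_diff_distrib by (simp add: euler_number_def fps_cos_def)
  ultimately show ?thesis by simp
qed

lemma euler_number_0: "euler_number 0 = 1"
  using euler_cos_sum[of 0] by simp

text \<open>With a = \<open>nodd w I\<close> even and b = \<open>neven w I\<close>, the coefficient
  of x^a y^b / (a! b!) in sech x e^-y.\<close>

definition sec_weight :: "('i \<Rightarrow> nat) \<Rightarrow> 'i set \<Rightarrow> rat" where
  "sec_weight w I = (-1) ^ neven w I * (half_sign (nodd w I) * euler_number (nodd w I))"

text \<open>For odd \<open>nodd w I\<close>, the corresponding coefficient of tanh x; the absence of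
  y is the condition on \<open>neven\<close>.\<close>

definition tan_weight :: "('i \<Rightarrow> nat) \<Rightarrow> 'i set \<Rightarrow> rat" where
  "tan_weight w I = (if neven w I = 0 then half_sign (nodd w I) * euler_number (nodd w I) else 0)"

text \<open>The parity of \<open>sum w S\<close> is that of \<open>nodd w S\<close>, so the
  constraint touches only the factor of the odd weights and the sum still splits as a
  product.\<close>

lemma sum_subsets_parity:
  fixes F H :: "nat \<Rightarrow> rat"
  assumes "finite I"
  shows "(\<Sum>S | S \<subseteq> I \<and> even (sum w S) = e. F (nodd w (I - S)) * H (neven w (I - S))) =
    (\<Sum>j\<le>nodd w I. of_nat (nodd w I choose j) * (if even j = e then F (nodd w I - j) else 0)) *
    (\<Sum>j\<le>neven w I. of_nat (neven w I choose j) * H (neven w I - j))"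
proof -
  have "(\<Sum>S | S \<subseteq> I \<and> even (sum w S) = e. F (nodd w (I - S)) * H (neven w (I - S))) =
    (\<Sum>S\<in>Pow I. (if even (nodd w S) = e then F (nodd w I - nodd w S) else 0) * H (neven w I - neven w S))"
    using assms finite_subset[OF _ assms]
    by (intro sum.mono_neutral_cong_left) (auto simp: even_sum_nodd nodd_Diff neven_Diff)
  then show ?thesis
    using sum_Pow_nodd_neven[OF assms, of "\<lambda>j. if even j = e then F (nodd w I - j) else 0" w
        "\<lambda>j. H (neven w I - j)"] by simp
qed

lemma alternating_binomial_sum: "(\<Sum>j\<le>b. of_nat (b choose j) * (-1) ^ (b - j)) = (if b = 0 then 1 else 0 :: rat)"
  using binomial_ring[of 1 "-1 :: rat" b] by (simp add: power_0_left)

text \<open>For even \<open>a\<close> and odd \<open>j\<close> the half of a - j is one less than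
  the difference of the halves; in all other cases they agree.\<close>

lemma half_sign_diff:
  assumes "j \<le> a"
  shows "half_sign (a - j) = (if even a \<and> odd j then -1 else 1) * half_sign a * half_sign j"
proof -
  obtain i where a: "a = i + j" using assms le_Suc_ex by (metis add.commute)
  show ?thesis unfolding a by (cases "even i"; cases "even j") (auto elim!: evenE oddE simp: power_add)
qed

text \<open>cosh x e^y times sech x e^-y is 1, whose coefficients vanish away from the empty index
  set.\<close>

lemma sum_even_subsets_sec_weight:
  assumes "finite I" "even (sum w I)" "I \<noteq> {}"
  shows "(\<Sum>S | S \<subseteq> I \<and> even (sum w S). sec_weight w (I - S)) = 0"
proof -
  let ?a = "nodd w I" and ?b = "neven w I"
  have a: "even ?a" using assms even_sum_nodd by blast
  have "(\<Sum>S | S \<subseteq> I \<and> even (sum w S) = True. sec_weight w (I - S)) =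
    (\<Sum>j\<le>?a. of_nat (?a choose j) * (if even j = True then half_sign (?a - j) * euler_number (?a - j) else 0)) *
    (\<Sum>j\<le>?b. of_nat (?b choose j) * (-1) ^ (?b - j))"
    unfolding sec_weight_def
    using sum_subsets_parity[OF assms(1), where w = w and e = True and
        F = "\<lambda>k. half_sign k * euler_number k" and H = "\<lambda>k. (-1) ^ k"]
    by (simp add: mult.commute)
  also have "(\<Sum>j\<le>?a. of_nat (?a choose j) * (if even j = True then half_sign (?a - j) * euler_number (?a - j) else 0)) =
    half_sign ?a * (\<Sum>j\<le>?a. of_nat (?a choose j) * ((if even j then half_sign j else 0) * euler_number (?a - j)))"
    unfolding sum_distrib_left by (intro sum.cong refl) (simp add: half_sign_diff)
  also have "\<dots> = half_sign ?a * (if ?a = 0 then 1 else 0)"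
    using a by (simp add: euler_cos_sum)
  also have "\<dots> * (\<Sum>j\<le>?b. of_nat (?b choose j) * (-1) ^ (?b - j)) = (if ?a = 0 \<and> ?b = 0 then 1 else 0)"
    by (simp add: alternating_binomial_sum)
  also have "\<dots> = 0"
    using assms(1,3) by (auto simp: nodd_def neven_def)
  finally show ?thesis by simp
qed

text \<open>sinh x e^y times sech x e^-y is tanh x.\<close>

lemma sum_odd_subsets_sec_weight:
  assumes "finite I" "odd (sum w I)"
  shows "(\<Sum>S | S \<subseteq> I \<and> odd (sum w S). sec_weight w (I - S)) = tan_weight w I"
proof -
  let ?a = "nodd w I" and ?b = "neven w I"
  have a: "odd ?a" using assms even_sum_nodd by blast
  have "(\<Sum>S | S \<subseteq> I \<and> even (sum w S) = False. sec_weight w (I - S)) =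
    (\<Sum>j\<le>?a. of_nat (?a choose j) * (if even j = False then half_sign (?a - j) * euler_number (?a - j) else 0)) *
    (\<Sum>j\<le>?b. of_nat (?b choose j) * (-1) ^ (?b - j))"
    unfolding sec_weight_def
    using sum_subsets_parity[OF assms(1), where w = w and e = False and
        F = "\<lambda>k. half_sign k * euler_number k" and H = "\<lambda>k. (-1) ^ k"]
    by (simp add: mult.commute)
  also have "(\<Sum>j\<le>?a. of_nat (?a choose j) * (if even j = False then half_sign (?a - j) * euler_number (?a - j) else 0)) =
    half_sign ?a * (\<Sum>j\<le>?a. of_nat (?a choose j) * ((if odd j then half_sign j else 0) * euler_number (?a - j)))"
    unfolding sum_distrib_left using a by (intro sum.cong refl) (simp add: half_sign_diff)
  also have "\<dots> = half_sign ?a * euler_number ?a"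
    using a by (simp add: euler_sin_sum)
  finally show ?thesis by (simp add: alternating_binomial_sum tan_weight_def)
qed

text \<open>sinh x e^y times tanh x is e^y (cosh x - sech x), and the coefficients of e^y cosh x at
  even powers of x are 1.\<close>

lemma sum_odd_subsets_tan_weight:
  assumes "finite I" "even (sum w I)"
  shows "(\<Sum>S | S \<subseteq> I \<and> odd (sum w S). tan_weight w (I - S)) =
    1 - half_sign (nodd w I) * euler_number (nodd w I)"
proof -
  let ?a = "nodd w I" and ?b = "neven w I"
  have a: "even ?a" using assms even_sum_nodd by blast
  have "(\<Sum>S | S \<subseteq> I \<and> even (sum w S) = False. tan_weight w (I - S)) =
    (\<Sum>j\<le>?a. of_nat (?a choose j) * (if even j = False then half_sign (?a - j) * euler_number (?a - j) else 0)) *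
    (\<Sum>j\<le>?b. of_nat (?b choose j) * (if ?b - j = 0 then 1 else 0))"
    unfolding tan_weight_def
    using sum_subsets_parity[OF assms(1), where w = w and e = False and
        F = "\<lambda>k. half_sign k * euler_number k" and H = "\<lambda>k. if k = 0 then 1 else 0"]
    by (simp add: if_distrib cong: if_cong)
  \<comment> \<open>\<open>tan_weight\<close> admits no even weight outside \<open>S\<close>, so
    \<open>S\<close> takes all of them.\<close>
  also have "(\<Sum>j\<le>?b. of_nat (?b choose j) * (if ?b - j = 0 then 1 else 0)) = (\<Sum>j\<in>{?b}. 1 :: rat)"
    by (rule sum.mono_neutral_cong_right) auto
  also have "(\<Sum>j\<le>?a. of_nat (?a choose j) * (if even j = False then half_sign (?a - j) * euler_number (?a - j) else 0)) =
    - half_sign ?a * (\<Sum>j\<le>?a. of_nat (?a choose j) * ((if odd j then half_sign j else 0) * euler_number (?a - j)))"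
    unfolding sum_distrib_left using a by (intro sum.cong refl) (simp add: half_sign_diff)
  also have "\<dots> = 1 - half_sign ?a * euler_number ?a"
    using a by (simp add: euler_sin_sum right_diff_distrib flip: power_add)
  finally show ?thesis by simp
qed

section \<open>Evaluation for the alternating compositions\<close>

lemma pcoeff_empty_Nil: "pcoeff w {} [] = 1"
  by (simp add: pcoeff_def mcoeff_1)

lemma sum_Diff_weights: "finite I \<Longrightarrow> S \<subseteq> I \<Longrightarrow> sum w (I - S) = sum w I - (sum w S :: nat)"
  by (simp add: sum_diff_nat finite_subset)

lemma sum_weights_le: "finite I \<Longrightarrow> S \<subseteq> I \<Longrightarrow> sum w S \<le> (sum w I :: nat)"
  by (simp add: sum_mono2)

text \<open>After splitting off the first block, every term has sign (-1)^(m - 1). The block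
  receives a nonempty even subset; over all even subsets the weights cancel, so what remains is
  minus the term of the empty subset.\<close>

lemma coarse_sum_evens:
  assumes "finite I" "\<And>j. j \<in> I \<Longrightarrow> w j > 0" "sum w I = 2 * m"
  shows "coarse_sum (replicate m 2) (pcoeff w I) = (-1) ^ m * sec_weight w I"
  using assms
proof (induction m arbitrary: I rule: less_induct)
  case (less m)
  show ?case
  proof (cases "m = 0")
    case True
    then have "I = {}" using less.prems by force
    then show ?thesis using True by (simp add: pcoeff_empty_Nil sec_weight_def neven_def nodd_def euler_number_0)
  next
    case False
    have "I \<noteq> {}" using False less.prems by auto
    have "coarse_sum (replicate m 2) (pcoeff w I) = (\<Sum>k<m. \<Sum>S | S \<subseteq> I \<and> sum w S = 2 * Suc k.
        (-1) ^ k * coarse_sum (replicate (m - Suc k) 2) (pcoeff w (I - S)))"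
      using False by (subst coarse_sum_pcoeff_unfold[OF less.prems(1,2)])
        (auto simp: sum_list_replicate min_def intro!: sum.cong)
    also have "\<dots> = (\<Sum>k<m. \<Sum>S | S \<subseteq> I \<and> sum w S = 2 * Suc k. (-1) ^ (m - 1) * sec_weight w (I - S))"
    proof (intro sum.cong refl)
      fix k S assume k: "k \<in> {..<m}" and S: "S \<in> {S. S \<subseteq> I \<and> sum w S = 2 * Suc k}"
      have "coarse_sum (replicate (m - Suc k) 2) (pcoeff w (I - S)) = (-1) ^ (m - Suc k) * sec_weight w (I - S)"
        by (rule less.IH) (use k S less.prems in \<open>auto simp: sum_Diff_weights\<close>)
      moreover have "k + (m - Suc k) = m - 1" using k by auto
      ultimately show "(-1) ^ k * coarse_sum (replicate (m - Suc k) 2) (pcoeff w (I - S)) =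
          (-1) ^ (m - 1) * sec_weight w (I - S)"
        by (metis mult.assoc power_add)
    qed
    also have "\<dots> = (\<Sum>S | S \<subseteq> I \<and> sum w S \<in> (\<lambda>k. 2 * Suc k) ` {..<m}. (-1) ^ (m - 1) * sec_weight w (I - S))"
      using less.prems(1) by (intro sum_group_weights) (auto simp: inj_on_def)
    \<comment> \<open>Positive weights give every nonempty subset positive weight, so the even
      weights from 2 to 2m exclude only the empty set.\<close>
    also have "{S. S \<subseteq> I \<and> sum w S \<in> (\<lambda>k. 2 * Suc k) ` {..<m}} = {S. S \<subseteq> I \<and> even (sum w S)} - {{}}"
    proof (intro set_eqI iffI)
      fix S assume "S \<in> {S. S \<subseteq> I \<and> even (sum w S)} - {{}}"
      then have S: "S \<subseteq> I" "even (sum w S)" "S \<noteq> {}" by auto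
      obtain x where x: "x \<in> S" using S by blast
      have "w x \<le> sum w S" using x finite_subset[OF S(1) less.prems(1)] by (intro member_le_sum) auto
      moreover have "w x > 0" using less.prems(2) x S(1) by blast
      moreover obtain k where k: "sum w S = 2 * k" using S(2) by (rule evenE)
      moreover have "sum w S \<le> 2 * m" using sum_weights_le[OF less.prems(1) S(1)] less.prems(3) by metis
      ultimately have "sum w S = 2 * Suc (k - 1)" "k - 1 < m" by auto
      then show "S \<in> {S. S \<subseteq> I \<and> sum w S \<in> (\<lambda>k. 2 * Suc k) ` {..<m}}" using S by blast
    qed auto
    also have "(\<Sum>S\<in>\<dots>. (-1) ^ (m - 1) * sec_weight w (I - S)) =
        (-1) ^ (m - 1) * ((\<Sum>S | S \<subseteq> I \<and> even (sum w S). sec_weight w (I - S)) - sec_weight w I)"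
      using less.prems(1) by (simp add: sum_diff1 flip: sum_distrib_left)
    also have "\<dots> = (-1) ^ m * sec_weight w I"
      using sum_even_subsets_sec_weight[OF less.prems(1) _ \<open>I \<noteq> {}\<close>] less.prems(3) False
      by (cases m) auto
    finally show ?thesis .
  qed
qed

lemma odd_weights_image:
  assumes "finite I" "sum w I \<le> 2 * m + 2"
  shows "{S. S \<subseteq> I \<and> sum w S \<in> (\<lambda>k. 2 * k + 1) ` {..<Suc m}} = {S. S \<subseteq> I \<and> odd (sum w S)}"
proof (intro set_eqI iffI)
  fix S assume "S \<in> {S. S \<subseteq> I \<and> odd (sum w S)}"
  then have S: "S \<subseteq> I" "odd (sum w S)" by auto
  obtain k where k: "sum w S = 2 * k + 1" using S(2) by (rule oddE)
  moreover have "sum w S \<le> 2 * m + 2" using sum_weights_le[OF assms(1) S(1), of w] assms(2) by linarith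
  ultimately have "k < Suc m" by simp
  then show "S \<in> {S. S \<subseteq> I \<and> sum w S \<in> (\<lambda>k. 2 * k + 1) ` {..<Suc m}}" using S k by blast
qed auto

text \<open>The first block contains the leading 1 and so takes an odd subset; what follows is a row
  of 2s.\<close>

lemma coarse_sum_one_evens:
  assumes "finite I" "\<And>j. j \<in> I \<Longrightarrow> w j > 0" "sum w I = 2 * m + 1"
  shows "coarse_sum (1 # replicate m 2) (pcoeff w I) = (-1) ^ m * tan_weight w I"
proof -
  have "sum w I \<le> 2 * m + 2" using assms(3) by simp
  note sets = odd_weights_image[OF assms(1) this]
  have "coarse_sum (1 # replicate m 2) (pcoeff w I) = (\<Sum>k<Suc m. \<Sum>S | S \<subseteq> I \<and> sum w S = 2 * k + 1.
      (-1) ^ k * coarse_sum (replicate (m - k) 2) (pcoeff w (I - S)))"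
    by (subst coarse_sum_pcoeff_unfold[OF assms(1,2)])
       (auto simp: sum_list_replicate min_def simp del: sum.lessThan_Suc intro!: sum.cong)
  also have "\<dots> = (\<Sum>k<Suc m. \<Sum>S | S \<subseteq> I \<and> sum w S = 2 * k + 1. (-1) ^ m * sec_weight w (I - S))"
  proof (intro sum.cong refl)
    fix k S assume k: "k \<in> {..<Suc m}" and S: "S \<in> {S. S \<subseteq> I \<and> sum w S = 2 * k + 1}"
    have "coarse_sum (replicate (m - k) 2) (pcoeff w (I - S)) = (-1) ^ (m - k) * sec_weight w (I - S)"
      by (rule coarse_sum_evens) (use k S assms in \<open>auto simp: sum_Diff_weights\<close>)
    moreover have "k + (m - k) = m" using k by auto
    ultimately show "(-1) ^ k * coarse_sum (replicate (m - k) 2) (pcoeff w (I - S)) =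
        (-1) ^ m * sec_weight w (I - S)"
      by (metis mult.assoc power_add)
  qed
  also have "\<dots> = (\<Sum>S | S \<subseteq> I \<and> sum w S \<in> (\<lambda>k. 2 * k + 1) ` {..<Suc m}. (-1) ^ m * sec_weight w (I - S))"
    using assms(1) by (intro sum_group_weights) (auto simp: inj_on_def)
  also have "\<dots> = (-1) ^ m * (\<Sum>S | S \<subseteq> I \<and> odd (sum w S). sec_weight w (I - S))"
    unfolding sets by (simp add: sum_distrib_left)
  also have "\<dots> = (-1) ^ m * tan_weight w I"
    using assms by (simp add: sum_odd_subsets_sec_weight)
  finally show ?thesis .
qed

lemma coarse_sum_evens_one:
  assumes "finite I" "\<And>j. j \<in> I \<Longrightarrow> w j > 0" "sum w I = 2 * m + 1"
  shows "coarse_sum (replicate m 2 @ [1]) (pcoeff w I) = (-1) ^ m * tan_weight w I"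
  using coarse_sum_rev[of "pcoeff w I" "1 # replicate m 2"] pcoeff_rev[OF assms(1)]
    coarse_sum_one_evens[OF assms] by simp

text \<open>The first block either takes an odd subset and leaves (2, ..., 2, 1), or takes
  everything. The latter term cancels the constant 1 of
  \<open>sum_odd_subsets_tan_weight\<close>.\<close>

lemma coarse_sum_one_evens_one:
  assumes "finite I" "\<And>j. j \<in> I \<Longrightarrow> w j > 0" "sum w I = 2 * m + 2"
  shows "coarse_sum (1 # replicate m 2 @ [1]) (pcoeff w I) =
    (-1) ^ Suc m * (half_sign (nodd w I) * euler_number (nodd w I))"
proof -
  have "sum w I \<le> 2 * m + 2" using assms(3) by simp
  note sets = odd_weights_image[OF assms(1) this]
  let ?\<alpha> = "1 # replicate m 2 @ [1] :: nat list"
  let ?T = "\<lambda>k. \<Sum>S | S \<subseteq> I \<and> sum w S = sum_list (take (Suc k) ?\<alpha>).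
      (-1) ^ k * coarse_sum (drop (Suc k) ?\<alpha>) (pcoeff w (I - S))"
  have "coarse_sum ?\<alpha> (pcoeff w I) = (\<Sum>k<Suc (Suc m). ?T k)"
    using coarse_sum_pcoeff_unfold[OF assms(1,2), where \<alpha> = ?\<alpha>] by simp
  also have "\<dots> = (\<Sum>k<Suc m. ?T k) + ?T (Suc m)" by simp
  \<comment> \<open>The first block is now the whole composition; its weight is that of
    \<open>I\<close>, and positive weights leave only \<open>S = I\<close>.\<close>
  also have "?T (Suc m) = (-1) ^ Suc m"
  proof -
    have "S = I" if S: "S \<subseteq> I" "sum w S = sum w I" for S
    proof (rule ccontr)
      assume "S \<noteq> I"
      then obtain x where x: "x \<in> I - S" using S(1) by blast
      have "w x \<le> sum w (I - S)" using x assms(1) by (intro member_le_sum) auto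
      also have "\<dots> = 0" using that sum_Diff_weights[OF assms(1) that(1)] by simp
      finally show False using assms(2)[of x] x by simp
    qed
    moreover have "sum_list (take (Suc (Suc m)) ?\<alpha>) = sum w I"
      using assms(3) by (simp add: sum_list_replicate)
    ultimately have "{S. S \<subseteq> I \<and> sum w S = sum_list (take (Suc (Suc m)) ?\<alpha>)} = {I}"
      by auto
    then show ?thesis by (simp add: pcoeff_empty_Nil)
  qed
  also have "(\<Sum>k<Suc m. ?T k) = (\<Sum>k<Suc m. \<Sum>S | S \<subseteq> I \<and> sum w S = 2 * k + 1. (-1) ^ m * tan_weight w (I - S))"
  proof (rule sum.cong[OF refl])
    fix k assume k: "k \<in> {..<Suc m}"
    have 1: "sum_list (take (Suc k) ?\<alpha>) = 2 * k + 1" "drop (Suc k) ?\<alpha> = replicate (m - k) 2 @ [1]"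
      using k by (auto simp: sum_list_replicate min_def)
    have "(-1) ^ k * coarse_sum (replicate (m - k) 2 @ [1]) (pcoeff w (I - S)) = (-1) ^ m * tan_weight w (I - S)"
      if "S \<subseteq> I \<and> sum w S = 2 * k + 1" for S
    proof -
      have "coarse_sum (replicate (m - k) 2 @ [1]) (pcoeff w (I - S)) = (-1) ^ (m - k) * tan_weight w (I - S)"
        by (rule coarse_sum_evens_one) (use k that assms in \<open>auto simp: sum_Diff_weights\<close>)
      moreover have "k + (m - k) = m" using k by auto
      ultimately show ?thesis by (metis mult.assoc power_add)
    qed
    then show "?T k = (\<Sum>S | S \<subseteq> I \<and> sum w S = 2 * k + 1. (-1) ^ m * tan_weight w (I - S))"
      unfolding 1 by (intro sum.cong refl) auto
  qed
  also have "\<dots> = (\<Sum>S | S \<subseteq> I \<and> sum w S \<in> (\<lambda>k. 2 * k + 1) ` {..<Suc m}. (-1) ^ m * tan_weight w (I - S))"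
    using assms(1) by (intro sum_group_weights) (auto simp: inj_on_def)
  also have "\<dots> = (-1) ^ m * (\<Sum>S | S \<subseteq> I \<and> odd (sum w S). tan_weight w (I - S))"
    unfolding sets by (simp add: sum_distrib_left)
  also have "\<dots> = (-1) ^ m * (1 - half_sign (nodd w I) * euler_number (nodd w I))"
    using assms by (simp add: sum_odd_subsets_tan_weight)
  finally show ?thesis by (simp add: right_diff_distrib)
qed

section \<open>Umbral evaluation of the specialised power sums\<close>

lemma umbral_eq_sum:
  assumes "Polynomial.degree q \<le> N"
  shows "umbral q = (\<Sum>k\<le>N. Polynomial.coeff q k * euler_number k)"
  unfolding umbral_def using assms
  by (intro sum.mono_neutral_left) (auto simp: coeff_eq_0)

lemma umbral_add: "umbral (p + q) = umbral p + umbral q"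
proof -
  let ?N = "max (Polynomial.degree p) (Polynomial.degree q)"
  have "Polynomial.degree (p + q) \<le> ?N" by (rule degree_add_le_max)
  then show ?thesis
    by (simp add: umbral_eq_sum[of _ ?N] sum.distrib distrib_right)
qed

lemma umbral_smult: "umbral (smult c q) = c * umbral q"
  using umbral_eq_sum[OF degree_smult_le[of c q]] by (simp add: umbral_def sum_distrib_left mult.assoc)

lemma umbral_sum_smult: "umbral (\<Sum>x\<in>A. smult (c x) (q x)) = (\<Sum>x\<in>A. c x * umbral (q x))"
proof (induction A rule: infinite_finite_induct)
  case (insert x A)
  then show ?case by (simp add: umbral_add umbral_smult)
qed (simp_all add: umbral_def)

lemma umbral_monom: "umbral (monom c k) = c * euler_number k"
  by (subst umbral_eq_sum[OF degree_monom_le], subst sum.mono_neutral_right[of _ "{k}"]) auto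

lemma minus_one_power_monom: "(-1) ^ k = monom ((-1) ^ k :: rat) 0"
  by (induction k) (simp_all add: monom_0 one_pCons)

lemma indeterminate_monom: "[:0, 1:] = monom (1 :: rat) 1"
  by (simp add: monom_altdef)

text \<open>Umbral evaluation is linear but not multiplicative, so the product is collapsed first:
  every odd part gives one factor E and every part a sign, which leaves a single monomial.\<close>

lemma prod_list_seq_plus:
  "prod_list (map seq_plus l) =
     monom ((-1) ^ (sum_list (map (\<lambda>x. x div 2) l) + length (filter even l))) (length (filter odd l))"
  by (induction l)
     (auto simp: seq_plus_def minus_one_power_monom indeterminate_monom mult_monom power_add mult.assoc add.commute minus_monom
        simp flip: One_nat_def)

lemma prod_list_seq_minus:
  "prod_list (map seq_minus l) = monom ((-1) ^ sum_list (map (\<lambda>x. x div 2) l)) (length (filter odd l))"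
  by (induction l)
     (auto simp: seq_minus_def minus_one_power_monom indeterminate_monom mult_monom power_add mult.assoc add.commute minus_monom
        simp flip: One_nat_def)

lemma prod_list_seq_zero:
  "prod_list (map seq_zero l) = (if filter even l = [] then
     monom ((-1) ^ sum_list (map (\<lambda>x. x div 2) l)) (length (filter odd l)) else 0)"
  by (induction l)
     (auto simp: seq_zero_def minus_one_power_monom indeterminate_monom mult_monom power_add mult.assoc add.commute minus_monom
        simp flip: One_nat_def)

text \<open>A part is twice its half plus its parity. This ties the sign exponent of the substituted
  sequences to n and the number of odd parts.\<close>

lemma sum_list_half: "2 * sum_list (map (\<lambda>x. x div 2) l) + length (filter odd l) = sum_list (l :: nat list)"
  by (induction l) (auto elim!: evenE oddE)

text \<open>The global sign of the ribbon sum absorbs \<open>half_sign\<close> and leaves the sign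
  given by the halved parts.\<close>

lemma half_sign_exponent:
  "m = h + a div 2 \<Longrightarrow> (-1) ^ m * (half_sign a * x) = (-1) ^ h * x"
  by (simp add: power_add)

text \<open>Both sides are linear in \<open>f\<close> and products of power sums span, so a ribbon
  is settled by its coarsening sums on these products.\<close>

lemma hall_inner_ribbon_schur_umbral:
  assumes f: "f \<in> homogeneous_symmetric (sum_list \<alpha>)"
    and eq: "\<And>l. l \<in> parts (sum_list \<alpha>) \<Longrightarrow>
      coarse_sum \<alpha> (pcoeff ((!) l) {..<length l}) = umbral (prod_list (map a l))"
  shows "hall_inner f (ribbon_schur \<alpha>) = umbral (power_sum_subst f a)"
proof -
  let ?n = "sum_list \<alpha>"
  obtain c where c: "f = (\<Sum>l\<in>parts ?n. mconst (c l) * power_sum_list l)"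
    using power_sum_expansion_exists[OF f] .
  have p: "mcoeff (power_sum_list l) (Poly_Mapping.nth \<beta>) = pcoeff ((!) l) {..<length l} \<beta>" for l \<beta>
    by (simp add: pcoeff_def prod.list_conv_set_nth atLeast0LessThan)
  have "hall_inner f (ribbon_schur \<alpha>) = coarse_sum \<alpha> (\<lambda>\<beta>. mcoeff f (Poly_Mapping.nth \<beta>))"
    using hall_inner_ribbon_schur[OF f] by (simp add: coarse_sum_def)
  also have "\<dots> = coarse_sum \<alpha> (\<lambda>\<beta>. \<Sum>l\<in>parts ?n. c l * pcoeff ((!) l) {..<length l} \<beta>)"
    by (simp add: c p)
  also have "\<dots> = (\<Sum>l\<in>parts ?n. c l * umbral (prod_list (map a l)))"
    by (simp add: coarse_sum_sum coarse_sum_scale eq)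
  also have "\<dots> = umbral (power_sum_subst f a)"
    by (simp add: c power_sum_subst_expansion umbral_sum_smult)
  finally show ?thesis .
qed

theorem theorem2p3:
  fixes n :: nat and f :: mseries
  assumes "n \<ge> 1" and "f \<in> homogeneous_symmetric n"
  shows "(odd n \<longrightarrow>
           hall_inner f (ribbon_schur (alternating_comp n)) =
             umbral (power_sum_subst f seq_zero) \<and>
           hall_inner f (ribbon_schur (reverse_alternating_comp n)) =
             umbral (power_sum_subst f seq_zero)) \<and>
         (even n \<longrightarrow>
           hall_inner f (ribbon_schur (alternating_comp n)) =
             umbral (power_sum_subst f seq_minus) \<and>
           hall_inner f (ribbon_schur (reverse_alternating_comp n)) =
             umbral (power_sum_subst f seq_plus))"
proof -
  have pos: "l ! j > 0" if "l \<in> parts n" "j \<in> {..<length l}" for l j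
  proof -
    have "l ! j \<in> set l" "0 \<notin> set l" using that by (auto simp: parts_def is_partition_def)
    then show ?thesis by (metis gr0I)
  qed
  have wt: "sum ((!) l) {..<length l} = n" if "l \<in> parts n" for l
    using that by (simp add: parts_def sum_list_sum_nth atLeast0LessThan)
  have nodd: "nodd ((!) l) {..<length l} = length (filter odd l)" for l
    by (simp add: nodd_def length_filter_conv_card)
  have neven: "neven ((!) l) {..<length l} = length (filter even l)" for l
    by (simp add: neven_def length_filter_conv_card)
  have half: "2 * sum_list (map (\<lambda>x. x div 2) l) + length (filter odd l) = n" if "l \<in> parts n" for l
    using that sum_list_half[of l] by (simp add: parts_def)
  show ?thesis
  proof (cases "even n")
    case False
    then obtain m where m: "n = 2 * m + 1" by (rule oddE)
    have tan: "(-1) ^ m * tan_weight ((!) l) {..<length l} = umbral (prod_list (map seq_zero l))"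
      if "l \<in> parts n" for l
    proof -
      have "m = sum_list (map (\<lambda>x. x div 2) l) + length (filter odd l) div 2"
        using half[OF that] m by presburger
      then show ?thesis
        by (auto simp: tan_weight_def nodd neven prod_list_seq_zero umbral_monom half_sign_exponent)
           (simp_all add: umbral_def)
    qed
    have "hall_inner f (ribbon_schur (1 # replicate m 2)) = umbral (power_sum_subst f seq_zero)"
    proof (rule hall_inner_ribbon_schur_umbral)
      fix l assume "l \<in> parts (sum_list (1 # replicate m 2))"
      then have l: "l \<in> parts n" using m by (simp add: sum_list_replicate mult.commute)
      show "coarse_sum (1 # replicate m 2) (pcoeff ((!) l) {..<length l}) =
          umbral (prod_list (map seq_zero l))"
        unfolding tan[OF l, symmetric]
        by (rule coarse_sum_one_evens) (use pos[OF l] wt[OF l] m in auto)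
    qed (use assms m in \<open>simp add: sum_list_replicate mult.commute\<close>)
    moreover have "hall_inner f (ribbon_schur (replicate m 2 @ [1])) = umbral (power_sum_subst f seq_zero)"
    proof (rule hall_inner_ribbon_schur_umbral)
      fix l assume "l \<in> parts (sum_list (replicate m 2 @ [1]))"
      then have l: "l \<in> parts n" using m by (simp add: sum_list_replicate mult.commute)
      show "coarse_sum (replicate m 2 @ [1]) (pcoeff ((!) l) {..<length l}) =
          umbral (prod_list (map seq_zero l))"
        unfolding tan[OF l, symmetric]
        by (rule coarse_sum_evens_one) (use pos[OF l] wt[OF l] m in auto)
    qed (use assms m in \<open>simp add: sum_list_replicate mult.commute\<close>)
    ultimately show ?thesis
      using m by (simp add: alternating_comp_def reverse_alternating_comp_def)
  next
    case True
    then obtain k where k: "n = 2 * k" by (rule evenE)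
    \<comment> \<open>\<open>m\<close> counts the 2s between the two 1s of the alternating
      composition; \<open>n \<ge> 1\<close> makes \<open>k\<close> positive, and the reverse
      composition has \<open>Suc m\<close> 2s.\<close>
    define m where "m = k - 1"
    have m: "n = 2 * m + 2" using k assms(1) by (simp add: m_def)
    have sign: "Suc m = sum_list (map (\<lambda>x. x div 2) l) + length (filter odd l) div 2" if "l \<in> parts n" for l
      using half[OF that] m by presburger
    have "hall_inner f (ribbon_schur (1 # replicate m 2 @ [1])) = umbral (power_sum_subst f seq_minus)"
    proof (rule hall_inner_ribbon_schur_umbral)
      fix l assume "l \<in> parts (sum_list (1 # replicate m 2 @ [1]))"
      then have l: "l \<in> parts n" using m by (simp add: sum_list_replicate mult.commute)
      show "coarse_sum (1 # replicate m 2 @ [1]) (pcoeff ((!) l) {..<length l}) =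
          umbral (prod_list (map seq_minus l))"
        using coarse_sum_one_evens_one[of "{..<length l}" "(!) l" m] pos[OF l] wt[OF l] m
          half_sign_exponent[OF sign[OF l]]
        by (simp add: nodd prod_list_seq_minus umbral_monom)
    qed (use assms m in \<open>simp add: sum_list_replicate mult.commute\<close>)
    moreover have "hall_inner f (ribbon_schur (replicate (Suc m) 2)) = umbral (power_sum_subst f seq_plus)"
    proof (rule hall_inner_ribbon_schur_umbral)
      fix l assume "l \<in> parts (sum_list (replicate (Suc m) 2))"
      then have l: "l \<in> parts n" using m by (simp add: sum_list_replicate mult.commute)
      show "coarse_sum (replicate (Suc m) 2) (pcoeff ((!) l) {..<length l}) =
          umbral (prod_list (map seq_plus l))"
        using coarse_sum_evens[of "{..<length l}" "(!) l" "Suc m"] pos[OF l] wt[OF l] m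
          half_sign_exponent[OF sign[OF l], of "(-1) ^ length (filter even l) * euler_number (length (filter odd l))"]
        by (simp add: nodd neven sec_weight_def prod_list_seq_plus umbral_monom power_add mult_ac)
    qed (use assms m in \<open>simp add: sum_list_replicate mult.commute\<close>)
    ultimately show ?thesis
      using m by (simp add: alternating_comp_def reverse_alternating_comp_def)
  qed
qed

end
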